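(* Let $\mathbf{A}\in\mathbb{R}^{d\times d}$ be symmetric positive definite with eigenvalues $\lambda_1\ge\cdots\ge\lambda_d$ and $\kappa=\lambda_1/\lambda_d$. Let $\mathbf{b}^{(1)},\dots,\mathbf{b}^{(m)}\in\mathbb{R}^d$ be independent standard Gaussian random vectors. Suppose $$r\le(m-1)\left\lceil\frac{\log(m/\delta)}{\log(100)}\right\rceil^{-1}-2.$$ Then, with probability at least $1-\delta$, the block-Lanczos square root iterates $\mathrm{bsq}_t^{(i)}$ for $\mathbf{B}=[\mathbf{b}^{(1)}~\cdots~\mathbf{b}^{(m)}]$ satisfy $$\left\{\forall i:\ \frac{\|\mathbf{A}^{1/2}\mathbf{b}^{(i)}-\mathrm{bsq}_t^{(i)}\|}{\|\mathbf{A}^{1/2}\|\,\|\mathbf{b}^{(i)}\|}\le\log(16\kappa)\exp\left(-\frac{t-(2+\log(d)/2)}{3\sqrt{\kappa_{r+1}(0)}}\right)\right\}.$$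
   Context: $\mathbf{A}_\mu=\mathbf{A}+\mu\mathbf{I}$; $\kappa_{r+1}(\mu)=(\lambda_{r+1}+\mu)/(\lambda_d+\mu)$, so $\kappa_{r+1}(0)=\lambda_{r+1}/\lambda_d$; $\|\cdot\|$ is the Euclidean norm for vectors and the spectral norm for matrices; $\|\mathbf{x}\|_{\mathbf{M}}=\sqrt{\mathbf{x}^{\mathsf T}\mathbf{M}\mathbf{x}}$. Here $\delta\in(0,1)$, $r,m,t$ are integers with $0\le r<d$, $t\ge 0$, and $\log$ is the natural logarithm. Krylov subspaces: $\mathcal{K}_t(\mathbf{M},\mathbf{v})=\operatorname{span}\{\mathbf{v},\mathbf{M}\mathbf{v},\dots,\mathbf{M}^{t-1}\mathbf{v}\}$, and for a matrix $\mathbf{V}$ with columns $\mathbf{v}^{(1)},\dots,\mathbf{v}^{(k)}$, $\mathcal{K}_t(\mathbf{M},\mathbf{V})=\mathcal{K}_t(\mathbf{M},\mathbf{v}^{(1)})+\cdots+\mathcal{K}_t(\mathbf{M},\mathbf{v}^{(k)})$. Block-CG: for $\mathbf{B}=[\mathbf{b}^{(1)}~\cdots~\mathbf{b}^{(m)}]$, $\mathrm{bcg}_t^{(i)}(\mu)=\operatorname{argmin}\{\|\mathbf{A}_\mu^{-1}\mathbf{b}^{(i)}-\mathbf{x}\|_{\mathbf{A}_\mu}:\mathbf{x}\in\mathcal{K}_t(\mathbf{A}_\mu,\mathbf{B})\}$. Block-Lanczos square root iterate: $\mathrm{bsq}_t^{(i)}:=\frac2\pi\int_0^\infty\mathbf{A}\,\mathrm{bcg}_t^{(i)}(z^2)\,\mathrm{d}z$.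 *)

theory Defs
  imports "HOL-Probability.Probability"
begin

text \<open>
  Matrices have type \<open>real^'d^'d\<close>, so the dimension is \<open>d = CARD('d)\<close>. The vectors
  \<open>b 1, \<dots>, b m\<close> and the eigenvalues \<open>lam 1, \<dots>, lam d\<close> are functions on \<open>nat\<close> that are only
  used on \<open>{1..m}\<close> and \<open>{1..d}\<close>.
\<close>

definition sym_pos_def :: "real^'d^'d \<Rightarrow> bool" where
  "sym_pos_def A \<longleftrightarrow> transpose A = A \<and> (\<forall>x. x \<noteq> 0 \<longrightarrow> 0 < x \<bullet> (A *v x))"

definition sym_pos_semidef :: "real^'d^'d \<Rightarrow> bool" where
  "sym_pos_semidef A \<longleftrightarrow> transpose A = A \<and> (\<forall>x. 0 \<le> x \<bullet> (A *v x))"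

definition matrix_sqrt :: "real^'d^'d \<Rightarrow> real^'d^'d" where
  "matrix_sqrt A = (THE S. sym_pos_semidef S \<and> S ** S = A)"

text \<open>
  The eigenvalues listed with algebraic multiplicity (roots of the characteristic polynomial)
  in nonincreasing order; this determines \<open>lam\<close> on \<open>{1..d}\<close>.
\<close>
definition ordered_eigenvalues :: "real^'d^'d \<Rightarrow> (nat \<Rightarrow> real) \<Rightarrow> bool" where
  "ordered_eigenvalues A lam \<longleftrightarrow>
     (\<forall>x. det (mat x - A) = (\<Prod>k\<in>{1..CARD('d)}. (x - lam k))) \<and>
     (\<forall>j\<in>{1..CARD('d)}. \<forall>k\<in>{1..CARD('d)}. j \<le> k \<longrightarrow> lam k \<le> lam j)"

text \<open>The quantity \<open>\<kappa>\<^sub>k(\<mu>)\<close>; the condition number is \<open>\<kappa> = \<kappa>\<^sub>1(0)\<close>.\<close>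
definition shifted_cond :: "nat \<Rightarrow> (nat \<Rightarrow> real) \<Rightarrow> nat \<Rightarrow> real \<Rightarrow> real" where
  "shifted_cond d lam k \<mu> = (lam k + \<mu>) / (lam d + \<mu>)"

definition spectral_norm :: "real^'d^'d \<Rightarrow> real" where
  "spectral_norm A = onorm (\<lambda>x. A *v x)"

definition weighted_norm :: "real^'d^'d \<Rightarrow> real^'d \<Rightarrow> real" where
  "weighted_norm M x = sqrt (x \<bullet> (M *v x))"

text \<open>\<open>mat \<mu>\<close> is the scalar matrix \<open>\<mu> I\<close>.\<close>
definition shifted_matrix :: "real^'d^'d \<Rightarrow> real \<Rightarrow> real^'d^'d" where
  "shifted_matrix A \<mu> = A + mat \<mu>"

text \<open>
  Powers \<open>M\<^sup>j v\<close> are iterated matrix-vector products, since \<open>^\<close> on \<open>real^'d^'d\<close> is entrywise.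
\<close>
definition krylov :: "real^'d^'d \<Rightarrow> real^'d \<Rightarrow> nat \<Rightarrow> (real^'d) set" where
  "krylov M v t = span {((\<lambda>x. M *v x) ^^ j) v | j. j < t}"

text \<open>The sum is the Minkowski sum of sets from \<open>Set_Algebras\<close>, i.e. the sum of subspaces.\<close>
definition block_krylov :: "real^'d^'d \<Rightarrow> nat \<Rightarrow> (nat \<Rightarrow> real^'d) \<Rightarrow> nat \<Rightarrow> (real^'d) set" where
  "block_krylov M m v t = (\<Sum>i\<in>{1..m}. krylov M (v i) t)"

definition bcg :: "real^'d^'d \<Rightarrow> nat \<Rightarrow> (nat \<Rightarrow> real^'d) \<Rightarrow> nat \<Rightarrow> nat \<Rightarrow> real \<Rightarrow> real^'d" where
  "bcg A m b t i \<mu> =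
     arg_min
       (\<lambda>x. weighted_norm (shifted_matrix A \<mu>) (matrix_inv (shifted_matrix A \<mu>) *v b i - x))
       (\<lambda>x. x \<in> block_krylov (shifted_matrix A \<mu>) m b t)"

definition bsq :: "real^'d^'d \<Rightarrow> nat \<Rightarrow> (nat \<Rightarrow> real^'d) \<Rightarrow> nat \<Rightarrow> nat \<Rightarrow> real^'d" where
  "bsq A m b t i = (2 / pi) *\<^sub>R (LBINT z=0..\<infinity>. A *v bcg A m b t i (z\<^sup>2))"

definition (in prob_space) std_gaussian_vector :: "('a \<Rightarrow> real^'d) \<Rightarrow> bool" where
  "std_gaussian_vector X \<longleftrightarrow>
     indep_vars (\<lambda>_. borel) (\<lambda>j \<omega>. X \<omega> $ j) UNIV \<and>
     (\<forall>j. distributed M lborel (\<lambda>\<omega>. X \<omega> $ j) std_normal_density)"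

end

theory Submission
  imports Defs
begin

text \<open>
  The square root is an integral of resolvents,
  \<open>A\<^sup>1\<^sup>/\<^sup>2 b = (2/\<pi>) \<integral> A (A + z\<^sup>2 I)\<^sup>-\<^sup>1 b dz\<close> over \<open>z > 0\<close>, and the iterate replaces each resolvent
  by a block-CG solution. Hence it is enough to bound the block-CG error for every shift
  \<open>\<mu> = z\<^sup>2\<close> at once. If that error, in the energy norm, is at most \<open>2E\<close> times the initial one with
  \<open>E\<close> independent of \<open>\<mu>\<close>, then the error of the square root is at most a multiple of \<open>E\<close> times a
  complete elliptic integral in \<open>\<lambda>\<^sub>1\<close> and \<open>\<lambda>\<^sub>d\<close>, and this integral grows only like \<open>log \<kappa>\<close>
  (\<open>sqrt_error_from_shifted_errors\<close>).

  For a fixed shift, block CG is optimal in a space that also contains every step of a CG method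
  deflated by a subspace \<open>Q\<close> of that space. On the energy-orthogonal complement of \<open>Q\<close> the operator
  has spectrum in \<open>[\<lambda>\<^sub>d + \<mu>, 36 (\<lambda>\<^sub>r\<^sub>+\<^sub>1 + \<mu>)]\<close> if \<open>Q\<close> is good, and \<open>k\<close> Chebyshev steps then reduce the
  error by \<open>2 exp (-k / (3 \<surd>\<kappa>\<^sub>r\<^sub>+\<^sub>1(\<mu>)))\<close>, where \<open>3 = \<surd>36 / 2\<close>; moreover
  \<open>\<kappa>\<^sub>r\<^sub>+\<^sub>1(\<mu>) \<le> \<kappa>\<^sub>r\<^sub>+\<^sub>1(0)\<close>. The Chebyshev estimate is proved directly on vectors, through a quantity that
  the three-term recursion conserves (\<open>deflated_chebyshev\<close>).

  The subspace \<open>Q\<close> is spanned by vectors \<open>A\<^sup>p y\<^sub>j\<close>, where \<open>y\<^sub>j\<close> is a combination of \<open>r + 2\<close> of the random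
  vectors that agrees with the eigenvector \<open>v\<^sub>j\<close> on the top \<open>r\<close> eigendirections. What \<open>y\<^sub>j\<close> leaks into
  the other directions has total square at most \<open>100 r (d - r) \<le> 25 d\<^sup>2\<close> with probability at
  least \<open>99/100\<close>.
  Only eigenvalues above \<open>e\<^sup>2 \<lambda>\<^sub>r\<^sub>+\<^sub>1\<close> have to be deflated, and for them \<open>p \<ge> (log d) / 2\<close> power steps
  damp its square by \<open>e\<^sup>-\<^sup>4\<^sup>p \<le> d\<^sup>-\<^sup>2\<close>; this costs the additive \<open>2 + (log d) / 2\<close> in the exponent
  (\<open>block_krylov_approximation\<close>, \<open>bsq_error_bound\<close>).

  For the leakage, write the eigencoordinates of \<open>r + 2\<close> Gaussian vectors as rows. The component
  of row \<open>j\<close> orthogonal to the other top rows is Gaussian in a space of dimension at least 3, and the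
  coefficients of \<open>y\<^sub>j\<close> are this component divided by its squared length. As \<open>E[1/\<chi>\<^sup>2]\<close> equals 1 for 3 degrees of
  freedom, each of the \<open>r (d - r)\<close> squared entries has expectation at most 1, and Markov's
  inequality applies (\<open>measure_bad_rows\<close>). The hypothesis on \<open>r\<close> leaves room for
  \<open>\<lceil>log (m/\<delta>) / log 100\<rceil>\<close> disjoint groups of \<open>r + 2\<close> vectors, so that all groups fail with probability
  at most \<open>\<delta>\<close> (\<open>prob_all_groups_bad\<close>). One good group serves all right-hand sides.

  The error event also has to be measurable. Galerkin solutions depend discontinuously on the
  vectors that span the space, but they are limits of regularized solutions given by Cramer's rule
  (\<open>measurable_galerkin\<close>).
\<close>

section \<open>Orthonormal eigenbases of symmetric matrices\<close>

definition orthonormal_family :: "('i \<Rightarrow> 'a::real_inner) \<Rightarrow> bool" where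
  "orthonormal_family V \<longleftrightarrow> (\<forall>i j. V i \<bullet> V j = of_bool (i = j))"

lemma orthonormal_family_inj:
  assumes "orthonormal_family V"
  shows "inj V"
proof (rule injI)
  fix i j assume "V i = V j"
  then have "V i \<bullet> V j = V i \<bullet> V i" by simp
  then show "i = j" using assms by (auto simp: orthonormal_family_def of_bool_def split: if_splits)
qed

lemma orthonormal_family_of_set:
  fixes B :: "(real^'n) set"
  assumes B: "pairwise orthogonal B" "\<And>x. x \<in> B \<Longrightarrow> norm x = 1"
    and card: "finite B" "card B = CARD('n)"
  obtains V :: "'n \<Rightarrow> real^'n" where "orthonormal_family V" "range V = B"
proof -
  obtain V where V: "bij_betw V (UNIV :: 'n set) B"
    using card by (metis finite_class.finite_UNIV bij_betw_iff_card)
  have VB: "V i \<in> B" for i using V by (auto simp: bij_betw_def)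
  have "orthonormal_family V"
    unfolding orthonormal_family_def
  proof (intro allI)
    fix i j
    show "V i \<bullet> V j = of_bool (i = j)"
    proof (cases "i = j")
      case True
      then show ?thesis using B(2)[OF VB[of j]] by (simp add: norm_eq_sqrt_inner)
    next
      case False
      then have "V i \<noteq> V j" using V by (auto simp: bij_betw_def inj_on_def)
      then show ?thesis using B(1) VB False by (auto simp: pairwise_def orthogonal_def)
    qed
  qed
  moreover have "range V = B" using V by (auto simp: bij_betw_def)
  ultimately show ?thesis using that by blast
qed

lemma orthonormal_family_expand:
  fixes V :: "'n::finite \<Rightarrow> real^'n"
  assumes "orthonormal_family V"
  shows "(\<Sum>i\<in>UNIV. (x \<bullet> V i) *\<^sub>R V i) = x"
proof -
  have ip: "V i \<bullet> V j = of_bool (i = j)" for i j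
    using assms by (auto simp: orthonormal_family_def)
  note inj = orthonormal_family_inj[OF assms]
  let ?B = "range V"
  have po: "pairwise orthogonal ?B"
    by (auto simp: pairwise_def orthogonal_def ip)
  have nm: "norm v = 1" if "v \<in> ?B" for v
    using that ip by (auto simp: norm_eq_sqrt_inner)
  have z: "0 \<notin> ?B" using nm[of 0] by auto
  have ind: "independent ?B" by (rule pairwise_orthogonal_independent[OF po z])
  have "card ?B = CARD('n)" using inj by (simp add: card_image)
  then have "dim ?B = CARD('n)" using ind by (simp add: dim_eq_card_independent)
  then have "span ?B = UNIV" by (metis DIM_cart DIM_real dim_eq_full mult.right_neutral)
  then have "(\<Sum>v\<in>?B. (x \<bullet> v) *\<^sub>R v) = x"
    by (intro orthonormal_basis_expand[OF po]) (auto simp: nm)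
  then show ?thesis
    by (simp add: sum.reindex[OF inj])
qed

lemma orthonormal_family_inner:
  fixes V :: "'n::finite \<Rightarrow> real^'n"
  assumes "orthonormal_family V"
  shows "x \<bullet> y = (\<Sum>i\<in>UNIV. (x \<bullet> V i) * (y \<bullet> V i))"
proof -
  have "x \<bullet> y = x \<bullet> (\<Sum>i\<in>UNIV. (y \<bullet> V i) *\<^sub>R V i)"
    by (simp add: orthonormal_family_expand[OF assms])
  then show ?thesis by (simp add: inner_sum_right mult.commute)
qed

lemma symmetric_matrix_inner:
  fixes A :: "real^'n^'n"
  assumes "transpose A = A"
  shows "(A *v x) \<bullet> y = x \<bullet> (A *v y)"
  using dot_lmul_matrix[of x A y] assms by (simp add: transpose_matrix_vector[symmetric])

text \<open>
  This turns the maximality of a Rayleigh quotient into an eigenvector equation: along every line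
  through a zero, a nonnegative form has derivative 0 there.
\<close>

lemma nonneg_quadratic_linear_coeff_zero:
  fixes q0 b0 :: real
  assumes "\<And>t. 0 \<le> 2 * t * b0 + t\<^sup>2 * q0"
  shows "b0 = 0"
proof (rule ccontr)
  assume b: "b0 \<noteq> 0"
  define s where "s = \<bar>q0\<bar> + 1"
  have s: "s > 0" "q0 < s" by (auto simp: s_def)
  \<comment> \<open>the point at which \<open>2 t b0 + t\<^sup>2 s\<close> is minimal, for some \<open>s > q0\<close>\<close>
  have "0 \<le> 2 * (- b0 / s) * b0 + (- b0 / s)\<^sup>2 * q0" by (rule assms)
  also have "\<dots> = (b0\<^sup>2 / s) * (q0 / s - 2)"
    using s by (simp add: field_simps power2_eq_square)
  finally have "0 \<le> (b0\<^sup>2 / s) * (q0 / s - 2)" .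
  moreover have "b0\<^sup>2 / s > 0" using b s by simp
  moreover have "q0 / s - 2 < 0" using s by (simp add: field_simps)
  ultimately show False by (smt (verit) mult_pos_neg)
qed

text \<open>
  The Rayleigh quotient attains its maximum \<open>c\<close> on the unit sphere of the subspace, which is compact.
  At a maximizer \<open>v\<close> the form \<open>c (y \<bullet> y) - y \<bullet> A y\<close> is nonnegative on the subspace and vanishes, so its
  derivative in the direction \<open>c v - A v\<close> is 0.
\<close>

lemma symmetric_eigenvector_in_subspace:
  fixes A :: "real^'n^'n"
  assumes sym: "transpose A = A" and S: "subspace S" and inv: "\<And>x. x \<in> S \<Longrightarrow> A *v x \<in> S"
    and ne: "S \<noteq> {0}"
  obtains v c where "v \<in> S" "norm v = 1" "A *v v = c *\<^sub>R v"
proof -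
  let ?K = "sphere 0 1 \<inter> S"
  have comp: "compact ?K"
    by (intro compact_Int_closed compact_sphere closed_subspace S)
  obtain x0 where "x0 \<in> S" "x0 \<noteq> 0" using ne S subspace_0 by blast
  then have "inverse (norm x0) *\<^sub>R x0 \<in> ?K"
    using S by (auto intro: subspace_scale)
  then have nee: "?K \<noteq> {}" by blast
  have cont: "continuous_on ?K (\<lambda>x. x \<bullet> (A *v x))"
    by (intro continuous_intros linear_continuous_on matrix_vector_mul_bounded_linear)
  obtain v where v: "v \<in> ?K" and max: "\<And>y. y \<in> ?K \<Longrightarrow> y \<bullet> (A *v y) \<le> v \<bullet> (A *v v)"
    using continuous_attains_sup[OF comp nee cont] by blast
  define c where "c = v \<bullet> (A *v v)"
  have vS: "v \<in> S" and vn: "norm v = 1" using v by auto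
  have le: "y \<bullet> (A *v y) \<le> c * (y \<bullet> y)" if y: "y \<in> S" for y
  proof (cases "y = 0")
    case False
    have "inverse (norm y) *\<^sub>R y \<in> ?K" using False S y by (auto intro: subspace_scale)
    from max[OF this] have "inverse (norm y) * (inverse (norm y) * (y \<bullet> (A *v y))) \<le> c"
      by (simp add: c_def scaleR_matrix_vector_assoc[symmetric] matrix_vector_mult_scaleR)
    then have "(y \<bullet> (A *v y)) / (norm y)\<^sup>2 \<le> c"
      by (simp add: divide_inverse power2_eq_square mult_ac)
    then show ?thesis using False
      by (simp add: power2_norm_eq_inner[symmetric] pos_divide_le_eq)
  qed simp
  define w where "w = c *\<^sub>R v - A *v v"
  have wS: "w \<in> S" unfolding w_def using S vS inv by (intro subspace_diff subspace_scale) auto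
  have "w \<bullet> w = 0"
  proof (rule nonneg_quadratic_linear_coeff_zero[where ?q0.0 = "c * (w \<bullet> w) - w \<bullet> (A *v w)"])
    fix t :: real
    have "v + t *\<^sub>R w \<in> S" using S vS wS by (intro subspace_add subspace_scale)
    from le[OF this] have "0 \<le> c * ((v + t *\<^sub>R w) \<bullet> (v + t *\<^sub>R w)) - (v + t *\<^sub>R w) \<bullet> (A *v (v + t *\<^sub>R w))"
      by simp
    also have "\<dots> = c * (v \<bullet> v) - v \<bullet> (A *v v) + 2 * t * (c * (v \<bullet> w) - (A *v v) \<bullet> w) + t\<^sup>2 * (c * (w \<bullet> w) - w \<bullet> (A *v w))"
      unfolding matrix_vector_right_distrib matrix_vector_mult_scaleR inner_add_left inner_add_right
        inner_scaleR_left inner_scaleR_right symmetric_matrix_inner[OF sym, of v w, symmetric]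
        inner_commute[of w "A *v v"] inner_commute[of w v] power2_eq_square
      by algebra
    also have "c * (v \<bullet> v) - v \<bullet> (A *v v) = 0"
      using vn by (simp add: c_def norm_eq_sqrt_inner)
    also have "c * (v \<bullet> w) - (A *v v) \<bullet> w = w \<bullet> w"
      unfolding w_def inner_diff_left inner_scaleR_left ..
    finally show "0 \<le> 2 * t * (w \<bullet> w) + t\<^sup>2 * (c * (w \<bullet> w) - w \<bullet> (A *v w))" by simp
  qed
  then have "A *v v = c *\<^sub>R v" by (simp add: w_def)
  with vS vn that show ?thesis by blast
qed

text \<open>
  The spectral theorem, by splitting off one eigenvector: symmetry makes the orthogonal complement of
  an eigenvector invariant again. The statement speaks of invariant subspaces so that the induction on
  the dimension goes through.
\<close>

lemma symmetric_orthonormal_eigenbasis_subspace: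
  fixes A :: "real^'n^'n"
  assumes sym: "transpose A = A" and S: "subspace S" and inv: "\<And>x. x \<in> S \<Longrightarrow> A *v x \<in> S"
  shows "\<exists>B. finite B \<and> pairwise orthogonal B \<and> (\<forall>x\<in>B. norm x = 1 \<and> (\<exists>c. A *v x = c *\<^sub>R x)) \<and> span B = S"
  using S inv
proof (induction "dim S" arbitrary: S rule: less_induct)
  case less
  show ?case
  proof (cases "S = {0}")
    case True
    then show ?thesis by (intro exI[of _ "{}"]) auto
  next
    case False
    obtain v c where v: "v \<in> S" "norm v = 1" "A *v v = c *\<^sub>R v"
      using symmetric_eigenvector_in_subspace[OF sym less.prems(1) less.prems(2) False] by blast
    have vv: "v \<bullet> v = 1" using v by (simp add: norm_eq_sqrt_inner)
    define S' where "S' = {x \<in> S. v \<bullet> x = 0}"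
    have S': "subspace S'" unfolding S'_def using less.prems(1)
      by (auto simp: subspace_def inner_add_right)
    have "v \<notin> S'" using vv by (simp add: S'_def)
    then have "S' \<subset> S" using v(1) unfolding S'_def by blast
    then have dim: "dim S' < dim S"
      by (metis S' less.prems(1) dim_psubset span_eq_iff)
    have inv': "A *v x \<in> S'" if "x \<in> S'" for x
    proof -
      have "v \<bullet> (A *v x) = (A *v v) \<bullet> x" by (simp add: symmetric_matrix_inner[OF sym])
      then show ?thesis using that less.prems(2) v by (auto simp: S'_def)
    qed
    obtain B where B: "finite B" "pairwise orthogonal B"
      "\<forall>x\<in>B. norm x = 1 \<and> (\<exists>c. A *v x = c *\<^sub>R x)" "span B = S'"
      using less.hyps[OF dim S' inv'] by blast
    have BS': "B \<subseteq> S'" using B(4) span_superset by blast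
    show ?thesis
    proof (intro exI[of _ "insert v B"] conjI)
      show "pairwise orthogonal (insert v B)"
        using B(2) BS' by (auto simp: pairwise_insert S'_def orthogonal_def inner_commute)
      show "span (insert v B) = S"
      proof
        show "span (insert v B) \<subseteq> S"
          using BS' v less.prems(1) by (intro span_minimal) (auto simp: S'_def)
        show "S \<subseteq> span (insert v B)"
        proof
          fix x assume x: "x \<in> S"
          have "x - (v \<bullet> x) *\<^sub>R v \<in> S'"
            using x v vv less.prems(1) by (auto simp: S'_def inner_diff_right intro: subspace_diff subspace_scale)
          then have "x - (v \<bullet> x) *\<^sub>R v \<in> span B" using B by simp
          then show "x \<in> span (insert v B)" using span_breakdown_eq by blast
        qed
      qed
    qed (use B v in auto)
  qed
qed

theorem symmetric_matrix_orthonormal_eigenbasis: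
  fixes A :: "real^'n^'n"
  assumes sym: "transpose A = A"
  obtains V :: "'n \<Rightarrow> real^'n" and evl :: "'n \<Rightarrow> real"
    where "orthonormal_family V" "\<And>i. A *v V i = evl i *\<^sub>R V i"
proof -
  obtain B where B: "finite B" "pairwise orthogonal B"
      "\<forall>x\<in>B. norm x = 1 \<and> (\<exists>c. A *v x = c *\<^sub>R x)" "span B = UNIV"
    using symmetric_orthonormal_eigenbasis_subspace[OF sym, of UNIV] by auto
  have "0 \<notin> B" using B(3) by force
  then have "independent B" by (rule pairwise_orthogonal_independent[OF B(2)])
  then have "card B = dim (span B)" by (simp add: dim_eq_card_independent)
  then have "card B = CARD('n)" by (simp add: B(4))
  obtain V :: "'n \<Rightarrow> real^'n" where V: "orthonormal_family V" "range V = B"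
    by (rule orthonormal_family_of_set[OF B(2) _ B(1) \<open>card B = CARD('n)\<close>]) (use B(3) that in auto)
  then have "\<forall>i. \<exists>c. A *v V i = c *\<^sub>R V i" using B(3) by blast
  then obtain evl where "\<And>i. A *v V i = evl i *\<^sub>R V i" using choice[of "\<lambda>i c. A *v V i = c *\<^sub>R V i"] by blast
  with V(1) that show ?thesis by blast
qed

lemma sym_pos_defD:
  assumes "sym_pos_def M"
  shows "transpose M = M" "x \<noteq> 0 \<Longrightarrow> 0 < x \<bullet> (M *v x)" "0 \<le> x \<bullet> (M *v x)"
    "(M *v x) \<bullet> y = x \<bullet> (M *v y)"
proof -
  show "transpose M = M" "x \<noteq> 0 \<Longrightarrow> 0 < x \<bullet> (M *v x)"
    using assms by (auto simp: sym_pos_def_def)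
  then show "0 \<le> x \<bullet> (M *v x)" "(M *v x) \<bullet> y = x \<bullet> (M *v y)"
    by (cases "x = 0"; simp add: symmetric_matrix_inner less_imp_le)+
qed

lemma sym_pos_def_eigenbasis:
  assumes "sym_pos_def (A :: real^'n^'n)"
  obtains V :: "'n \<Rightarrow> real^'n" and evl :: "'n \<Rightarrow> real"
    where "orthonormal_family V" "\<And>i. A *v V i = evl i *\<^sub>R V i" "\<And>i. evl i > 0"
proof -
  obtain V :: "'n \<Rightarrow> real^'n" and evl where V: "orthonormal_family V" "\<And>i. A *v V i = evl i *\<^sub>R V i"
    by (rule symmetric_matrix_orthonormal_eigenbasis[OF sym_pos_defD(1)[OF assms]]) (rule that)
  have "evl i > 0" for i
  proof -
    have "V i \<bullet> V i = 1" using V(1) by (auto simp: orthonormal_family_def)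
    moreover from this have "V i \<noteq> 0" by auto
    ultimately show ?thesis using sym_pos_defD(2)[OF assms, of "V i"] V(2)[of i] by simp
  qed
  with V that show ?thesis by blast
qed

lemma sym_pos_def_invertible:
  assumes "sym_pos_def M"
  shows "invertible M"
proof -
  have "x = 0" if "M *v x = 0" for x
    using that sym_pos_defD(2)[OF assms, of x] by (metis inner_zero_right less_irrefl)
  then show ?thesis
    using invertible_left_inverse matrix_left_invertible_ker by blast
qed

lemma sym_pos_def_inv_mult:
  assumes "sym_pos_def M"
  shows "M *v (matrix_inv M *v x) = x" "matrix_inv M *v (M *v x) = x"
proof -
  have "M ** matrix_inv M = mat 1 \<and> matrix_inv M ** M = mat 1"
    using sym_pos_def_invertible[OF assms] unfolding invertible_def matrix_inv_def by (rule someI_ex)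
  then show "M *v (matrix_inv M *v x) = x" "matrix_inv M *v (M *v x) = x"
    by (simp_all add: matrix_vector_mul_assoc)
qed

section \<open>The ordered list of eigenvalues\<close>

text \<open>
  Unique factorization into linear factors, in the form of a matching of the index sets. It relates
  the list of eigenvalues, which is defined through the characteristic polynomial, to an eigenbasis.
\<close>

lemma linear_factors_matching:
  fixes a :: "'i \<Rightarrow> real" and c :: "'j \<Rightarrow> real"
  assumes "finite I" "finite J" "(\<Prod>i\<in>I. [:- a i, 1:]) = (\<Prod>j\<in>J. [:- c j, 1:])"
  shows "\<exists>\<sigma>. bij_betw \<sigma> I J \<and> (\<forall>i\<in>I. c (\<sigma> i) = a i)"
  using assms
proof (induction I arbitrary: J rule: finite_induct)
  case empty
  have "J = {}"
  proof (rule ccontr)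
    assume "J \<noteq> {}"
    then obtain j where "j \<in> J" by blast
    then have "poly (\<Prod>j\<in>J. [:- c j, 1:]) (c j) = 0"
      using empty.prems(1) by (auto simp: poly_prod)
    with empty.prems(2) show False by (metis poly_1 prod.empty zero_neq_one)
  qed
  then show ?case by (auto simp: bij_betw_def)
next
  case (insert i0 I)
  have "poly (\<Prod>i\<in>insert i0 I. [:- a i, 1:]) (a i0) = 0"
    using insert.hyps by (simp add: poly_prod)
  then have "poly (\<Prod>j\<in>J. [:- c j, 1:]) (a i0) = 0" using insert.prems(2) by simp
  then obtain j0 where j0: "j0 \<in> J" "c j0 = a i0"
    using insert.prems(1) by (auto simp: poly_prod)
  have "[:- a i0, 1:] * (\<Prod>i\<in>I. [:- a i, 1:]) = [:- a i0, 1:] * (\<Prod>j\<in>J - {j0}. [:- c j, 1:])"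
    using insert.prems insert.hyps j0 by (simp add: prod.remove[of J j0])
  then have "(\<Prod>i\<in>I. [:- a i, 1:]) = (\<Prod>j\<in>J - {j0}. [:- c j, 1:])"
    by (subst (asm) mult_left_cancel) auto
  from insert.IH[OF _ this] insert.prems(1) obtain \<sigma> where
    \<sigma>: "bij_betw \<sigma> I (J - {j0})" "\<forall>i\<in>I. c (\<sigma> i) = a i" by auto
  let ?\<tau> = "\<sigma>(i0 := j0)"
  have "?\<tau> ` I = \<sigma> ` I" "inj_on ?\<tau> I \<longleftrightarrow> inj_on \<sigma> I"
    using insert.hyps by (auto intro!: image_cong inj_on_cong)
  then have "bij_betw ?\<tau> (insert i0 I) J"
    using \<sigma>(1) insert.hyps j0 by (auto simp: bij_betw_def)
  moreover have "\<forall>i\<in>insert i0 I. c (?\<tau> i) = a i"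
    using \<sigma>(2) j0 insert.hyps by auto
  ultimately show ?case by blast
qed

text \<open>
  An orthogonal matrix whose columns form the eigenbasis conjugates \<open>A\<close> to a diagonal matrix, so both
  families of numbers are the roots of the same characteristic polynomial.
\<close>

lemma ordered_eigenvalues_enumerate:
  fixes A :: "real^'n^'n" and V :: "'n \<Rightarrow> real^'n"
  assumes V: "orthonormal_family V" "\<And>i. A *v V i = evl i *\<^sub>R V i"
    and lam: "ordered_eigenvalues A lam"
  obtains \<sigma> where "bij_betw \<sigma> {1..CARD('n)} (UNIV :: 'n set)"
    "\<And>k. k \<in> {1..CARD('n)} \<Longrightarrow> evl (\<sigma> k) = lam k"
proof -
  define P :: "real^'n^'n" where "P = (\<chi> i j. V j $ i)"
  have ip: "V i \<bullet> V j = of_bool (i = j)" for i j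
    using V by (auto simp: orthonormal_family_def)
  have PP: "transpose P ** P = mat 1"
    using ip by (simp add: P_def matrix_matrix_mult_def transpose_def mat_def vec_eq_iff inner_vec_def)
  have "det P * det P = 1" using PP by (metis det_I det_mul det_transpose)
  then have dP: "det P \<noteq> 0" by auto
  have colP: "M ** P = (\<chi> i j. (M *v V j) $ i)" for M :: "real^'n^'n"
    by (simp add: P_def matrix_matrix_mult_def matrix_vector_mult_def vec_eq_iff)
  have charpoly: "det (mat x - A) = (\<Prod>i\<in>UNIV. x - evl i)" for x
  proof -
    define D :: "real^'n^'n" where "D = (\<chi> i j. if i = j then x - evl i else 0)"
    have mx: "mat x *v w = x *\<^sub>R w" for w :: "real^'n"
      by (simp add: mat_def matrix_vector_mult_def vec_eq_iff if_distrib if_distribR sum.delta' cong: if_cong)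
    have "(mat x - A) ** P = (\<chi> i j. ((x - evl j) *\<^sub>R V j) $ i)"
      unfolding colP by (simp add: matrix_vector_mult_diff_rdistrib mx V(2) algebra_simps)
    also have "\<dots> = P ** D"
      by (simp add: P_def D_def matrix_matrix_mult_def vec_eq_iff if_distrib if_distribR sum.delta' mult.commute cong: if_cong)
    finally have "det (mat x - A) * det P = det P * det D" by (metis det_mul)
    then have "det (mat x - A) = det D" using dP by simp
    also have "\<dots> = (\<Prod>i\<in>UNIV. x - evl i)"
      by (subst det_diagonal) (auto simp: D_def)
    finally show ?thesis .
  qed
  have "poly (\<Prod>k\<in>{1..CARD('n)}. [:- lam k, 1:]) x = poly (\<Prod>i\<in>UNIV. [:- evl i, 1:]) x" for x
  proof -
    have "(\<Prod>k\<in>{1..CARD('n)}. x - lam k) = (\<Prod>i\<in>UNIV. x - evl i)"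
      using lam charpoly[of x] by (auto simp: ordered_eigenvalues_def)
    then show ?thesis by (simp add: poly_prod)
  qed
  then have "(\<Prod>k\<in>{1..CARD('n)}. [:- lam k, 1:]) = (\<Prod>i\<in>UNIV. [:- evl i, 1:])"
    by (intro poly_eq_poly_eq_iff[THEN iffD1] ext)
  from linear_factors_matching[OF _ _ this] that show ?thesis by auto
qed

lemma mat_mult_vec: "mat c *v x = c *\<^sub>R (x :: real^'n)"
  by (simp add: mat_def matrix_vector_mult_def vec_eq_iff if_distrib if_distribR sum.delta' cong: if_cong)

section \<open>The square root of a positive definite matrix\<close>

definition spectral_matrix :: "('n::finite \<Rightarrow> real^'n) \<Rightarrow> ('n \<Rightarrow> real) \<Rightarrow> real^'n^'n" where
  "spectral_matrix V c = (\<chi> k l. \<Sum>i\<in>UNIV. c i * V i $ k * V i $ l)"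

lemma spectral_matrix_mult:
  "spectral_matrix V c *v x = (\<Sum>i\<in>UNIV. (c i * (V i \<bullet> x)) *\<^sub>R V i)"
proof -
  have "(\<Sum>l\<in>UNIV. (\<Sum>i\<in>UNIV. c i * V i $ k * V i $ l) * x $ l)
      = (\<Sum>i\<in>UNIV. c i * (\<Sum>l\<in>UNIV. V i $ l * x $ l) * V i $ k)" for k
    unfolding sum_distrib_right sum_distrib_left
    by (subst sum.swap) (simp add: algebra_simps)
  then show ?thesis
    by (simp add: spectral_matrix_def matrix_vector_mult_def vec_eq_iff inner_vec_def)
qed

lemma transpose_spectral_matrix: "transpose (spectral_matrix V c) = spectral_matrix V c"
  by (simp add: spectral_matrix_def transpose_def vec_eq_iff algebra_simps)

lemma spectral_matrix_eigen:
  assumes "orthonormal_family V"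
  shows "spectral_matrix V c *v V j = c j *\<^sub>R V j"
proof -
  have "(c i * (V i \<bullet> V j)) *\<^sub>R V i = (if i = j then c j *\<^sub>R V j else 0)" for i
    using assms by (auto simp: orthonormal_family_def)
  then show ?thesis by (simp add: spectral_matrix_mult)
qed

lemma matrix_eq_on_orthonormal_family:
  fixes A B :: "real^'n^'n" and V :: "'n \<Rightarrow> real^'n"
  assumes V: "orthonormal_family V" and eq: "\<And>i. A *v V i = B *v V i"
  shows "A = B"
proof -
  have "A *v x = B *v x" for x
  proof -
    have "M *v x = (\<Sum>i\<in>UNIV. (x \<bullet> V i) *\<^sub>R (M *v V i))" for M :: "real^'n^'n"
      by (subst orthonormal_family_expand[OF V, of x, symmetric])
        (simp add: linear_sum[OF matrix_vector_mul_linear] matrix_vector_mult_scaleR o_def)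
    then show ?thesis by (simp add: eq)
  qed
  then show ?thesis by (simp add: matrix_eq)
qed

text \<open>
  The spectral matrix with eigenvalues \<open>\<surd>\<lambda>\<^sub>i\<close> is a positive semidefinite root of \<open>A\<close>. It is the only
  one: if \<open>S\<close> is another and \<open>s = \<surd>\<lambda>\<^sub>i\<close>, then \<open>(S + s) (S - s) v\<^sub>i = 0\<close> and \<open>S + s\<close> is positive definite,
  so \<open>S v\<^sub>i = s v\<^sub>i\<close>.
\<close>

lemma matrix_sqrt_eigen:
  fixes A :: "real^'n^'n" and V :: "'n \<Rightarrow> real^'n"
  assumes V: "orthonormal_family V" "\<And>i. A *v V i = evl i *\<^sub>R V i" and pos: "\<And>i. evl i > 0"
  shows "matrix_sqrt A *v V i = sqrt (evl i) *\<^sub>R V i"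
    and "sym_pos_semidef (matrix_sqrt A)" and "matrix_sqrt A ** matrix_sqrt A = A"
proof -
  let ?R = "spectral_matrix V (\<lambda>i. sqrt (evl i))"
  have psd: "sym_pos_semidef ?R"
  proof -
    have "0 \<le> sqrt (evl i) * (V i \<bullet> x) * (x \<bullet> V i)" for i x
      using pos[of i] by (simp add: inner_commute[of x] mult.assoc)
    then show ?thesis
      by (auto simp: sym_pos_semidef_def transpose_spectral_matrix spectral_matrix_mult
        inner_sum_right intro!: sum_nonneg)
  qed
  have sq: "?R ** ?R = A"
    using pos by (intro matrix_eq_on_orthonormal_family[OF V(1)])
      (simp add: matrix_vector_mul_assoc[symmetric] spectral_matrix_eigen[OF V(1)]
        matrix_vector_mult_scaleR V(2) less_imp_le)
  have uniq: "S = ?R" if S: "sym_pos_semidef S" "S ** S = A" for S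
  proof (rule matrix_eq_on_orthonormal_family[OF V(1)])
    fix i
    define s where "s = sqrt (evl i)"
    have s: "s > 0" "s * s = evl i" using pos[of i] by (auto simp: s_def)
    define w where "w = S *v V i - s *\<^sub>R V i"
    have "S *v w + s *\<^sub>R w = (S ** S) *v V i - (s * s) *\<^sub>R V i"
      by (simp add: w_def matrix_vector_mult_diff_distrib matrix_vector_mult_scaleR
          matrix_vector_mul_assoc algebra_simps)
    also have "\<dots> = 0" by (simp add: S(2) V(2) s)
    finally have "w \<bullet> (S *v w + s *\<^sub>R w) = 0" by simp
    then have "w \<bullet> (S *v w) + s * (w \<bullet> w) = 0" by (simp add: inner_add_right)
    moreover have "0 \<le> w \<bullet> (S *v w)" using S(1) by (auto simp: sym_pos_semidef_def)
    moreover have "0 \<le> s * (w \<bullet> w)" using s by simp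
    ultimately have "s * (w \<bullet> w) = 0" by linarith
    then have "w = 0" using s by simp
    then show "S *v V i = ?R *v V i" by (simp add: w_def s_def spectral_matrix_eigen[OF V(1)])
  qed
  have eq: "matrix_sqrt A = ?R"
    unfolding matrix_sqrt_def by (rule the_equality) (use psd sq uniq in blast)+
  show "matrix_sqrt A *v V i = sqrt (evl i) *\<^sub>R V i"
    by (simp add: eq spectral_matrix_eigen[OF V(1)])
  show "sym_pos_semidef (matrix_sqrt A)" "matrix_sqrt A ** matrix_sqrt A = A"
    using psd sq by (simp_all add: eq)
qed

lemma spectral_norm_ge_eigenvalue:
  assumes "M *v v = c *\<^sub>R v" "v \<noteq> 0"
  shows "c \<le> spectral_norm M"
proof -
  have "norm (M *v v) \<le> spectral_norm M * norm v"
    unfolding spectral_norm_def by (intro onorm matrix_vector_mul_bounded_linear)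
  then have "\<bar>c\<bar> * norm v \<le> spectral_norm M * norm v" by (simp add: assms)
  then show ?thesis using assms(2) by auto
qed

section \<open>Galerkin solutions\<close>

lemma sym_pos_def_coercive:
  fixes M :: "real^'n^'n"
  assumes "sym_pos_def M"
  obtains \<alpha> where "\<alpha> > 0" "\<And>x. \<alpha> * (x \<bullet> x) \<le> x \<bullet> (M *v x)"
proof -
  obtain V :: "'n \<Rightarrow> real^'n" and evl where V: "orthonormal_family V" "\<And>i. M *v V i = evl i *\<^sub>R V i"
    and pos: "\<And>i. evl i > 0"
    by (rule sym_pos_def_eigenbasis[OF assms]) (rule that)
  define \<alpha> where "\<alpha> = Min (range evl)"
  have le: "\<alpha> \<le> evl i" for i by (auto simp: \<alpha>_def)
  have p: "\<alpha> > 0" using pos by (simp add: \<alpha>_def)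
  have "\<alpha> * (x \<bullet> x) \<le> x \<bullet> (M *v x)" for x
  proof -
    have MV: "(M *v x) \<bullet> V i = evl i * (x \<bullet> V i)" for i
      by (simp add: sym_pos_defD(4)[OF assms] V(2))
    have "\<alpha> * (x \<bullet> x) = (\<Sum>i\<in>UNIV. \<alpha> * ((x \<bullet> V i) * (x \<bullet> V i)))"
      by (subst orthonormal_family_inner[OF V(1)]) (simp add: sum_distrib_left)
    also have "\<dots> \<le> (\<Sum>i\<in>UNIV. evl i * ((x \<bullet> V i) * (x \<bullet> V i)))"
      by (intro sum_mono mult_right_mono le) auto
    also have "\<dots> = x \<bullet> (M *v x)"
      by (subst (2) orthonormal_family_inner[OF V(1)]) (simp add: MV algebra_simps)
    finally show ?thesis .
  qed
  with p that show ?thesis by blast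
qed

definition galerkin :: "real^'n^'n \<Rightarrow> (real^'n) set \<Rightarrow> real^'n \<Rightarrow> real^'n \<Rightarrow> bool" where
  "galerkin M K b x \<longleftrightarrow> x \<in> K \<and> (\<forall>y\<in>K. (b - M *v x) \<bullet> y = 0)"

text \<open>
  With \<open>S = M\<^sup>1\<^sup>/\<^sup>2\<close> the energy norm of \<open>x\<close> is the Euclidean norm of \<open>S x\<close>, so the solution comes from the
  orthogonal projection of \<open>S M\<^sup>-\<^sup>1 b\<close> onto the image of \<open>K\<close> under \<open>S\<close>.
\<close>

lemma galerkin_exists:
  fixes M :: "real^'n^'n"
  assumes M: "sym_pos_def M" and K: "subspace K"
  shows "\<exists>x. galerkin M K b x"
proof -
  obtain V :: "'n \<Rightarrow> real^'n" and evl where V: "orthonormal_family V" "\<And>i. M *v V i = evl i *\<^sub>R V i"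
    and pos: "\<And>i. evl i > 0"
    by (rule sym_pos_def_eigenbasis[OF M]) (rule that)
  define S where "S = matrix_sqrt M"
  have S: "transpose S = S" "S ** S = M"
    using matrix_sqrt_eigen(2,3)[OF V pos] by (auto simp: S_def sym_pos_semidef_def)
  define g where "g = matrix_inv M *v b"
  have g: "M *v g = b" by (simp add: g_def sym_pos_def_inv_mult[OF M])
  have SK: "subspace ((*v) S ` K)"
    by (rule linear_subspace_image[OF matrix_vector_mul_linear K])
  obtain y z where yz: "y \<in> span ((*v) S ` K)" "\<And>w. w \<in> span ((*v) S ` K) \<Longrightarrow> orthogonal z w"
      "S *v g = y + z"
    using orthogonal_subspace_decomp_exists by blast
  have sp: "span ((*v) S ` K) = (*v) S ` K" using SK by (simp add: span_eq_iff)
  from yz(1) obtain x where x: "x \<in> K" "y = S *v x" by (auto simp: sp)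
  have "(b - M *v x) \<bullet> w = 0" if "w \<in> K" for w
  proof -
    have "b - M *v x = S *v z"
      using yz(3) by (simp add: x(2) g[symmetric] S(2)[symmetric] matrix_vector_mul_assoc[symmetric]
          matrix_vector_mult_diff_distrib[symmetric])
    then have "(b - M *v x) \<bullet> w = z \<bullet> (S *v w)" by (simp add: symmetric_matrix_inner[OF S(1)])
    also have "\<dots> = 0" using yz(2)[of "S *v w"] that by (auto simp: sp orthogonal_def)
    finally show ?thesis .
  qed
  then show ?thesis using x by (auto simp: galerkin_def)
qed

text \<open>
  Pythagoras in the energy inner product: the error of the Galerkin solution is energy-orthogonal to
  \<open>K\<close>. Uniqueness and optimality both follow from it.
\<close>

lemma galerkin_energy:
  assumes M: "sym_pos_def M" and K: "subspace K" and x: "galerkin M K b x" and y: "y \<in> K"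
  defines "g \<equiv> matrix_inv M *v b"
  shows "(g - y) \<bullet> (M *v (g - y)) = (g - x) \<bullet> (M *v (g - x)) + (x - y) \<bullet> (M *v (x - y))"
proof -
  have g: "M *v g = b" by (simp add: g_def sym_pos_def_inv_mult[OF M])
  have "x - y \<in> K" using x y K by (auto simp: galerkin_def intro: subspace_diff)
  then have "(b - M *v x) \<bullet> (x - y) = 0" using x by (auto simp: galerkin_def)
  then have 0: "(M *v (g - x)) \<bullet> (x - y) = 0" by (simp add: matrix_vector_mult_diff_distrib g)
  have 1: "(g - x) \<bullet> (M *v (x - y)) = 0" using 0 by (simp add: sym_pos_defD(4)[OF M])
  have 2: "(x - y) \<bullet> (M *v (g - x)) = 0" using 0 by (simp add: inner_commute)
  have "g - y = (g - x) + (x - y)" by simp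
  then show ?thesis
    by (simp only: matrix_vector_right_distrib inner_add_left inner_add_right 1 2)
qed

lemma galerkin_unique:
  assumes M: "sym_pos_def M" and K: "subspace K" and x: "galerkin M K b x" and y: "galerkin M K b y"
  shows "x = y"
proof (rule ccontr)
  assume ne: "x \<noteq> y"
  have "(x - y) \<bullet> (M *v (x - y)) = - ((y - x) \<bullet> (M *v (y - x)))"
    using galerkin_energy[OF M K x, of y] galerkin_energy[OF M K y, of x] x y
    by (simp add: galerkin_def)
  moreover have "(x - y) \<bullet> (M *v (x - y)) > 0" "(y - x) \<bullet> (M *v (y - x)) > 0"
    using ne sym_pos_defD(2)[OF M] by auto
  ultimately show False by linarith
qed

lemma arg_min_eq_galerkin:
  assumes M: "sym_pos_def M" and K: "subspace K" and x: "galerkin M K b x"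
  shows "arg_min (\<lambda>x. weighted_norm M (matrix_inv M *v b - x)) (\<lambda>x. x \<in> K) = x"
proof -
  let ?g = "matrix_inv M *v b"
  have xK: "x \<in> K" using x by (simp add: galerkin_def)
  have le: "weighted_norm M (?g - x) \<le> weighted_norm M (?g - y)" if "y \<in> K" for y
    using galerkin_energy[OF M K x that] sym_pos_defD(3)[OF M] by (simp add: weighted_norm_def)
  have eq: "y = x" if y: "y \<in> K" "weighted_norm M (?g - y) \<le> weighted_norm M (?g - x)" for y
  proof (rule ccontr)
    assume "y \<noteq> x"
    then have "(x - y) \<bullet> (M *v (x - y)) > 0" by (intro sym_pos_defD(2)[OF M]) auto
    with y(2) galerkin_energy[OF M K x y(1)] show False by (simp add: weighted_norm_def)
  qed
  show ?thesis
    unfolding arg_min_def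
  proof (rule some_equality)
    show "is_arg_min (\<lambda>x. weighted_norm M (?g - x)) (\<lambda>x. x \<in> K) x"
      using xK le by (auto simp: is_arg_min_def not_less)
  next
    fix y assume "is_arg_min (\<lambda>x. weighted_norm M (?g - x)) (\<lambda>x. x \<in> K) y"
    then show "y = x" using xK by (intro eq) (auto simp: is_arg_min_def not_less)
  qed
qed

section \<open>Krylov spaces and block CG\<close>

definition krylov_space :: "real^'n^'n \<Rightarrow> (real^'n) set \<Rightarrow> nat \<Rightarrow> (real^'n) set" where
  "krylov_space A F t = span {((*v) A ^^ j) v | j v. j < t \<and> v \<in> F}"

lemma subspace_krylov_space: "subspace (krylov_space A F t)"
  by (simp add: krylov_space_def)

lemma krylov_space_mono: "s \<le> t \<Longrightarrow> E \<subseteq> F \<Longrightarrow> krylov_space A E s \<subseteq> krylov_space A F t"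
  unfolding krylov_space_def by (intro span_mono) force

lemma krylov_space_start: "v \<in> F \<Longrightarrow> 0 < t \<Longrightarrow> v \<in> krylov_space A F t"
  unfolding krylov_space_def by (intro span_base) (force intro: exI[of _ "0::nat"])

lemma krylov_space_mult:
  assumes "x \<in> krylov_space A F t"
  shows "A *v x \<in> krylov_space A F (Suc t)"
  using assms unfolding krylov_space_def
proof (induction rule: span_induct_alt)
  case base
  show ?case by (simp add: span_zero)
next
  case (step c u y)
  then obtain j v where "u = ((*v) A ^^ j) v" "j < t" "v \<in> F" by blast
  then have "A *v u = ((*v) A ^^ Suc j) v \<and> Suc j < Suc t \<and> v \<in> F" by simp
  then have "A *v u \<in> span {((*v) A ^^ j) v |j v. j < Suc t \<and> v \<in> F}"
    by (intro span_base) blast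
  then show ?case using step
    by (simp add: matrix_vector_right_distrib matrix_vector_mult_scaleR span_add span_scale)
qed

lemma krylov_space_power:
  assumes "x \<in> krylov_space A F t"
  shows "((*v) A ^^ j) x \<in> krylov_space A F (t + j)"
  by (induction j) (auto simp: assms krylov_space_mult)

text \<open>
  A power of \<open>A + \<mu> I\<close> is a polynomial of the same degree in \<open>A\<close>. Thus one Krylov space serves all
  shifts.
\<close>

lemma krylov_space_shift_subset: "krylov_space (shifted_matrix A \<mu>) F t \<subseteq> krylov_space A F t"
proof -
  have mem: "((*v) (shifted_matrix A \<mu>) ^^ j) v \<in> krylov_space A F (Suc j)" if "v \<in> F" for j v
  proof (induction j)
    case 0
    then show ?case using that by (simp add: krylov_space_start)
  next
    case (Suc j)
    let ?y = "((*v) (shifted_matrix A \<mu>) ^^ j) v"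
    have "A *v ?y \<in> krylov_space A F (Suc (Suc j))" using Suc by (rule krylov_space_mult)
    moreover have "\<mu> *\<^sub>R ?y \<in> krylov_space A F (Suc (Suc j))"
      using Suc krylov_space_mono[of "Suc j" "Suc (Suc j)" F F A]
      by (intro subspace_scale[OF subspace_krylov_space]) auto
    ultimately have "A *v ?y + \<mu> *\<^sub>R ?y \<in> krylov_space A F (Suc (Suc j))"
      by (rule subspace_add[OF subspace_krylov_space])
    moreover have "shifted_matrix A \<mu> *v x = A *v x + \<mu> *\<^sub>R x" for x
      by (simp add: shifted_matrix_def matrix_vector_mult_add_rdistrib mat_mult_vec)
    then have "((*v) (shifted_matrix A \<mu>) ^^ Suc j) v = A *v ?y + \<mu> *\<^sub>R ?y"
      by (simp only: funpow.simps o_apply)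
    ultimately show ?case by (simp only:)
  qed
  have "((*v) (shifted_matrix A \<mu>) ^^ j) v \<in> krylov_space A F t" if "j < t" "v \<in> F" for j v
    using mem[OF that(2), of j] krylov_space_mono[of "Suc j" t F F A] that(1) by auto
  then show ?thesis
    unfolding krylov_space_def[of "shifted_matrix A \<mu>"]
    by (intro span_minimal subspace_krylov_space) blast
qed

lemma krylov_space_shift: "krylov_space (shifted_matrix A \<mu>) F t = krylov_space A F t"
proof
  have "shifted_matrix (shifted_matrix A \<mu>) (- \<mu>) = A"
    by (simp add: shifted_matrix_def mat_def vec_eq_iff)
  then show "krylov_space A F t \<subseteq> krylov_space (shifted_matrix A \<mu>) F t"
    by (metis krylov_space_shift_subset)
qed (rule krylov_space_shift_subset)

lemma sum_spans:
  fixes S :: "'i \<Rightarrow> 'a::real_vector set"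
  assumes "finite I"
  shows "(\<Sum>i\<in>I. span (S i)) = span (\<Union>i\<in>I. S i)"
  using assms
proof (induction I rule: finite_induct)
  case empty
  then show ?case by simp
next
  case (insert i I)
  have "span (S i) + span (\<Union>i\<in>I. S i) = span (S i \<union> (\<Union>i\<in>I. S i))"
    by (auto simp: span_Un set_plus_def)
  then show ?case using insert by simp
qed

lemma block_krylov_eq: "block_krylov A m v t = krylov_space A (v ` {1..m}) t"
proof -
  have "(\<Union>i\<in>{1..m}. {((\<lambda>x. A *v x) ^^ j) (v i) | j. j < t}) = {((*v) A ^^ j) w | j w. j < t \<and> w \<in> v ` {1..m}}"
    by auto
  then show ?thesis
    by (simp add: block_krylov_def krylov_def krylov_space_def sum_spans)
qed

lemma sym_pos_def_shifted:
  assumes "sym_pos_def A" "\<mu> \<ge> 0"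
  shows "sym_pos_def (shifted_matrix A \<mu>)"
  unfolding sym_pos_def_def
proof (intro conjI allI impI)
  show "transpose (shifted_matrix A \<mu>) = shifted_matrix A \<mu>"
    using sym_pos_defD(1)[OF assms(1)]
    by (auto simp: shifted_matrix_def transpose_def mat_def vec_eq_iff)
  show "0 < x \<bullet> (shifted_matrix A \<mu> *v x)" if "x \<noteq> 0" for x
    using sym_pos_defD(2)[OF assms(1) that] assms(2)
    by (simp add: shifted_matrix_def matrix_vector_mult_add_rdistrib mat_mult_vec inner_add_right add_pos_nonneg)
qed

lemma shifted_eigen:
  fixes A :: "real^'n^'n"
  shows "A *v v = c *\<^sub>R v \<Longrightarrow> shifted_matrix A \<mu> *v v = (c + \<mu>) *\<^sub>R v"
  by (simp add: shifted_matrix_def matrix_vector_mult_add_rdistrib mat_mult_vec scaleR_add_left)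

text \<open>
  The orthogonality conditions replace the minimization from here on: they are linear, hence the right
  form both for estimates and for measurability.
\<close>

lemma bcg_galerkin:
  assumes "sym_pos_def A" "\<mu> \<ge> 0"
  shows "galerkin (shifted_matrix A \<mu>) (krylov_space A (b ` {1..m}) t) (b i) (bcg A m b t i \<mu>)"
proof -
  obtain x where x: "galerkin (shifted_matrix A \<mu>) (krylov_space A (b ` {1..m}) t) (b i) x"
    using galerkin_exists[OF sym_pos_def_shifted[OF assms] subspace_krylov_space] by blast
  from arg_min_eq_galerkin[OF sym_pos_def_shifted[OF assms] subspace_krylov_space x] x
  show ?thesis by (simp add: bcg_def block_krylov_eq krylov_space_shift)
qed

section \<open>Measurability of Galerkin solutions\<close>

lemma measurable_vec_nth [measurable]:
  fixes f :: "'a \<Rightarrow> ('b::euclidean_space)^'n"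
  assumes "f \<in> borel_measurable N"
  shows "(\<lambda>x. f x $ i) \<in> borel_measurable N"
proof -
  have "(\<lambda>x::'b^'n. x $ i) \<in> borel_measurable borel"
    by (rule borel_measurable_continuous_onI, rule linear_continuous_on, rule bounded_linear_vec_nth)
  from measurable_compose[OF assms this] show ?thesis .
qed

lemma measurable_vec_lambda:
  fixes f :: "'a \<Rightarrow> 'n::finite \<Rightarrow> 'b::euclidean_space"
  assumes "\<And>i. (\<lambda>x. f x i) \<in> borel_measurable N"
  shows "(\<lambda>x. \<chi> i. f x i) \<in> borel_measurable N"
proof (subst borel_measurable_euclidean_space, intro ballI)
  fix v :: "'b^'n" assume "v \<in> Basis"
  have "(\<lambda>x. (\<chi> i. f x i) \<bullet> v) = (\<lambda>x. \<Sum>i\<in>UNIV. f x i \<bullet> (v $ i))"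
    by (simp add: inner_vec_def)
  then show "(\<lambda>x. (\<chi> i. f x i) \<bullet> v) \<in> borel_measurable N"
    using assms by simp
qed

lemma measurable_matrix_vector_mult:
  fixes M :: "'a \<Rightarrow> real^'n^'m"
  assumes "M \<in> borel_measurable N" "x \<in> borel_measurable N"
  shows "(\<lambda>\<omega>. M \<omega> *v x \<omega>) \<in> borel_measurable N"
proof -
  have "(\<lambda>\<omega>. M \<omega> $ i $ j * x \<omega> $ j) \<in> borel_measurable N" for i j
    by (rule borel_measurable_times[OF measurable_vec_nth[OF measurable_vec_nth[OF assms(1)]]
          measurable_vec_nth[OF assms(2)]])
  then show ?thesis
    unfolding matrix_vector_mult_def by (intro measurable_vec_lambda borel_measurable_sum)
qed

lemma measurable_matrix_power:
  fixes A :: "real^'n^'n"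
  assumes "x \<in> borel_measurable N"
  shows "(\<lambda>\<omega>. ((*v) A ^^ j) (x \<omega>)) \<in> borel_measurable N"
proof (induction j)
  case 0
  then show ?case using assms by simp
next
  case (Suc j)
  then show ?case by (simp add: measurable_matrix_vector_mult del: measurable_vec_nth)
qed

text \<open>
  This is \<open>W W\<^sup>T\<close> for the matrix \<open>W\<close> with columns \<open>w j\<close>. It keeps the fixed size of the ambient space
  however many vectors there are.
\<close>

definition gram_sum :: "'j set \<Rightarrow> ('j \<Rightarrow> real^'n) \<Rightarrow> real^'n^'n" where
  "gram_sum J w = (\<chi> k l. \<Sum>j\<in>J. w j $ k * w j $ l)"

lemma gram_sum_mult: "gram_sum J w *v x = (\<Sum>j\<in>J. (w j \<bullet> x) *\<^sub>R w j)"
proof -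
  have "(\<Sum>l\<in>UNIV. (\<Sum>j\<in>J. w j $ k * w j $ l) * x $ l)
      = (\<Sum>j\<in>J. (\<Sum>l\<in>UNIV. w j $ l * x $ l) * w j $ k)" for k
    unfolding sum_distrib_right sum_distrib_left
    by (subst sum.swap) (simp add: algebra_simps)
  then show ?thesis
    by (simp add: gram_sum_def matrix_vector_mult_def vec_eq_iff inner_vec_def)
qed

lemma gram_sum_inner: "(gram_sum J w *v x) \<bullet> y = (\<Sum>j\<in>J. (w j \<bullet> x) * (w j \<bullet> y))"
  by (simp add: gram_sum_mult inner_sum_left)

lemma gram_sum_sym: "(gram_sum J w *v x) \<bullet> y = x \<bullet> (gram_sum J w *v y)"
  by (subst inner_commute[of x]) (simp add: gram_sum_inner mult.commute)

lemma gram_sum_nonneg: "0 \<le> x \<bullet> (gram_sum J w *v x)"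
  by (subst inner_commute) (auto simp: gram_sum_inner intro!: sum_nonneg)

text \<open>
  If \<open>z\<close> is orthogonal to the range of \<open>W W\<^sup>T\<close>, then \<open>z \<bullet> W W\<^sup>T z = 0\<close>, so \<open>z\<close> is orthogonal to every
  \<open>w j\<close>; hence the span of the \<open>w j\<close> lies in the range.
\<close>

lemma range_gram_sum:
  assumes J: "finite J" and x: "x \<in> span (w ` J)"
  obtains y where "gram_sum J w *v y = x"
proof -
  let ?G = "gram_sum J w"
  have sub: "subspace (range ((*v) ?G))"
    by (rule linear_subspace_image[OF matrix_vector_mul_linear subspace_UNIV])
  have "w j \<in> range ((*v) ?G)" if j: "j \<in> J" for j
  proof -
    have sp: "span (range ((*v) ?G)) = range ((*v) ?G)" using sub by (simp add: span_eq_iff)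
    obtain y z where yz: "y \<in> range ((*v) ?G)" "\<And>u. u \<in> range ((*v) ?G) \<Longrightarrow> orthogonal z u" "w j = y + z"
      using orthogonal_subspace_decomp_exists[of "range ((*v) ?G)" "w j"] unfolding sp by blast
    have "(?G *v z) \<bullet> z = 0" using yz(2)[of "?G *v z"] by (auto simp: orthogonal_def inner_commute)
    then have "(\<Sum>j\<in>J. (w j \<bullet> z) * (w j \<bullet> z)) = 0" by (simp add: gram_sum_inner)
    then have "w j \<bullet> z = 0" using j J by (simp add: sum_nonneg_eq_0_iff)
    moreover have "z \<bullet> y = 0" using yz by (auto simp: orthogonal_def)
    moreover have "z \<bullet> w j = z \<bullet> y + z \<bullet> z" by (simp add: yz(3) inner_add_right)
    ultimately have "z \<bullet> z = 0" by (simp add: inner_commute)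
    then show ?thesis using yz by simp
  qed
  then have "span (w ` J) \<subseteq> range ((*v) ?G)" by (intro span_minimal sub) auto
  with x that show ?thesis by blast
qed

lemma regularized_nonsingular:
  assumes M: "sym_pos_def M" and e: "\<epsilon> > 0"
  shows "det (gram_sum J w ** M + mat \<epsilon>) \<noteq> 0"
proof -
  have "x = 0" if x: "(gram_sum J w ** M + mat \<epsilon>) *v x = 0" for x
  proof (rule ccontr)
    assume "x \<noteq> 0"
    then have p: "x \<bullet> (M *v x) > 0" by (rule sym_pos_defD(2)[OF M])
    have "gram_sum J w *v (M *v x) + \<epsilon> *\<^sub>R x = 0"
      using x by (simp add: matrix_vector_mult_add_rdistrib mat_mult_vec matrix_vector_mul_assoc)
    then have "(M *v x) \<bullet> (gram_sum J w *v (M *v x) + \<epsilon> *\<^sub>R x) = 0" by simp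
    then have "(M *v x) \<bullet> (gram_sum J w *v (M *v x)) + \<epsilon> * ((M *v x) \<bullet> x) = 0"
      by (simp add: inner_add_right)
    moreover have "0 \<le> (M *v x) \<bullet> (gram_sum J w *v (M *v x))" by (rule gram_sum_nonneg)
    moreover have "0 < \<epsilon> * ((M *v x) \<bullet> x)" using e p by (simp add: inner_commute)
    ultimately show False by linarith
  qed
  then have "invertible (gram_sum J w ** M + mat \<epsilon>)"
    unfolding invertible_left_inverse matrix_left_invertible_ker by blast
  then show ?thesis by (simp add: invertible_det_nz)
qed

text \<open>
  With \<open>G = W W\<^sup>T\<close> the Galerkin conditions read \<open>G (b - M x) = 0\<close>, which is singular if the \<open>w j\<close> do not
  span the whole space. The regularized equation \<open>(G M + \<epsilon>) x\<^sub>\<epsilon> = G b\<close> always has a unique solution.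
  Its error \<open>D = G u\<close> satisfies \<open>G M D = - \<epsilon> x\<^sub>\<epsilon>\<close>; testing this equation with \<open>u\<close> bounds the energy of
  \<open>D\<close> by \<open>- \<epsilon> (D \<bullet> y)\<close>.
\<close>

lemma regularized_galerkin_error:
  assumes M: "sym_pos_def M" and J: "finite J" and x: "galerkin M (span (w ` J)) b x"
    and \<alpha>: "\<alpha> > 0" "\<And>x. \<alpha> * (x \<bullet> x) \<le> x \<bullet> (M *v x)"
    and y: "gram_sum J w *v y = x"
    and e: "\<epsilon> > 0" and xe: "(gram_sum J w ** M + mat \<epsilon>) *v xe = gram_sum J w *v b"
  shows "norm (xe - x) \<le> \<epsilon> * (norm y / \<alpha>)"
proof -
  let ?G = "gram_sum J w"
  have eq: "?G *v (M *v xe) + \<epsilon> *\<^sub>R xe = ?G *v b"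
    using xe by (simp add: matrix_vector_mult_add_rdistrib mat_mult_vec matrix_vector_mul_assoc)
  have "w j \<bullet> (b - M *v x) = 0" if "j \<in> J" for j
    using x that by (auto simp: galerkin_def inner_commute intro: span_base)
  then have 0: "?G *v (b - M *v x) = 0" by (simp add: gram_sum_mult)
  define D where "D = xe - x"
  have 1: "?G *v (M *v D) = - (\<epsilon> *\<^sub>R xe)"
    using eq 0 by (simp add: D_def matrix_vector_mult_diff_distrib algebra_simps add_eq_0_iff2)
  define u where "u = inverse \<epsilon> *\<^sub>R (b - M *v xe) - y"
  have 2: "?G *v u = D"
  proof -
    have "?G *v (b - M *v xe) = \<epsilon> *\<^sub>R xe"
      using eq by (simp add: matrix_vector_mult_diff_distrib algebra_simps)
    then show ?thesis using e
      by (simp add: u_def D_def matrix_vector_mult_diff_distrib matrix_vector_mult_scaleR y)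
  qed
  have "\<alpha> * (D \<bullet> D) \<le> D \<bullet> (M *v D)" by (rule \<alpha>)
  also have "\<dots> = u \<bullet> (?G *v (M *v D))"
    by (simp add: gram_sum_sym[symmetric] 2)
  also have "\<dots> = - \<epsilon> * (u \<bullet> (?G *v u) + u \<bullet> (?G *v y))"
    unfolding 1 2 y by (simp add: D_def inner_diff_right inner_add_right algebra_simps)
  also have "u \<bullet> (?G *v y) = D \<bullet> y" by (simp add: gram_sum_sym[symmetric] 2)
  also have "- \<epsilon> * (u \<bullet> (?G *v u) + D \<bullet> y) \<le> \<epsilon> * (norm D * norm y)"
  proof -
    have "- (D \<bullet> y) \<le> norm D * norm y" using norm_cauchy_schwarz[of "-D" y] by simp
    moreover have "0 \<le> u \<bullet> (?G *v u)" by (rule gram_sum_nonneg)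
    ultimately have "- (u \<bullet> (?G *v u) + D \<bullet> y) \<le> norm D * norm y" by simp
    then have "\<epsilon> * - (u \<bullet> (?G *v u) + D \<bullet> y) \<le> \<epsilon> * (norm D * norm y)"
      using e by (intro mult_left_mono) auto
    then show ?thesis by (simp add: algebra_simps)
  qed
  finally have "\<alpha> * (D \<bullet> D) \<le> \<epsilon> * (norm D * norm y)" .
  then have "norm D * (\<alpha> * norm D) \<le> norm D * (\<epsilon> * norm y)"
    by (simp add: power2_norm_eq_inner[symmetric] power2_eq_square mult_ac)
  then have "\<alpha> * norm D \<le> \<epsilon> * norm y"
    using e by (cases "D = 0") (auto simp: mult_le_cancel_left)
  then show ?thesis using \<alpha>(1) by (simp add: D_def field_simps)
qed

text \<open>
  The dimension of the span may jump, so the solution need not be continuous in the data. The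
  regularized solutions are quotients of determinants by Cramer's rule, hence measurable, and they
  converge pointwise.
\<close>

lemma measurable_galerkin:
  fixes M :: "'a \<Rightarrow> real^'n^'n"
  assumes J: "finite J" and w [measurable]: "\<And>j. j \<in> J \<Longrightarrow> w j \<in> borel_measurable N"
    and M [measurable]: "M \<in> borel_measurable N" and b [measurable]: "b \<in> borel_measurable N"
    and spd: "\<And>\<omega>. \<omega> \<in> space N \<Longrightarrow> sym_pos_def (M \<omega>)"
    and gal: "\<And>\<omega>. \<omega> \<in> space N \<Longrightarrow> galerkin (M \<omega>) (span ((\<lambda>j. w j \<omega>) ` J)) (b \<omega>) (x \<omega>)"
  shows "x \<in> borel_measurable N"
proof -
  define G where "G = (\<lambda>\<omega>. gram_sum J (\<lambda>j. w j \<omega>))"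
  define C where "C = (\<lambda>n \<omega>. G \<omega> ** M \<omega> + mat (inverse (real (Suc n))))"
  define h where "h = (\<lambda>\<omega>. G \<omega> *v b \<omega>)"
  define X where "X = (\<lambda>n \<omega>. \<chi> k. det (\<chi> i j. if j = k then h \<omega> $ i else C n \<omega> $ i $ j) / det (C n \<omega>))"
  have Gm[measurable]: "G \<in> borel_measurable N"
    unfolding G_def gram_sum_def by (intro measurable_vec_lambda) measurable
  have hm[measurable]: "h \<in> borel_measurable N"
    unfolding h_def by (intro measurable_matrix_vector_mult) auto
  have cm[measurable]: "C n \<in> borel_measurable N" for n
    unfolding C_def matrix_matrix_mult_def
    by (intro borel_measurable_add measurable_vec_lambda borel_measurable_const) measurable
  have detm: "(\<lambda>\<omega>. det (E \<omega>)) \<in> borel_measurable N"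
    if E: "\<And>i j. (\<lambda>\<omega>. E \<omega> $ i $ j) \<in> borel_measurable N" for E :: "'a \<Rightarrow> real^'n^'n"
    unfolding det_def using E by (intro borel_measurable_sum borel_measurable_times borel_measurable_const borel_measurable_prod)
  have Xm: "X n \<in> borel_measurable N" for n
    unfolding X_def
  proof (intro measurable_vec_lambda borel_measurable_divide detm)
    fix k i j
    show "(\<lambda>\<omega>. (\<chi> i j. if j = k then h \<omega> $ i else C n \<omega> $ i $ j) $ i $ j) \<in> borel_measurable N"
      by (cases "j = k") simp_all
  qed measurable
  have lim: "(\<lambda>n. X n \<omega>) \<longlonglongrightarrow> x \<omega>" if \<omega>: "\<omega> \<in> space N" for \<omega>
  proof -
    have g: "galerkin (M \<omega>) (span ((\<lambda>j. w j \<omega>) ` J)) (b \<omega>) (x \<omega>)" using gal \<omega> by simp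
    obtain y where y: "gram_sum J (\<lambda>j. w j \<omega>) *v y = x \<omega>"
      using range_gram_sum[OF J] g by (auto simp: galerkin_def)
    obtain \<alpha> where \<alpha>: "\<alpha> > 0" "\<And>x. \<alpha> * (x \<bullet> x) \<le> x \<bullet> (M \<omega> *v x)"
      using sym_pos_def_coercive[OF spd[OF \<omega>]] by blast
    have "norm (X n \<omega> - x \<omega>) \<le> inverse (real (Suc n)) * (norm y / \<alpha>)" for n
    proof (rule regularized_galerkin_error[OF spd[OF \<omega>] J g \<alpha> y])
      have "det (C n \<omega>) \<noteq> 0"
        unfolding C_def G_def by (rule regularized_nonsingular[OF spd[OF \<omega>]]) simp
      from cramer[OF this, of "X n \<omega>" "h \<omega>"]
      show "(gram_sum J (\<lambda>j. w j \<omega>) ** M \<omega> + mat (inverse (real (Suc n)))) *v X n \<omega>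
          = gram_sum J (\<lambda>j. w j \<omega>) *v b \<omega>"
        by (simp add: X_def C_def G_def h_def)
    qed simp
    then have "(\<lambda>n. X n \<omega> - x \<omega>) \<longlonglongrightarrow> 0"
      by (rule Lim_null_comparison[OF always_eventually[OF allI]
            tendsto_mult_left_zero[OF LIMSEQ_inverse_real_of_nat]])
    then show ?thesis by (rule LIM_zero_cancel)
  qed
  show ?thesis by (rule borel_measurable_LIMSEQ_metric[OF Xm lim])
qed

section \<open>Chebyshev iteration on a deflated operator\<close>

text \<open>
  This is \<open>x \<le> artanh x\<close>. It converts the Chebyshev rate into an exponential.
\<close>

lemma exp_le_ratio:
  fixes x :: real
  assumes "0 \<le> x" "x < 1"
  shows "exp (2 * x) \<le> (1 + x) / (1 - x)"
proof -
  define f where "f = (\<lambda>x::real. ln (1 + x) - ln (1 - x) - 2 * x)"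
  have "f 0 \<le> f x"
  proof (rule DERIV_nonneg_imp_nondecreasing[OF assms(1)])
    fix y assume y: "0 \<le> y" "y \<le> x"
    have "(f has_real_derivative (1 / (1 + y) + 1 / (1 - y) - 2)) (at y)"
      unfolding f_def using y assms by (auto intro!: derivative_eq_intros)
    moreover have "1 / (1 + y) + 1 / (1 - y) - 2 = 2 * y\<^sup>2 / ((1 + y) * (1 - y))"
    proof -
      have "1 + y \<noteq> 0" "1 - y \<noteq> 0" using y assms by auto
      then show ?thesis by (simp add: divide_simps power2_eq_square) (simp add: algebra_simps)
    qed
    moreover have "0 \<le> 2 * y\<^sup>2 / ((1 + y) * (1 - y))"
      using y assms by (intro divide_nonneg_nonneg mult_nonneg_nonneg) auto
    ultimately show "\<exists>D. (f has_real_derivative D) (at y) \<and> 0 \<le> D" by metis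
  qed
  then have "2 * x \<le> ln ((1 + x) / (1 - x))" using assms by (simp add: f_def ln_div)
  then have "exp (2 * x) \<le> exp (ln ((1 + x) / (1 - x)))" by simp
  then show ?thesis using assms by simp
qed

lemma weighted_cauchy_schwarz:
  fixes M :: "real^'n^'n"
  assumes "sym_pos_def M"
  shows "(x \<bullet> (M *v y))\<^sup>2 \<le> (x \<bullet> (M *v x)) * (y \<bullet> (M *v y))"
proof -
  obtain V :: "'n \<Rightarrow> real^'n" and evl where V: "orthonormal_family V" "\<And>i. M *v V i = evl i *\<^sub>R V i"
    and pos: "\<And>i. evl i > 0"
    by (rule sym_pos_def_eigenbasis[OF assms]) (rule that)
  define S where "S = matrix_sqrt M"
  have S: "transpose S = S" "S ** S = M"
    using matrix_sqrt_eigen(2,3)[OF V pos] by (auto simp: S_def sym_pos_semidef_def)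
  have "(S *v a) \<bullet> (S *v c) = a \<bullet> (M *v c)" for a c
    by (simp add: symmetric_matrix_inner[OF S(1)] S(2)[symmetric] matrix_vector_mul_assoc[symmetric])
  with Cauchy_Schwarz_ineq[of "S *v x" "S *v y"] show ?thesis by simp
qed

text \<open>
  Let \<open>D\<close> be the energy-orthogonal projection onto the complement \<open>U\<close> of \<open>Q\<close>, and let \<open>X\<close> be the affine
  image of \<open>D M\<close> that maps the spectral interval \<open>[\<alpha>, \<beta>]\<close> to \<open>[-1, 1]\<close>; it is self-adjoint on \<open>U\<close> in the
  energy inner product \<open>B\<close>. The vectors \<open>\<tau> = T\<^sub>k(X) (D g)\<close> and \<open>w = U\<^sub>k\<^sub>-\<^sub>1(X) (D g)\<close>, given by Chebyshev
  polynomials of the first and second kind, satisfy the Pell identity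
  \<open>B \<tau> \<tau> + B w w - B (X w) (X w) = B (D g) (D g)\<close>, and \<open>X\<close> is a contraction, so the energy of \<open>\<tau>\<close> never
  exceeds that of \<open>D g\<close>.
  Dividing by \<open>T\<^sub>k((\<beta> + \<alpha>)/(\<beta> - \<alpha>)) = (\<rho>\<^sup>k + \<rho>\<^sup>-\<^sup>k)/2\<close> turns \<open>\<tau>\<close> into the error of a vector of the Krylov
  space, since each application of \<open>X\<close> costs one degree and \<open>Q\<close> itself needs \<open>s\<close> of them.
\<close>

lemma deflated_chebyshev:
  fixes M :: "real^'n^'n" and Kr :: "nat \<Rightarrow> (real^'n) set"
  assumes M: "sym_pos_def M" and Q: "subspace Q"
    and Kr: "\<And>j. subspace (Kr j)" and mono: "\<And>i j. i \<le> j \<Longrightarrow> Kr i \<subseteq> Kr j"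
    and mult: "\<And>j x. x \<in> Kr j \<Longrightarrow> M *v x \<in> Kr (Suc j)"
    and QK: "Q \<subseteq> Kr s" and s: "1 \<le> s" and b: "M *v g \<in> Kr 1"
    and ab: "\<alpha> < \<beta>" and \<rho>: "1 < \<rho>" "(\<beta> + \<alpha>) / (\<beta> - \<alpha>) = (\<rho> + 1 / \<rho>) / 2"
    and lo: "\<And>x. (\<And>y. y \<in> Q \<Longrightarrow> (M *v x) \<bullet> y = 0) \<Longrightarrow> \<alpha> * (x \<bullet> (M *v x)) \<le> (M *v x) \<bullet> (M *v x)"
    and hi: "\<And>x. (\<And>y. y \<in> Q \<Longrightarrow> (M *v x) \<bullet> y = 0) \<Longrightarrow> (M *v x) \<bullet> (M *v x) \<le> \<beta> * (x \<bullet> (M *v x))"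
  shows "\<exists>x\<in>Kr (s + k). (g - x) \<bullet> (M *v (g - x)) \<le> (2 / \<rho> ^ k)\<^sup>2 * (g \<bullet> (M *v g))"
proof -
  define B where "B = (\<lambda>x y. x \<bullet> (M *v y))"
  have Bsym: "B x y = B y x" for x y
    using sym_pos_defD(4)[OF M, of x y] by (simp add: B_def inner_commute)
  have Badd: "B (x + y) z = B x z + B y z" "B z (x + y) = B z x + B z y"
    and Bdiff: "B (x - y) z = B x z - B y z" "B z (x - y) = B z x - B z y"
    and Bscale: "B (c *\<^sub>R x) z = c * B x z" "B z (c *\<^sub>R x) = c * B z x" for x y z c
    by (simp_all add: B_def matrix_vector_right_distrib matrix_vector_mult_diff_distrib
        matrix_vector_mult_scaleR inner_add_left inner_add_right inner_diff_left inner_diff_right)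
  define U where "U = {x. \<forall>y\<in>Q. B x y = 0}"
  have Umem: "x \<in> U \<longleftrightarrow> (\<forall>y\<in>Q. (M *v x) \<bullet> y = 0)" for x
    by (simp add: U_def B_def sym_pos_defD(4)[OF M])
  have Usub: "subspace U"
    by (auto simp: subspace_def U_def Badd Bscale) (simp add: B_def)
  have "\<exists>P. \<forall>v. galerkin M Q (M *v v) (P v)"
    using galerkin_exists[OF M Q] by (intro choice) blast
  then obtain P where P: "\<And>v. galerkin M Q (M *v v) (P v)" by blast
  have PQ: "P v \<in> Q" for v using P by (auto simp: galerkin_def)
  define D where "D = (\<lambda>v. v - P v)"
  have DU: "D v \<in> U" for v
    using P[of v] by (auto simp: Umem D_def galerkin_def matrix_vector_mult_diff_distrib)
  have BD: "B (D v) c = B v c" if "c \<in> U" for v c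
    using that PQ[of v] by (simp add: D_def Bdiff U_def Bsym[of _ c])
  define \<sigma> where "\<sigma> = (\<beta> + \<alpha>) / (\<beta> - \<alpha>)"
  define c where "c = 2 / (\<beta> - \<alpha>)"
  define X where "X = (\<lambda>a. \<sigma> *\<^sub>R a - c *\<^sub>R D (M *v a))"
  have XU: "X a \<in> U" if "a \<in> U" for a
    unfolding X_def using that DU Usub by (intro subspace_diff subspace_scale) auto
  have MM: "B (M *v a) e = (M *v a) \<bullet> (M *v e)" for a e by (simp add: B_def)
  have Xsym: "B (X a) e = B a (X e)" if "a \<in> U" "e \<in> U" for a e
  proof -
    have "B a (D (M *v e)) = B (M *v e) a" using BD[OF that(1)] by (simp add: Bsym[of a])
    then show ?thesis using that
      by (simp add: X_def Bdiff Bscale BD MM inner_commute)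
  qed
  \<comment> \<open>For \<open>H = D M\<close> this is \<open>(H - \<alpha>) (\<beta> - H) \<ge> 0\<close>. It follows from \<open>\<alpha> \<le> H \<le> \<beta>\<close> on \<open>U\<close> by \<open>(\<beta> - \<alpha>) (H - \<alpha>) (\<beta> - H) = (H - \<alpha>) (\<beta> - H) (H - \<alpha>) + (\<beta> - H) (H - \<alpha>) (\<beta> - H)\<close>.\<close>
  have Xle: "B (X a) (X a) \<le> B a a" if a: "a \<in> U" for a
  proof -
    define h where "h = D (M *v a)"
    define m0 m1 m2 m3 where m_def: "m0 = B a a" "m1 = (M *v a) \<bullet> (M *v a)" "m2 = B h h" "m3 = (M *v h) \<bullet> (M *v h)"
    have h: "h \<in> U" by (simp add: h_def DU)
    have ha: "B h a = m1" "B a h = m1" using BD[OF a, of "M *v a"] by (simp_all add: h_def m_def MM Bsym[of a])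
    have Mah: "(M *v a) \<bullet> (M *v h) = m2" "(M *v h) \<bullet> (M *v a) = m2"
      using BD[OF h, of "M *v a"] by (simp_all add: h_def m_def MM inner_commute)
    have p1: "h - \<alpha> *\<^sub>R a \<in> U" and p2: "\<beta> *\<^sub>R a - h \<in> U"
      using a h Usub by (auto intro: subspace_diff subspace_scale)
    have i1: "(M *v (h - \<alpha> *\<^sub>R a)) \<bullet> (M *v (h - \<alpha> *\<^sub>R a)) \<le> \<beta> * B (h - \<alpha> *\<^sub>R a) (h - \<alpha> *\<^sub>R a)"
      using hi[of "h - \<alpha> *\<^sub>R a"] p1 by (simp add: Umem B_def)
    have i2: "\<alpha> * B (\<beta> *\<^sub>R a - h) (\<beta> *\<^sub>R a - h) \<le> (M *v (\<beta> *\<^sub>R a - h)) \<bullet> (M *v (\<beta> *\<^sub>R a - h))"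
      using lo[of "\<beta> *\<^sub>R a - h"] p2 by (simp add: Umem B_def)
    have j1: "m3 - 2 * \<alpha> * m2 + \<alpha>\<^sup>2 * m1 \<le> \<beta> * (m2 - 2 * \<alpha> * m1 + \<alpha>\<^sup>2 * m0)"
      using i1 by (simp add: Bdiff Bscale ha m_def[symmetric] matrix_vector_mult_diff_distrib matrix_vector_mult_scaleR
          inner_diff_left inner_diff_right Mah power2_eq_square algebra_simps)
    have j2: "\<alpha> * (\<beta>\<^sup>2 * m0 - 2 * \<beta> * m1 + m2) \<le> \<beta>\<^sup>2 * m1 - 2 * \<beta> * m2 + m3"
      using i2 by (simp add: Bdiff Bscale ha m_def[symmetric] matrix_vector_mult_diff_distrib matrix_vector_mult_scaleR
          inner_diff_left inner_diff_right Mah power2_eq_square algebra_simps)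
    have "0 \<le> (\<beta> - \<alpha>) * ((\<alpha> + \<beta>) * m1 - m2 - \<alpha> * \<beta> * m0)"
      using j1 j2 by (simp add: power2_eq_square algebra_simps)
    then have main: "0 \<le> (\<alpha> + \<beta>) * m1 - m2 - \<alpha> * \<beta> * m0"
      using ab by (simp add: zero_le_mult_iff)
    have "B (X a) (X a) = \<sigma>\<^sup>2 * m0 - 2 * \<sigma> * c * m1 + c\<^sup>2 * m2"
      by (simp add: X_def h_def[symmetric] Bdiff Bscale ha m_def[symmetric] power2_eq_square algebra_simps)
    also have "\<dots> = m0 - c\<^sup>2 * ((\<alpha> + \<beta>) * m1 - m2 - \<alpha> * \<beta> * m0)"
    proof -
      have "\<beta> - \<alpha> \<noteq> 0" using ab by simp
      moreover from this have "\<sigma>\<^sup>2 * (\<beta> - \<alpha>)\<^sup>2 = (\<beta> + \<alpha>)\<^sup>2" "c\<^sup>2 * (\<beta> - \<alpha>)\<^sup>2 = 4"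
        by (simp_all add: \<sigma>_def c_def power_divide)
      moreover have "(\<beta> + \<alpha>)\<^sup>2 = (\<beta> - \<alpha>)\<^sup>2 + 4 * (\<alpha> * \<beta>)" by (simp add: power2_eq_square algebra_simps)
      ultimately have "(\<beta> - \<alpha>)\<^sup>2 * \<sigma>\<^sup>2 = (\<beta> - \<alpha>)\<^sup>2 * (1 + c\<^sup>2 * (\<alpha> * \<beta>))"
        by (simp add: algebra_simps)
      then have s2: "\<sigma>\<^sup>2 = 1 + c\<^sup>2 * (\<alpha> * \<beta>)" using \<open>\<beta> - \<alpha> \<noteq> 0\<close> by (metis mult_left_cancel zero_eq_power2)
      have "2 * \<sigma> = c * (\<alpha> + \<beta>)" by (simp add: \<sigma>_def c_def add_divide_distrib algebra_simps)
      then have s1: "2 * \<sigma> * c = c\<^sup>2 * (\<alpha> + \<beta>)" by (simp add: power2_eq_square)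
      show ?thesis unfolding s1 s2 by (simp add: algebra_simps)
    qed
    also have "\<dots> \<le> m0" using main by simp
    finally show ?thesis by (simp add: m_def)
  qed
  \<comment> \<open>Modulo the Krylov space, every vector of the iteration is a multiple of the exact solution \<open>g\<close>, and \<open>X\<close> acts on the coefficient as \<open>\<sigma>\<close>.\<close>
  have XK: "X y - (\<sigma> * \<theta>) *\<^sub>R g \<in> Kr (Suc j)" if z: "y - \<theta> *\<^sub>R g \<in> Kr j" and j: "s \<le> Suc j" for y \<theta> j
  proof -
    have "M *v y = M *v (y - \<theta> *\<^sub>R g) + \<theta> *\<^sub>R (M *v g)"
      by (simp add: matrix_vector_mult_diff_distrib matrix_vector_mult_scaleR)
    moreover have "M *v (y - \<theta> *\<^sub>R g) + \<theta> *\<^sub>R (M *v g) \<in> Kr (Suc j)"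
      using mult[OF z] b mono[of 1 "Suc j"] by (intro subspace_add subspace_scale Kr) auto
    ultimately have My: "M *v y \<in> Kr (Suc j)" by simp
    have "P (M *v y) \<in> Kr (Suc j)" using PQ QK mono[OF j] by blast
    then have DK: "D (M *v y) \<in> Kr (Suc j)" unfolding D_def using My by (intro subspace_diff Kr)
    have zz: "y - \<theta> *\<^sub>R g \<in> Kr (Suc j)" using z mono[of j "Suc j"] by auto
    have "\<sigma> *\<^sub>R (y - \<theta> *\<^sub>R g) - c *\<^sub>R D (M *v y) \<in> Kr (Suc j)"
      by (rule subspace_diff[OF Kr subspace_scale[OF Kr zz] subspace_scale[OF Kr DK]])
    moreover have "\<sigma> *\<^sub>R (y - \<theta> *\<^sub>R g) - c *\<^sub>R D (M *v y) = X y - (\<sigma> * \<theta>) *\<^sub>R g"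
      by (simp add: X_def algebra_simps)
    ultimately show ?thesis by simp
  qed
  \<comment> \<open>The numbers \<open>\<theta> = T\<^sub>k(\<sigma>)\<close> and \<open>\<omega> = U\<^sub>k\<^sub>-\<^sub>1(\<sigma>)\<close> satisfy \<open>\<theta> \<plusminus> \<delta> \<omega> = \<rho>\<^sup>\<plusminus>\<^sup>k\<close>, which avoids a closed form for \<open>\<omega>\<close>.\<close>
  define \<delta> where "\<delta> = (\<rho> - 1 / \<rho>) / 2"
  have \<sigma>\<rho>: "\<sigma> = (\<rho> + 1 / \<rho>) / 2" using \<rho>(2) by (simp add: \<sigma>_def)
  have sd: "\<sigma> + \<delta> = \<rho>" "\<sigma> - \<delta> = 1 / \<rho>" by (simp_all add: \<sigma>\<rho> \<delta>_def field_simps)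
  have sd2: "\<sigma> * \<sigma> - 1 = \<delta> * \<delta>" using \<rho>(1) by (simp add: \<sigma>\<rho> \<delta>_def field_simps)
  define E0 where "E0 = B (D g) (D g)"
  have "\<exists>\<tau> w \<theta> \<omega>. \<tau> \<in> U \<and> w \<in> U \<and> \<tau> - \<theta> *\<^sub>R g \<in> Kr (s + k) \<and> w - \<omega> *\<^sub>R g \<in> Kr (s + k - 1)
      \<and> B \<tau> \<tau> + B w w - B (X w) (X w) = E0 \<and> \<theta> + \<delta> * \<omega> = \<rho> ^ k \<and> \<theta> - \<delta> * \<omega> = (1 / \<rho>) ^ k"
  proof (induction k)
    case 0
    have "D g - 1 *\<^sub>R g \<in> Kr s"
      using PQ[of g] QK subspace_neg[OF Kr, of "P g" s] by (auto simp: D_def)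
    moreover have "X 0 \<in> U" "B (X 0) (X 0) \<le> 0"
      using XU[of 0] Xle[of 0] subspace_0[OF Usub] by (auto simp: B_def)
    moreover have "0 \<le> B (X 0) (X 0)" using sym_pos_defD(3)[OF M] by (simp add: B_def)
    moreover have "0 \<in> Kr (s + 0 - 1)" "0 \<in> U" using Kr Usub by (auto intro: subspace_0)
    moreover have "B 0 0 = 0" by (simp add: B_def)
    ultimately show ?case using DU[of g]
      by (intro exI[of _ "D g"] exI[of _ 0] exI[of _ 1]) (auto simp: E0_def)
  next
    case (Suc k)
    then obtain \<tau> w \<theta> \<omega> where IH: "\<tau> \<in> U" "w \<in> U" "\<tau> - \<theta> *\<^sub>R g \<in> Kr (s + k)" "w - \<omega> *\<^sub>R g \<in> Kr (s + k - 1)"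
      "B \<tau> \<tau> + B w w - B (X w) (X w) = E0" "\<theta> + \<delta> * \<omega> = \<rho> ^ k" "\<theta> - \<delta> * \<omega> = (1 / \<rho>) ^ k"
      by blast
    \<comment> \<open>The next pair is \<open>w' = y = X w + \<tau>\<close> and \<open>\<tau>' = X y - w\<close>.\<close>
    define y where "y = \<tau> + X w"
    define \<eta> where "\<eta> = \<theta> + \<sigma> * \<omega>"
    have yU: "y \<in> U" unfolding y_def using IH XU Usub by (intro subspace_add) auto
    have "X w - (\<sigma> * \<omega>) *\<^sub>R g \<in> Kr (s + k)" using XK[OF IH(4)] s by auto
    then have "(\<tau> - \<theta> *\<^sub>R g) + (X w - (\<sigma> * \<omega>) *\<^sub>R g) \<in> Kr (s + k)" using IH(3) by (intro subspace_add Kr)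
    then have yK: "y - \<eta> *\<^sub>R g \<in> Kr (s + k)" by (simp add: y_def \<eta>_def algebra_simps)
    have "X y - (\<sigma> * \<eta>) *\<^sub>R g \<in> Kr (s + Suc k)" using XK[OF yK] by simp
    moreover have "w - \<omega> *\<^sub>R g \<in> Kr (s + Suc k)" 
    proof -
      have "s + k - 1 \<le> s + Suc k" by arith
      from mono[OF this] IH(4) show ?thesis by blast
    qed
    ultimately have "(X y - (\<sigma> * \<eta>) *\<^sub>R g) - (w - \<omega> *\<^sub>R g) \<in> Kr (s + Suc k)"
      by (rule subspace_diff[OF Kr])
    then have tK: "(X y - w) - (\<sigma> * \<eta> - \<omega>) *\<^sub>R g \<in> Kr (s + Suc k)" by (simp add: algebra_simps)
    have tU: "X y - w \<in> U" using XU[OF yU] IH(2) Usub by (intro subspace_diff)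
    have "\<tau> = y - X w" by (simp add: y_def)
    then have "B \<tau> \<tau> = B y y - 2 * B y (X w) + B (X w) (X w)"
      by (simp add: Bdiff Bsym[of "X w" y])
    moreover have "B (X y - w) (X y - w) = B (X y) (X y) - 2 * B y (X w) + B w w"
      using Xsym[OF yU IH(2)] by (simp add: Bdiff Bsym[of w "X y"])
    ultimately have en: "B (X y - w) (X y - w) + B y y - B (X y) (X y) = E0" using IH(5) by simp
    have "(\<sigma> * \<eta> - \<omega>) + \<delta> * \<eta> = (\<sigma> + \<delta>) * \<theta> + (\<sigma> * \<sigma> - 1 + \<delta> * \<sigma>) * \<omega>"
      by (simp add: \<eta>_def algebra_simps)
    also have "\<dots> = (\<sigma> + \<delta>) * (\<theta> + \<delta> * \<omega>)" by (simp only: sd2) (simp add: algebra_simps)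
    finally have r1: "(\<sigma> * \<eta> - \<omega>) + \<delta> * \<eta> = \<rho> ^ Suc k" by (simp add: sd IH(6))
    have "(\<sigma> * \<eta> - \<omega>) - \<delta> * \<eta> = (\<sigma> - \<delta>) * \<theta> + (\<sigma> * \<sigma> - 1 - \<delta> * \<sigma>) * \<omega>"
      by (simp add: \<eta>_def algebra_simps)
    also have "\<dots> = (\<sigma> - \<delta>) * (\<theta> - \<delta> * \<omega>)" by (simp only: sd2) (simp add: algebra_simps)
    finally have r2: "(\<sigma> * \<eta> - \<omega>) - \<delta> * \<eta> = (1 / \<rho>) ^ Suc k" by (simp only: sd IH(7) power_Suc)
    show ?case
      by (rule exI[of _ "X y - w"], rule exI[of _ y], rule exI[of _ "\<sigma> * \<eta> - \<omega>"], rule exI[of _ \<eta>])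
        (use tU yU tK yK en r1 r2 in simp)
  qed
  then obtain \<tau> w \<theta> \<omega> where fin: "\<tau> \<in> U" "w \<in> U" "\<tau> - \<theta> *\<^sub>R g \<in> Kr (s + k)"
      "B \<tau> \<tau> + B w w - B (X w) (X w) = E0" "\<theta> + \<delta> * \<omega> = \<rho> ^ k" "\<theta> - \<delta> * \<omega> = (1 / \<rho>) ^ k"
    by blast
  have "2 * \<theta> = \<rho> ^ k + (1 / \<rho>) ^ k" using fin(5,6) by linarith
  moreover have "0 < (1 / \<rho>) ^ k" using \<rho>(1) by simp
  ultimately have th: "\<rho> ^ k / 2 \<le> \<theta>" by linarith
  have pk: "0 < \<rho> ^ k" using \<rho>(1) by simp
  with th have th0: "0 < \<theta>" by linarith
  have Bt: "B \<tau> \<tau> \<le> E0" using fin(4) Xle[OF fin(2)] by linarith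
  have E0: "E0 \<le> B g g"
  proof -
    have "galerkin M Q (M *v g) (P g)" by (rule P)
    from galerkin_energy[OF M Q this subspace_0[OF Q]]
    show ?thesis using sym_pos_defD(3)[OF M, of "P g"]
      by (simp add: sym_pos_def_inv_mult(2)[OF M] E0_def B_def D_def)
  qed
  have B0: "0 \<le> B \<tau> \<tau>" using sym_pos_defD(3)[OF M] by (simp add: B_def)
  define x where "x = (- inverse \<theta>) *\<^sub>R (\<tau> - \<theta> *\<^sub>R g)"
  have "x \<in> Kr (s + k)" unfolding x_def by (intro subspace_scale Kr fin)
  moreover have "g - x = inverse \<theta> *\<^sub>R \<tau>" using th0 by (simp add: x_def algebra_simps)
  then have "B (g - x) (g - x) = (inverse \<theta>)\<^sup>2 * B \<tau> \<tau>"
    by (simp only: Bscale power2_eq_square mult.assoc)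
  moreover have "(inverse \<theta>)\<^sup>2 * B \<tau> \<tau> \<le> (2 / \<rho> ^ k)\<^sup>2 * B g g"
  proof (intro mult_mono power_mono)
    show "inverse \<theta> \<le> 2 / \<rho> ^ k" using th th0 pk by (simp add: field_simps)
    show "B \<tau> \<tau> \<le> B g g" using Bt E0 by simp
  qed (use th0 B0 in auto)
  ultimately show ?thesis unfolding B_def by (intro bexI[of _ x]) auto
qed


section \<open>Deflation by powers of dual combinations\<close>

lemma eigen_power_inner:
  fixes A :: "real^'n^'n"
  assumes sym: "transpose A = A" and eig: "A *v v = c *\<^sub>R v"
  shows "((*v) A ^^ p) x \<bullet> v = c ^ p * (x \<bullet> v)"
  by (induction p) (simp_all add: symmetric_matrix_inner[OF sym] eig)

text \<open>
  By duality: \<open>z = M x\<close> is orthogonal to \<open>Q\<close>, so \<open>z \<bullet> z = x \<bullet> M (z - v)\<close> for every \<open>v\<close> in \<open>Q\<close>, and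
  Cauchy-Schwarz in the energy inner product reduces the claim to an approximation of \<open>z\<close> from \<open>Q\<close> with
  an error of energy at most \<open>26 (l + \<mu>)\<close> times \<open>z \<bullet> z\<close>. The approximation \<open>v\<close> removes exactly the components with
  eigenvalue above \<open>e\<^sup>2 l\<close>, creates none in the other directions of \<open>T\<close>, and outside \<open>T\<close> adds components
  \<open>\<zeta>\<close> that the powers of \<open>A\<close> have damped.
\<close>

lemma deflated_operator_upper_bound:
  fixes A :: "real^'n^'n" and V :: "'n \<Rightarrow> real^'n"
  assumes A: "sym_pos_def A" and V: "orthonormal_family V" "\<And>i. A *v V i = evl i *\<^sub>R V i"
    and pos: "\<And>i. evl i > 0" and \<mu>: "0 \<le> \<mu>" and l: "\<And>i. i \<notin> T \<Longrightarrow> evl i \<le> l" "0 < l"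
    and dual: "\<And>i j. i \<in> T \<Longrightarrow> j \<in> T \<Longrightarrow> V i \<bullet> y j = of_bool (i = j)"
    and small: "(\<Sum>i\<in>-T. \<Sum>j\<in>T. (V i \<bullet> y j)\<^sup>2) \<le> 25 * D\<^sup>2" and p: "D\<^sup>2 \<le> exp (4 * real p)"
    and x: "\<And>j. j \<in> T \<Longrightarrow> exp 2 * l < evl j \<Longrightarrow>
      (shifted_matrix A \<mu> *v x) \<bullet> ((1 / evl j ^ p) *\<^sub>R ((*v) A ^^ p) (y j)) = 0"
  shows "(shifted_matrix A \<mu> *v x) \<bullet> (shifted_matrix A \<mu> *v x)
    \<le> 36 * (l + \<mu>) * (x \<bullet> (shifted_matrix A \<mu> *v x))"
proof -
  define M where "M = shifted_matrix A \<mu>"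
  have M: "sym_pos_def M" unfolding M_def by (rule sym_pos_def_shifted[OF A \<mu>])
  have MV: "M *v V i = (evl i + \<mu>) *\<^sub>R V i" for i
    unfolding M_def by (rule shifted_eigen[OF V(2)])
  define T1 where "T1 = {j \<in> T. exp 2 * l < evl j}"
  define u where "u = (\<lambda>j. (1 / evl j ^ p) *\<^sub>R ((*v) A ^^ p) (y j))"
  define z where "z = M *v x"
  define a where "a = (\<lambda>i. z \<bullet> V i)"
  define Y where "Y = (\<lambda>i j. (evl i / evl j) ^ p * (V i \<bullet> y j))"
  have uV: "u j \<bullet> V i = Y i j" for i j
    by (simp add: u_def Y_def eigen_power_inner[OF sym_pos_defD(1)[OF A] V(2)] power_divide
        inner_commute[of "V i"])
  \<comment> \<open>the components outside \<open>T\<close> that the approximation \<open>v\<close> adds\<close>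
  define \<zeta> where "\<zeta> = (\<lambda>i. \<Sum>j\<in>T1. a j * Y i j)"
  define v where "v = (\<Sum>j\<in>T1. a j *\<^sub>R u j)"
  define c where "c = (\<lambda>i. (z - v) \<bullet> V i)"
  have c: "c i = a i - \<zeta> i" for i
    by (simp add: c_def a_def v_def \<zeta>_def inner_diff_left inner_sum_left uV)
  have T1T: "T1 \<subseteq> T" by (auto simp: T1_def)
  have Y1: "Y i j = of_bool (i = j)" if "i \<in> T" "j \<in> T1" for i j
    using that dual[of i j] T1T pos[of j] by (auto simp: Y_def)
  have cT1: "c i = 0" if "i \<in> T1" for i
  proof -
    have "\<zeta> i = (\<Sum>j\<in>T1. if j = i then a j else 0)"
      unfolding \<zeta>_def using that T1T by (intro sum.cong) (auto simp: Y1)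
    then show ?thesis using that by (simp add: c)
  qed
  have cT: "c i = a i" if "i \<in> T - T1" for i
  proof -
    have "\<zeta> i = 0"
      unfolding \<zeta>_def using that T1T by (intro sum.neutral) (auto simp: Y1)
    then show ?thesis by (simp add: c)
  qed
  have e2: "exp 2 \<le> (26::real)"
  proof -
    have "exp (1::real) \<le> 3" by (rule exp_le)
    then have "exp (1::real) * exp 1 \<le> 3 * 3" by (intro mult_mono) auto
    then show ?thesis by (simp add: exp_add[symmetric])
  qed
  have ratio: "(evl i / evl j) ^ p \<le> exp (- 2 * real p)" if "i \<in> -T" "j \<in> T1" for i j
  proof -
    have "evl i / evl j \<le> l / (exp 2 * l)"
      using that l pos[of i] pos[of j] by (intro frac_le) (auto simp: T1_def less_imp_le)
    also have "\<dots> = exp (- 2)" using l(2) by (simp add: exp_minus field_simps)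
    finally have "(evl i / evl j) ^ p \<le> exp (- 2) ^ p"
      using pos[of i] pos[of j] by (intro power_mono) (auto intro: divide_nonneg_nonneg less_imp_le)
    then show ?thesis by (simp add: exp_of_nat_mult[symmetric] mult.commute)
  qed
  have Ysq: "(Y i j)\<^sup>2 \<le> exp (- 4 * real p) * (V i \<bullet> y j)\<^sup>2" if "i \<in> -T" "j \<in> T1" for i j
  proof -
    have "((evl i / evl j) ^ p)\<^sup>2 \<le> (exp (- 2 * real p))\<^sup>2"
      using ratio[OF that] pos[of i] pos[of j]
      by (intro power_mono) (auto intro!: zero_le_power divide_nonneg_nonneg less_imp_le)
    also have "\<dots> = exp (- 4 * real p)" by (simp add: exp_double[symmetric])
    finally show ?thesis unfolding Y_def power_mult_distrib by (intro mult_right_mono) auto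
  qed
  have \<zeta>: "(\<Sum>i\<in>-T. (\<zeta> i)\<^sup>2) \<le> 25 * (\<Sum>j\<in>T1. (a j)\<^sup>2)"
  proof -
    have "(\<Sum>i\<in>-T. (\<zeta> i)\<^sup>2) \<le> (\<Sum>i\<in>-T. (\<Sum>j\<in>T1. (a j)\<^sup>2) * (\<Sum>j\<in>T1. (Y i j)\<^sup>2))"
      unfolding \<zeta>_def by (intro sum_mono Cauchy_Schwarz_ineq_sum)
    also have "\<dots> = (\<Sum>j\<in>T1. (a j)\<^sup>2) * (\<Sum>i\<in>-T. \<Sum>j\<in>T1. (Y i j)\<^sup>2)"
      by (simp add: sum_distrib_left)
    also have "\<dots> \<le> (\<Sum>j\<in>T1. (a j)\<^sup>2) * 25"
    proof (intro mult_left_mono)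
      have "(\<Sum>i\<in>-T. \<Sum>j\<in>T1. (Y i j)\<^sup>2) \<le> (\<Sum>i\<in>-T. \<Sum>j\<in>T1. exp (- 4 * real p) * (V i \<bullet> y j)\<^sup>2)"
        by (intro sum_mono Ysq)
      also have "\<dots> \<le> (\<Sum>i\<in>-T. \<Sum>j\<in>T. exp (- 4 * real p) * (V i \<bullet> y j)\<^sup>2)"
        using T1T by (intro sum_mono sum_mono2) auto
      also have "\<dots> = exp (- 4 * real p) * (\<Sum>i\<in>-T. \<Sum>j\<in>T. (V i \<bullet> y j)\<^sup>2)"
        by (simp add: sum_distrib_left)
      also have "\<dots> \<le> exp (- 4 * real p) * (25 * exp (4 * real p))"
        using small p by (intro mult_left_mono) auto
      also have "\<dots> = 25" by (simp add: exp_minus)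
      finally show "(\<Sum>i\<in>-T. \<Sum>j\<in>T1. (Y i j)\<^sup>2) \<le> 25" .
    qed (auto intro: sum_nonneg)
    finally show ?thesis by (simp add: mult.commute)
  qed
  have split: "(\<Sum>i\<in>UNIV. f i) = (\<Sum>i\<in>T1. f i) + (\<Sum>i\<in>T-T1. f i) + (\<Sum>i\<in>-T. f i)" for f :: "'n \<Rightarrow> real"
  proof -
    have "(\<Sum>i\<in>UNIV. f i) = (\<Sum>i\<in>T. f i) + (\<Sum>i\<in>-T. f i)"
      by (metis Compl_partition Compl_disjoint finite_class.finite_UNIV finite_subset subset_UNIV sum.union_disjoint)
    also have "(\<Sum>i\<in>T. f i) = (\<Sum>i\<in>T1. f i) + (\<Sum>i\<in>T-T1. f i)"
      using T1T by (metis add.commute finite_class.finite_UNIV finite_subset subset_UNIV sum.subset_diff)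
    finally show ?thesis .
  qed
  have l\<mu>: "0 \<le> l + \<mu>" using l(2) \<mu> by simp
  have zv: "(z - v) \<bullet> (M *v (z - v)) \<le> 26 * (l + \<mu>) * (z \<bullet> z)"
  proof -
    have "(z - v) \<bullet> (M *v (z - v)) = (\<Sum>i\<in>UNIV. (evl i + \<mu>) * (c i)\<^sup>2)"
      by (subst orthonormal_family_inner[OF V(1)])
        (simp add: c_def sym_pos_defD(4)[OF M] MV power2_eq_square algebra_simps)
    also have "\<dots> = (\<Sum>i\<in>T-T1. (evl i + \<mu>) * (c i)\<^sup>2) + (\<Sum>i\<in>-T. (evl i + \<mu>) * (c i)\<^sup>2)"
      unfolding split by (simp add: cT1)
    also have "\<dots> \<le> (\<Sum>i\<in>T-T1. (26 * (l + \<mu>)) * (a i)\<^sup>2) + (\<Sum>i\<in>-T. (l + \<mu>) * (26 * (a i)\<^sup>2 + (26/25) * (\<zeta> i)\<^sup>2))"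
    proof (intro add_mono sum_mono)
      fix i assume i: "i \<in> T - T1"
      then have "evl i \<le> exp 2 * l" by (auto simp: T1_def)
      also have "\<dots> \<le> 26 * l" using e2 l(2) by (intro mult_right_mono) auto
      finally show "(evl i + \<mu>) * (c i)\<^sup>2 \<le> (26 * (l + \<mu>)) * (a i)\<^sup>2"
        unfolding cT[OF i] using \<mu> by (intro mult_right_mono) auto
    next
      fix i assume i: "i \<in> -T"
      \<comment> \<open>The weights 26 and 26/25 match the bound \<open>\<Sum> \<zeta>\<^sup>2 \<le> 25 \<Sum> a\<^sup>2\<close>.\<close>
      have "0 \<le> (5 * a i + \<zeta> i / 5)\<^sup>2" by simp
      then have "(c i)\<^sup>2 \<le> 26 * (a i)\<^sup>2 + (26/25) * (\<zeta> i)\<^sup>2"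
        unfolding c by (simp add: power2_eq_square algebra_simps)
      then show "(evl i + \<mu>) * (c i)\<^sup>2 \<le> (l + \<mu>) * (26 * (a i)\<^sup>2 + (26/25) * (\<zeta> i)\<^sup>2)"
        using l(1)[of i] i l\<mu> by (intro mult_mono) auto
    qed
    also have "\<dots> = 26 * (l + \<mu>) * ((\<Sum>i\<in>T-T1. (a i)\<^sup>2) + (\<Sum>i\<in>-T. (a i)\<^sup>2) + (\<Sum>i\<in>-T. (\<zeta> i)\<^sup>2) / 25)"
    proof -
      have "(\<Sum>i\<in>-T. (l + \<mu>) * (26 * (a i)\<^sup>2 + (26/25) * (\<zeta> i)\<^sup>2))
          = (l + \<mu>) * (26 * (\<Sum>i\<in>-T. (a i)\<^sup>2) + (26/25) * (\<Sum>i\<in>-T. (\<zeta> i)\<^sup>2))"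
        by (simp only: sum_distrib_left[symmetric] sum.distrib)
      then show ?thesis by (simp only: sum_distrib_left[symmetric]) (simp add: algebra_simps)
    qed
    also have "\<dots> \<le> 26 * (l + \<mu>) * ((\<Sum>i\<in>T-T1. (a i)\<^sup>2) + (\<Sum>i\<in>-T. (a i)\<^sup>2) + (\<Sum>j\<in>T1. (a j)\<^sup>2))"
      using \<zeta> l\<mu> by (intro mult_left_mono add_left_mono) auto
    also have "(\<Sum>i\<in>T-T1. (a i)\<^sup>2) + (\<Sum>i\<in>-T. (a i)\<^sup>2) + (\<Sum>j\<in>T1. (a j)\<^sup>2) = z \<bullet> z"
    proof -
      have "z \<bullet> z = (\<Sum>i\<in>UNIV. (a i)\<^sup>2)"
        by (subst orthonormal_family_inner[OF V(1)]) (simp add: a_def power2_eq_square)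
      then show ?thesis unfolding split by simp
    qed
    finally show ?thesis .
  qed
  have "z \<bullet> u j = 0" if "j \<in> T1" for j
    using x[of j] that by (simp add: T1_def u_def z_def M_def)
  then have "z \<bullet> v = 0" by (simp add: v_def inner_sum_right)
  then have "z \<bullet> z = z \<bullet> (z - v)" by (simp add: inner_diff_right)
  also have "\<dots> = x \<bullet> (M *v (z - v))" by (simp add: z_def sym_pos_defD(4)[OF M])
  finally have "(z \<bullet> z)\<^sup>2 \<le> (x \<bullet> (M *v x)) * ((z - v) \<bullet> (M *v (z - v)))"
    using weighted_cauchy_schwarz[OF M, of x "z - v"] by simp
  also have "\<dots> \<le> (x \<bullet> (M *v x)) * (26 * (l + \<mu>) * (z \<bullet> z))"
    by (intro mult_left_mono zv sym_pos_defD(3)[OF M])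
  finally have "(z \<bullet> z) * (z \<bullet> z) \<le> (z \<bullet> z) * (26 * (l + \<mu>) * (x \<bullet> (M *v x)))"
    by (simp add: power2_eq_square mult_ac)
  have "0 \<le> (l + \<mu>) * (x \<bullet> (M *v x))" using l\<mu> sym_pos_defD(3)[OF M] by simp
  have "z \<bullet> z \<le> 26 * (l + \<mu>) * (x \<bullet> (M *v x))"
  proof (cases "z = 0")
    case True
    then show ?thesis using \<open>0 \<le> (l + \<mu>) * (x \<bullet> (M *v x))\<close> by (simp add: algebra_simps)
  next
    case False
    then have "0 < z \<bullet> z" by simp
    then show ?thesis
      using \<open>(z \<bullet> z) * (z \<bullet> z) \<le> (z \<bullet> z) * (26 * (l + \<mu>) * (x \<bullet> (M *v x)))\<close>
      by (rule mult_left_le_imp_le[rotated])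
  qed
  with \<open>0 \<le> (l + \<mu>) * (x \<bullet> (M *v x))\<close> show ?thesis
    unfolding z_def M_def by linarith
qed

lemma operator_lower_bound:
  fixes M :: "real^'n^'n" and V :: "'n \<Rightarrow> real^'n"
  assumes M: "sym_pos_def M" and V: "orthonormal_family V" "\<And>i. M *v V i = evl i *\<^sub>R V i"
    and lo: "\<And>i. \<alpha> \<le> evl i" and pos: "\<And>i. 0 \<le> evl i"
  shows "\<alpha> * (x \<bullet> (M *v x)) \<le> (M *v x) \<bullet> (M *v x)"
proof -
  have c: "(M *v x) \<bullet> V i = evl i * (x \<bullet> V i)" for i
    by (simp add: sym_pos_defD(4)[OF M] V(2))
  have "\<alpha> * (x \<bullet> (M *v x)) = (\<Sum>i\<in>UNIV. \<alpha> * (evl i * (x \<bullet> V i)\<^sup>2))"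
    by (subst orthonormal_family_inner[OF V(1)]) (simp add: c power2_eq_square sum_distrib_left algebra_simps)
  also have "\<dots> \<le> (\<Sum>i\<in>UNIV. evl i * (evl i * (x \<bullet> V i)\<^sup>2))"
    by (intro sum_mono mult_right_mono mult_nonneg_nonneg lo pos) auto
  also have "\<dots> = (M *v x) \<bullet> (M *v x)"
    by (subst orthonormal_family_inner[OF V(1)]) (simp add: c power2_eq_square algebra_simps)
  finally show ?thesis .
qed

text \<open>
  Deflation with the powers \<open>A\<^sup>p y\<^sub>j\<close> uses \<open>p + 1\<close> of the available degrees; the Chebyshev iteration uses
  the remaining \<open>k\<close>.
\<close>

theorem block_krylov_approximation:
  fixes A :: "real^'n^'n" and V :: "'n \<Rightarrow> real^'n"
  assumes A: "sym_pos_def A" and V: "orthonormal_family V" "\<And>i. A *v V i = evl i *\<^sub>R V i"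
    and pos: "\<And>i. evl i > 0" and \<mu>: "0 \<le> \<mu>" and l: "\<And>i. i \<notin> T \<Longrightarrow> evl i \<le> l"
    and lo: "0 < lo" "\<And>i. lo \<le> evl i" "lo \<le> l"
    and dual: "\<And>i j. i \<in> T \<Longrightarrow> j \<in> T \<Longrightarrow> V i \<bullet> y j = of_bool (i = j)"
    and small: "(\<Sum>i\<in>-T. \<Sum>j\<in>T. (V i \<bullet> y j)\<^sup>2) \<le> 25 * D\<^sup>2" and p: "D\<^sup>2 \<le> exp (4 * real p)"
    and yF: "\<And>j. j \<in> T \<Longrightarrow> y j \<in> span F" and bF: "b \<in> F"
  defines "M \<equiv> shifted_matrix A \<mu>"
  shows "\<exists>x\<in>krylov_space A F (Suc p + k).
      weighted_norm M (matrix_inv M *v b - x)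
      \<le> 2 * exp (- (real k / (3 * sqrt ((l + \<mu>) / (lo + \<mu>))))) * weighted_norm M (matrix_inv M *v b)"
proof -
  have M: "sym_pos_def M" unfolding M_def by (rule sym_pos_def_shifted[OF A \<mu>])
  have MV: "M *v V i = (evl i + \<mu>) *\<^sub>R V i" for i
    unfolding M_def by (rule shifted_eigen[OF V(2)])
  have l0: "0 < l" using lo by simp
  define g where "g = matrix_inv M *v b"
  have Mg: "M *v g = b" by (simp add: g_def sym_pos_def_inv_mult[OF M])
  define u where "u = (\<lambda>j. (1 / evl j ^ p) *\<^sub>R ((*v) A ^^ p) (y j))"
  define Q where "Q = span (u ` {j \<in> T. exp 2 * l < evl j})"
  define Kr where "Kr = krylov_space A F"
  define \<alpha> where "\<alpha> = lo + \<mu>"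
  define \<beta> where "\<beta> = 36 * (l + \<mu>)"
  \<comment> \<open>The factor 36 makes \<open>2 \<xi>\<close> equal to \<open>1 / (3 \<surd>\<kappa>)\<close>.\<close>
  define \<xi> where "\<xi> = sqrt (\<alpha> / \<beta>)"
  have \<alpha>: "0 < \<alpha>" using lo \<mu> by (simp add: \<alpha>_def)
  have \<beta>: "\<alpha> < \<beta>" using lo \<mu> by (simp add: \<alpha>_def \<beta>_def)
  have \<xi>: "0 < \<xi>" "\<xi> < 1" "\<xi>\<^sup>2 = \<alpha> / \<beta>" using \<alpha> \<beta> by (auto simp: \<xi>_def)
  have \<xi>': "\<xi> = 1 / (6 * sqrt ((l + \<mu>) / (lo + \<mu>)))"
  proof -
    have "sqrt 36 = (6::real)" by (rule real_sqrt_unique) auto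
    then have "sqrt (36 * (l + \<mu>)) = 6 * sqrt (l + \<mu>)" by (simp only: real_sqrt_mult)
    then show ?thesis by (simp add: \<xi>_def \<alpha>_def \<beta>_def real_sqrt_divide)
  qed
  define \<rho> where "\<rho> = (1 + \<xi>) / (1 - \<xi>)"
  have \<rho>1: "1 < \<rho>" using \<xi> by (simp add: \<rho>_def field_simps)
  have "(\<beta> + \<alpha>) / (\<beta> - \<alpha>) = (1 + \<xi>\<^sup>2) / (1 - \<xi>\<^sup>2)"
    using \<alpha> \<beta> by (simp add: \<xi>(3) field_simps)
  also have "\<dots> = (\<rho> + 1 / \<rho>) / 2"
  proof -
    have "1 + \<xi> \<noteq> 0" "1 - \<xi> \<noteq> 0" "1 - \<xi>\<^sup>2 = (1 - \<xi>) * (1 + \<xi>)"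
      using \<xi> by (auto simp: power2_eq_square algebra_simps)
    then show ?thesis by (simp add: \<rho>_def divide_simps) (simp add: power2_eq_square algebra_simps)
  qed
  finally have \<rho>2: "(\<beta> + \<alpha>) / (\<beta> - \<alpha>) = (\<rho> + 1 / \<rho>) / 2" .
  have QK: "Q \<subseteq> Kr (Suc p)"
    unfolding Q_def Kr_def
  proof (intro span_minimal subspace_krylov_space, clarify)
    fix j assume j: "j \<in> T"
    have "span F \<subseteq> krylov_space A F 1"
      by (intro span_minimal subspace_krylov_space) (auto intro: krylov_space_start)
    then have "((*v) A ^^ p) (y j) \<in> krylov_space A F (1 + p)"
      using yF[OF j] by (intro krylov_space_power) auto
    then show "u j \<in> krylov_space A F (Suc p)"
      unfolding u_def by (intro subspace_scale[OF subspace_krylov_space]) simp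
  qed
  have "\<exists>x\<in>Kr (Suc p + k). (g - x) \<bullet> (M *v (g - x)) \<le> (2 / \<rho> ^ k)\<^sup>2 * (g \<bullet> (M *v g))"
  proof (rule deflated_chebyshev[OF M, of Q Kr "Suc p" g \<alpha> \<beta> \<rho> k])
    show "subspace Q" by (simp add: Q_def)
    show "subspace (Kr j)" for j by (simp add: Kr_def subspace_krylov_space)
    show "Kr i \<subseteq> Kr j" if "i \<le> j" for i j unfolding Kr_def using that by (intro krylov_space_mono) auto
    show "M *v x \<in> Kr (Suc j)" if "x \<in> Kr j" for j x
      using krylov_space_mult[of x M F j] that by (simp add: Kr_def M_def krylov_space_shift)
    show "M *v g \<in> Kr 1" unfolding Mg Kr_def by (intro krylov_space_start bF) simp
    show "\<alpha> * (x \<bullet> (M *v x)) \<le> (M *v x) \<bullet> (M *v x)" for x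
      using lo pos \<mu> by (intro operator_lower_bound[OF M V(1) MV]) (auto simp: \<alpha>_def add_nonneg_nonneg less_imp_le)
    show "(M *v x) \<bullet> (M *v x) \<le> \<beta> * (x \<bullet> (M *v x))" if "\<And>y. y \<in> Q \<Longrightarrow> (M *v x) \<bullet> y = 0" for x
      unfolding \<beta>_def M_def
    proof (rule deflated_operator_upper_bound[OF A V pos \<mu> l l0 dual small p])
      fix j assume "j \<in> T" "exp 2 * l < evl j"
      then have "u j \<in> Q" unfolding Q_def by (intro span_base) auto
      from that[OF this] show "(shifted_matrix A \<mu> *v x) \<bullet> ((1 / evl j ^ p) *\<^sub>R ((*v) A ^^ p) (y j)) = 0"
        by (simp add: u_def M_def)
    qed
  qed (use QK \<beta> \<rho>1 \<rho>2 in auto)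
  then obtain x where x: "x \<in> Kr (Suc p + k)"
    "(g - x) \<bullet> (M *v (g - x)) \<le> (2 / \<rho> ^ k)\<^sup>2 * (g \<bullet> (M *v g))" by blast
  have "weighted_norm M (g - x) \<le> sqrt ((2 / \<rho> ^ k)\<^sup>2 * (g \<bullet> (M *v g)))"
    unfolding weighted_norm_def using x(2) by simp
  also have "\<dots> = (2 / \<rho> ^ k) * weighted_norm M g"
    using \<rho>1 by (simp add: real_sqrt_mult weighted_norm_def)
  also have "\<dots> \<le> 2 * exp (- (real k / (3 * sqrt ((l + \<mu>) / (lo + \<mu>))))) * weighted_norm M g"
  proof (intro mult_right_mono)
    have "exp (2 * \<xi>) \<le> \<rho>" unfolding \<rho>_def using \<xi> by (intro exp_le_ratio) auto
    then have "exp (2 * \<xi>) ^ k \<le> \<rho> ^ k" by (intro power_mono) auto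
    then have "exp (real k * (2 * \<xi>)) \<le> \<rho> ^ k" by (simp add: exp_of_nat_mult)
    moreover have "real k * (2 * \<xi>) = real k / (3 * sqrt ((l + \<mu>) / (lo + \<mu>)))" by (simp add: \<xi>')
    ultimately have "exp (real k / (3 * sqrt ((l + \<mu>) / (lo + \<mu>)))) \<le> \<rho> ^ k" by simp
    then have "2 / \<rho> ^ k \<le> 2 / exp (real k / (3 * sqrt ((l + \<mu>) / (lo + \<mu>))))"
      by (intro divide_left_mono) (use \<rho>1 in auto)
    then show "2 / \<rho> ^ k \<le> 2 * exp (- (real k / (3 * sqrt ((l + \<mu>) / (lo + \<mu>)))))"
      by (simp add: exp_minus inverse_eq_divide)
  qed (simp add: weighted_norm_def sym_pos_defD(3)[OF M])
  finally show ?thesis using x(1) by (auto simp: g_def Kr_def)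
qed

section \<open>Integrals of resolvents and an elliptic integral\<close>

lemma set_integral_FTC_ray:
  fixes f F :: "real \<Rightarrow> real"
  assumes F: "\<And>x. a < x \<Longrightarrow> (F has_real_derivative f x) (at x)" and f: "\<And>x. a < x \<Longrightarrow> isCont f x"
    and nonneg: "\<And>x. a < x \<Longrightarrow> 0 \<le> f x" and A: "isCont F a" and B: "(F \<longlongrightarrow> T) at_top"
  shows "set_integrable lborel {a<..} f" "(LINT x:{a<..}|lborel. f x) = T - F a"
proof -
  have A': "((F \<circ> real_of_ereal) \<longlongrightarrow> F a) (at_right (ereal a))"
    using A by (simp add: ereal_tendsto_simps isCont_def filterlim_at_split)
  have B': "((F \<circ> real_of_ereal) \<longlongrightarrow> T) (at_left \<infinity>)"
    using B by (simp add: ereal_tendsto_simps)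
  note * = interval_integral_FTC_nonneg[of "ereal a" \<infinity> F f "F a" T, OF _ _ _ _ A' B']
  show "set_integrable lborel {a<..} f" using *(1) F f nonneg by auto
  show "(LINT x:{a<..}|lborel. f x) = T - F a"
    using *(2) F f nonneg by (auto simp: interval_integral_to_infinity_eq)
qed

lemma set_integral_FTC_interval:
  fixes f F :: "real \<Rightarrow> real"
  assumes ab: "a < b" and F: "\<And>x. a < x \<Longrightarrow> (F has_real_derivative f x) (at x)" and f: "\<And>x. a < x \<Longrightarrow> isCont f x"
    and nonneg: "\<And>x. a < x \<Longrightarrow> 0 \<le> f x" and A: "isCont F a" and B: "isCont F b"
  shows "set_integrable lborel {a<..<b} f" "(LINT x:{a<..<b}|lborel. f x) = F b - F a"
proof -
  have A': "((F \<circ> real_of_ereal) \<longlongrightarrow> F a) (at_right (ereal a))"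
    using A by (simp add: ereal_tendsto_simps isCont_def filterlim_at_split)
  have B': "((F \<circ> real_of_ereal) \<longlongrightarrow> F b) (at_left (ereal b))"
    using B by (simp add: ereal_tendsto_simps isCont_def filterlim_at_split)
  note * = interval_integral_FTC_nonneg[of "ereal a" "ereal b" F f "F a" "F b", OF _ _ _ _ A' B']
  show "set_integrable lborel {a<..<b} f" using *(1) F f nonneg ab by auto
  show "(LINT x:{a<..<b}|lborel. f x) = F b - F a"
    using *(2) F f nonneg ab by (auto simp: interval_lebesgue_integral_def less_imp_le)
qed

lemma integral_resolvent:
  fixes c :: real
  assumes c: "c > 0"
  shows "set_integrable lborel {0<..} (\<lambda>z. c / (c + z\<^sup>2))"
    "(LINT z:{0<..}|lborel. c / (c + z\<^sup>2)) = sqrt c * (pi / 2)"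
proof -
  define F where "F = (\<lambda>z. sqrt c * arctan (z / sqrt c))"
  have F: "(F has_real_derivative (c / (c + z\<^sup>2))) (at z)" for z
  proof -
    have "(F has_real_derivative (sqrt c * (inverse (1 + (z / sqrt c)\<^sup>2) * (1 / sqrt c)))) (at z)"
      unfolding F_def using c
      by (intro DERIV_cmult DERIV_chain2[OF DERIV_arctan] DERIV_cdivide DERIV_ident)
    moreover have "sqrt c * (inverse (1 + (z / sqrt c)\<^sup>2) * (1 / sqrt c)) = c / (c + z\<^sup>2)"
    proof -
      have "c + z\<^sup>2 \<noteq> 0" using c by (metis add_pos_nonneg less_irrefl zero_le_power2)
      then have "inverse (1 + z\<^sup>2 / c) = c / (c + z\<^sup>2)" using c by (simp add: divide_simps)
      moreover have "(z / sqrt c)\<^sup>2 = z\<^sup>2 / c" using c by (simp add: power_divide)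
      ultimately show ?thesis using c by simp
    qed
    ultimately show ?thesis by simp
  qed
  have cont: "isCont (\<lambda>z. c / (c + z\<^sup>2)) z" for z
    using c by (intro continuous_intros) (metis add_pos_nonneg less_irrefl zero_le_power2)
  have "filterlim (\<lambda>z. z / sqrt c) at_top at_top"
    unfolding divide_inverse using c
    by (intro filterlim_at_top_mult_tendsto_pos[OF tendsto_const _ filterlim_ident]) auto
  then have lim: "(F \<longlongrightarrow> sqrt c * (pi / 2)) at_top"
    unfolding F_def by (intro tendsto_mult tendsto_const filterlim_compose[OF tendsto_arctan_at_top])
  have "isCont F 0" using F DERIV_isCont by blast
  from set_integral_FTC_ray[of 0 F "\<lambda>z. c / (c + z\<^sup>2)", OF F cont _ this lim] c
  show "set_integrable lborel {0<..} (\<lambda>z. c / (c + z\<^sup>2))"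
    "(LINT z:{0<..}|lborel. c / (c + z\<^sup>2)) = sqrt c * (pi / 2)"
    by (auto simp: F_def intro!: divide_nonneg_nonneg add_nonneg_nonneg)
qed

text \<open>
  The substitution \<open>z \<mapsto> p q / z\<close> preserves this complete elliptic integral, so it is split at the fixed
  point \<open>\<surd>(p q)\<close>. On the left half the factor \<open>p / \<surd>(p\<^sup>2 + z\<^sup>2)\<close> is bounded by 1, on the right half the
  factor \<open>\<surd>(q\<^sup>2 + z\<^sup>2)\<close> is bounded below by \<open>z\<close>; both remaining integrals are \<open>arsinh (\<surd>(p/q))\<close>.
\<close>

lemma elliptic_integral_bound:
  fixes p q :: real
  assumes q: "0 < q" and pq: "q \<le> p"
  defines "f \<equiv> (\<lambda>z. p / (sqrt (p\<^sup>2 + z\<^sup>2) * sqrt (q\<^sup>2 + z\<^sup>2)))"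
  shows "set_integrable lborel {0<..} f" "(LINT z:{0<..}|lborel. f z) \<le> 2 * arsinh (sqrt (p / q))"
proof -
  have p: "0 < p" using assms by simp
  \<comment> \<open>the point at which the integral is split\<close>
  define c where "c = sqrt (p * q)"
  have c: "0 < c" using p q by (simp add: c_def)
  define g1 where "g1 = (\<lambda>z. 1 / sqrt (q\<^sup>2 + z\<^sup>2))"
  define g2 where "g2 = (\<lambda>z. p / (z * sqrt (p\<^sup>2 + z\<^sup>2)))"
  have pos: "0 < sqrt (a\<^sup>2 + z\<^sup>2)" if "0 < a" for a z :: real
    using that by (simp add: add_pos_nonneg)
  have pn: "a\<^sup>2 + z\<^sup>2 \<noteq> 0" if "0 < a" for a z :: real
    using that by (metis add_pos_nonneg less_irrefl zero_le_power2 zero_less_power)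
  have D1: "((\<lambda>z. arsinh (z / q)) has_real_derivative g1 z) (at z)" for z
  proof -
    have "((\<lambda>z. arsinh (z / q)) has_real_derivative (1 / sqrt ((z / q)\<^sup>2 + 1) * (1 / q))) (at z)"
      using q by (intro DERIV_chain2[OF arsinh_real_has_field_derivative]) (auto intro!: derivative_eq_intros)
    moreover have "1 / sqrt ((z / q)\<^sup>2 + 1) * (1 / q) = g1 z"
    proof -
      have "sqrt ((z / q)\<^sup>2 + 1) * q = sqrt (((z / q)\<^sup>2 + 1) * q\<^sup>2)" using q by (simp add: real_sqrt_mult)
      also have "((z / q)\<^sup>2 + 1) * q\<^sup>2 = q\<^sup>2 + z\<^sup>2" using q by (simp add: power_divide field_simps)
      finally show ?thesis by (simp add: g1_def)
    qed
    ultimately show ?thesis by simp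
  qed
  have D2: "((\<lambda>z. - arsinh (p / z)) has_real_derivative g2 z) (at z)" if z: "0 < z" for z
  proof -
    have "((\<lambda>z. - arsinh (p / z)) has_real_derivative (- (1 / sqrt ((p / z)\<^sup>2 + 1) * (- p / z\<^sup>2)))) (at z)"
      using z by (intro DERIV_minus DERIV_chain2[OF arsinh_real_has_field_derivative])
        (auto intro!: derivative_eq_intros simp: power2_eq_square)
    moreover have "- (1 / sqrt ((p / z)\<^sup>2 + 1) * (- p / z\<^sup>2)) = g2 z"
    proof -
      have "sqrt ((p / z)\<^sup>2 + 1) * z = sqrt (((p / z)\<^sup>2 + 1) * z\<^sup>2)" using z by (simp add: real_sqrt_mult)
      also have "((p / z)\<^sup>2 + 1) * z\<^sup>2 = p\<^sup>2 + z\<^sup>2" using z by (simp add: power_divide field_simps)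
      finally have "sqrt ((p / z)\<^sup>2 + 1) * z\<^sup>2 = z * sqrt (p\<^sup>2 + z\<^sup>2)" by (simp add: power2_eq_square)
      then show ?thesis by (simp add: g2_def)
    qed
    ultimately show ?thesis by simp
  qed
  have C1: "isCont g1 z" for z
    unfolding g1_def using pos[OF q, of z] by (intro continuous_intros) auto
  have C2: "isCont g2 z" if "0 < z" for z
    unfolding g2_def using pos[OF p, of z] that by (intro continuous_intros) auto
  have N1: "0 \<le> g1 z" for z using pos[OF q, of z] by (simp add: g1_def)
  have N2: "0 \<le> g2 z" if "0 < z" for z using pos[OF p, of z] p that by (simp add: g2_def)
  have I1: "set_integrable lborel {0<..<c} g1" "(LINT z:{0<..<c}|lborel. g1 z) = arsinh (c / q)"
    using set_integral_FTC_interval[OF c D1 C1 N1 DERIV_isCont[OF D1] DERIV_isCont[OF D1]] by auto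
  have lim: "((\<lambda>z. - arsinh (p / z)) \<longlongrightarrow> 0) at_top"
  proof -
    have "((\<lambda>z. p / z) \<longlongrightarrow> 0) at_top" by (rule tendsto_divide_0[OF tendsto_const filterlim_at_top_imp_at_infinity[OF filterlim_ident]])
    moreover have "isCont arsinh (0::real)" by (rule DERIV_isCont) (rule arsinh_real_has_field_derivative)
    ultimately have "((\<lambda>z. arsinh (p / z)) \<longlongrightarrow> arsinh 0) at_top" by (rule isCont_tendsto_compose[rotated])
    then show ?thesis using tendsto_minus by fastforce
  qed
  have I2: "set_integrable lborel {c<..} g2" "(LINT z:{c<..}|lborel. g2 z) = arsinh (p / c)"
    using set_integral_FTC_ray[of c "\<lambda>z. - arsinh (p / z)" g2 0, OF D2 C2 N2 DERIV_isCont[OF D2[OF c]] lim] c by auto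
  have le1: "f z \<le> g1 z" for z
  proof -
    have "p = sqrt (p\<^sup>2)" using p by simp
    also have "\<dots> \<le> sqrt (p\<^sup>2 + z\<^sup>2)" by (rule real_sqrt_le_mono) simp
    finally show ?thesis using pos[OF p, of z] pos[OF q, of z] by (simp add: f_def g1_def field_simps)
  qed
  have le2: "f z \<le> g2 z" if z: "0 < z" for z
  proof -
    have "z = sqrt (z\<^sup>2)" using z by simp
    also have "\<dots> \<le> sqrt (q\<^sup>2 + z\<^sup>2)" by (rule real_sqrt_le_mono) simp
    finally show ?thesis using pos[OF p, of z] pos[OF q, of z] p z
      by (simp add: f_def g2_def frac_le mult.commute mult_mono)
  qed
  have fnn: "0 \<le> f z" for z using pos[OF p, of z] pos[OF q, of z] p by (simp add: f_def)
  have fm: "f \<in> borel_measurable borel" unfolding f_def by measurable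
  have g1m: "g1 \<in> borel_measurable borel" unfolding g1_def by measurable
  have g2m: "g2 \<in> borel_measurable borel" unfolding g2_def by measurable
  define h where "h = (\<lambda>z. indicator {0<..<c} z *\<^sub>R g1 z + indicator {c<..} z *\<^sub>R g2 z)"
  have h: "integrable lborel h"
    unfolding h_def using I1(1) I2(1) by (auto simp: set_integrable_def)
  have hI: "(LINT z|lborel. h z) = arsinh (c / q) + arsinh (p / c)"
    unfolding h_def using I1 I2
    by (subst Bochner_Integration.integral_add) (auto simp: set_integrable_def set_lebesgue_integral_def)
  have fh: "AE z in lborel. indicator {0<..} z *\<^sub>R f z \<le> h z"
  proof (rule AE_mp[OF AE_lborel_singleton[of c]], rule AE_I2, rule impI)
    fix z assume "z \<noteq> c"
    then show "indicator {0<..} z *\<^sub>R f z \<le> h z"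
      using c le1[of z] le2[of z] by (auto simp: h_def indicator_def)
  qed
  have int: "integrable lborel (\<lambda>z. indicator {0<..} z *\<^sub>R f z)"
  proof (rule Bochner_Integration.integrable_bound[OF h])
    show "(\<lambda>z. indicator {0<..} z *\<^sub>R f z) \<in> borel_measurable lborel" using fm by simp
    show "AE z in lborel. norm (indicator {0<..} z *\<^sub>R f z) \<le> norm (h z)"
      using fh by eventually_elim (use fnn in \<open>auto simp: abs_le_iff intro: order_trans\<close>)
  qed
  then show "set_integrable lborel {0<..} f" by (simp add: set_integrable_def)
  have "(LINT z:{0<..}|lborel. f z) \<le> (LINT z|lborel. h z)"
    unfolding set_lebesgue_integral_def by (rule integral_mono_AE[OF int h fh])
  also have "\<dots> = 2 * arsinh (sqrt (p / q))"
  proof -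
    have "c / q = sqrt (p / q)" "p / c = sqrt (p / q)"
    proof -
      have "(c / q)\<^sup>2 = p / q" "(p / c)\<^sup>2 = p / q"
        using p q by (simp_all add: c_def power_divide power2_eq_square)
      then show "c / q = sqrt (p / q)" "p / c = sqrt (p / q)"
        using c p q by (metis divide_nonneg_pos less_imp_le real_sqrt_unique)+
    qed
    then show ?thesis by (simp add: hI)
  qed
  finally show "(LINT z:{0<..}|lborel. f z) \<le> 2 * arsinh (sqrt (p / q))" .
qed

text \<open>
  With \<open>x\<^sup>4 = \<kappa>\<close> this bounds the elliptic integral by the logarithm in the final estimate. As
  \<open>\<pi> > 3\<close>, it is enough that \<open>arsinh x \<le> (3/2) log (2 x)\<close>.
\<close>

lemma arsinh_le_ln:
  fixes x :: real
  assumes x: "1 \<le> x"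
  shows "(4 / pi) * (2 * arsinh x) \<le> ln (16 * x ^ 4)"
proof -
  \<comment> \<open>The constant 3/2 exceeds \<open>\<surd>2\<close>, and \<open>(5/2)\<^sup>2 \<le> 2\<^sup>3\<close>.\<close>
  have "sqrt (x\<^sup>2 + 1) \<le> sqrt ((3/2 * x)\<^sup>2)"
  proof (rule real_sqrt_le_mono)
    have "1 \<le> x\<^sup>2" using x by (simp add: one_le_power)
    then show "x\<^sup>2 + 1 \<le> (3/2 * x)\<^sup>2" by (simp add: power_mult_distrib power2_eq_square)
  qed
  then have "x + sqrt (x\<^sup>2 + 1) \<le> 5/2 * x" using x by simp
  moreover have "0 < x + sqrt (x\<^sup>2 + 1)" using x by (simp add: add_pos_nonneg)
  ultimately have "arsinh x \<le> ln (5/2 * x)"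
    unfolding arsinh_real_def by simp
  also have "\<dots> = ln (5/2) + ln x" using x ln_mult[of "5/2" x] by simp
  also have "ln (5/2) \<le> 3/2 * ln (2::real)"
  proof -
    have "2 * ln (5/2) = ln ((5/2)^2 :: real)" by (simp add: ln_realpow)
    also have "\<dots> \<le> ln (2 ^ 3)" by (simp add: power2_eq_square)
    also have "\<dots> = 3 * ln (2::real)" using ln_realpow[of "2::real" 3] by simp
    finally show ?thesis by simp
  qed
  also have "3/2 * ln 2 + ln x \<le> 3/2 * ln (2 * x)" using x by (simp add: ln_mult)
  finally have a: "arsinh x \<le> 3/2 * ln (2 * x)" by simp
  have l: "0 \<le> ln (2 * x)" using x by simp
  have "(4 / pi) * (2 * arsinh x) \<le> (4 / 3) * (2 * (3/2 * ln (2 * x)))"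
  proof (rule mult_mono)
    show "4 / pi \<le> 4 / (3::real)" using pi_gt3 by (simp add: field_simps)
    have "1 \<le> x + sqrt (x\<^sup>2 + 1)" using x by (simp add: add_increasing2)
    then have "0 \<le> arsinh x" unfolding arsinh_real_def by (rule ln_ge_zero)
    then show "0 \<le> 2 * arsinh x" by (rule mult_nonneg_nonneg[rotated]) simp
    show "2 * arsinh x \<le> 2 * (3/2 * ln (2 * x))" using a by simp
  qed simp
  also have "\<dots> = 4 * ln (2 * x)" by simp
  also have "\<dots> = ln ((2 * x) ^ 4)" using x ln_realpow[of "2 * x" 4] by (simp del: ln_realpow)
  also have "(2 * x) ^ 4 = 16 * x ^ 4" by (simp add: power_mult_distrib)
  finally show ?thesis .
qed

section \<open>From shifted systems to the square root\<close>

text \<open>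
  Applying \<open>A\<close> to an error with energy norm \<open>\<epsilon>\<close> gives a Euclidean norm of at most
  \<open>hi \<epsilon> / \<surd>(hi + \<mu>)\<close>, and the initial energy error is at most \<open>\<parallel>b\<parallel> / \<surd>(lo + \<mu>)\<close>. The integrand of the
  total error is therefore dominated by that of an elliptic integral.
\<close>

theorem sqrt_error_from_shifted_errors:
  fixes A :: "real^'n^'n" and V :: "'n \<Rightarrow> real^'n" and c :: "real \<Rightarrow> real^'n"
  assumes A: "sym_pos_def A" and V: "orthonormal_family V" "\<And>i. A *v V i = evl i *\<^sub>R V i"
    and lo: "0 < lo" "\<And>i. lo \<le> evl i" and hi: "\<And>i. evl i \<le> hi" and K: "0 \<le> K"
    and err: "\<And>\<mu>. 0 \<le> \<mu> \<Longrightarrow> weighted_norm (shifted_matrix A \<mu>) (matrix_inv (shifted_matrix A \<mu>) *v b - c \<mu>)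
        \<le> 2 * K * weighted_norm (shifted_matrix A \<mu>) (matrix_inv (shifted_matrix A \<mu>) *v b)"
    and meas: "(\<lambda>z. c (z\<^sup>2)) \<in> borel_measurable borel"
  shows "norm (matrix_sqrt A *v b - (2 / pi) *\<^sub>R (LBINT z=0..\<infinity>. A *v c (z\<^sup>2)))
    \<le> ln (16 * (hi / lo)) * K * (sqrt hi * norm b)"
proof -
  have pos: "0 < evl i" for i using lo(1) lo(2)[of i] by simp
  have lohi: "lo \<le> hi" using lo(2) hi order_trans by blast
  have hi0: "0 < hi" using lo lohi by linarith
  define p where "p = sqrt hi"
  define q where "q = sqrt lo"
  have p: "0 < p" "p\<^sup>2 = hi" and q: "0 < q" "q\<^sup>2 = lo" using lo hi0 by (auto simp: p_def q_def)
  have qp: "q \<le> p" using lohi by (simp add: p_def q_def)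
  let ?M = "\<lambda>\<mu>. shifted_matrix A \<mu>"
  have M: "sym_pos_def (?M \<mu>)" if "0 \<le> \<mu>" for \<mu> by (rule sym_pos_def_shifted[OF A that])
  have MV: "?M \<mu> *v V i = (evl i + \<mu>) *\<^sub>R V i" for \<mu> i by (rule shifted_eigen[OF V(2)])
  define g where "g = (\<lambda>\<mu>. matrix_inv (?M \<mu>) *v b)"
  have gV: "g \<mu> \<bullet> V i = (b \<bullet> V i) / (evl i + \<mu>)" if \<mu>: "0 \<le> \<mu>" for \<mu> i
  proof -
    have "b \<bullet> V i = (?M \<mu> *v g \<mu>) \<bullet> V i" by (simp add: g_def sym_pos_def_inv_mult[OF M[OF \<mu>]])
    also have "\<dots> = (evl i + \<mu>) * (g \<mu> \<bullet> V i)" by (simp add: sym_pos_defD(4)[OF M[OF \<mu>]] MV)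
    finally show ?thesis using pos[of i] \<mu> by (simp add: field_simps)
  qed
  define w where "w = (\<lambda>i. (b \<bullet> V i) *\<^sub>R V i)"
  define F where "F = (\<lambda>z. \<Sum>i\<in>UNIV. (evl i / (evl i + z\<^sup>2)) *\<^sub>R w i)"
  have F: "A *v g (z\<^sup>2) = F z" for z
  proof -
    have "A *v g (z\<^sup>2) = (\<Sum>i\<in>UNIV. ((A *v g (z\<^sup>2)) \<bullet> V i) *\<^sub>R V i)"
      by (rule orthonormal_family_expand[OF V(1), symmetric])
    also have "\<dots> = F z"
      unfolding F_def w_def by (intro sum.cong refl) (simp add: sym_pos_defD(4)[OF A] V(2) gV)
    finally show ?thesis .
  qed
  have F': "indicator {0<..} z *\<^sub>R F z
      = (\<Sum>i\<in>UNIV. (indicator {0<..} z *\<^sub>R (evl i / (evl i + z\<^sup>2))) *\<^sub>R w i)" for z :: real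
    by (simp only: F_def scaleR_sum_right scaleR_scaleR real_scaleR_def)
  have Fint: "set_integrable lborel {0<..} F"
    unfolding set_integrable_def F'
    by (intro Bochner_Integration.integrable_sum Bochner_Integration.integrable_scaleR_left
        integral_resolvent(1)[OF pos, unfolded set_integrable_def])
  have FI: "(LINT z:{0<..}|lborel. F z) = (pi / 2) *\<^sub>R (matrix_sqrt A *v b)"
  proof -
    have "(LINT z:{0<..}|lborel. F z)
        = (\<Sum>i\<in>UNIV. (LINT z:{0<..}|lborel. evl i / (evl i + z\<^sup>2)) *\<^sub>R w i)"
      unfolding set_lebesgue_integral_def F'
      by (subst Bochner_Integration.integral_sum)
        (intro Bochner_Integration.integrable_scaleR_left sum.cong refl
          Bochner_Integration.integral_scaleR_left integral_resolvent(1)[OF pos, unfolded set_integrable_def])+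
    also have "\<dots> = (\<Sum>i\<in>UNIV. (sqrt (evl i) * (pi / 2)) *\<^sub>R w i)"
      by (simp only: integral_resolvent(2)[OF pos])
    also have "\<dots> = (pi / 2) *\<^sub>R (\<Sum>i\<in>UNIV. (b \<bullet> V i) *\<^sub>R (sqrt (evl i) *\<^sub>R V i))"
      by (simp add: w_def scaleR_sum_right mult_ac)
    also have "(\<Sum>i\<in>UNIV. (b \<bullet> V i) *\<^sub>R (sqrt (evl i) *\<^sub>R V i)) = matrix_sqrt A *v (\<Sum>i\<in>UNIV. (b \<bullet> V i) *\<^sub>R V i)"
      by (simp add: linear_sum[OF matrix_vector_mul_linear] matrix_vector_mult_scaleR
          matrix_sqrt_eigen(1)[OF V pos] o_def)
    also have "(\<Sum>i\<in>UNIV. (b \<bullet> V i) *\<^sub>R V i) = b" by (rule orthonormal_family_expand[OF V(1)])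
    finally show ?thesis .
  qed
  define e where "e = (\<lambda>z. p / (sqrt (p\<^sup>2 + z\<^sup>2) * sqrt (q\<^sup>2 + z\<^sup>2)))"
  define C where "C = 2 * K * p * norm b"
  have C: "0 \<le> C" using K p by (simp add: C_def)
  have FH: "norm (F z - A *v c (z\<^sup>2)) \<le> C * e z" for z
  proof -
    define \<mu> where "\<mu> = z\<^sup>2"
    have \<mu>: "0 \<le> \<mu>" by (simp add: \<mu>_def)
    define d where "d = g \<mu> - c \<mu>"
    have \<mu>p: "0 < hi + \<mu>" "0 < lo + \<mu>" using hi0 lo \<mu> by auto
    have "(A *v d) \<bullet> (A *v d) = (\<Sum>i\<in>UNIV. (evl i * (d \<bullet> V i)) * (evl i * (d \<bullet> V i)))"
      by (subst orthonormal_family_inner[OF V(1)]) (simp add: sym_pos_defD(4)[OF A] V(2))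
    also have "\<dots> \<le> (\<Sum>i\<in>UNIV. (hi\<^sup>2 / (hi + \<mu>)) * ((d \<bullet> V i) * ((evl i + \<mu>) * (d \<bullet> V i))))"
    proof (intro sum_mono)
      fix i :: 'n
      have "evl i * evl i * hi \<le> evl i * hi * hi" using hi[of i] pos[of i] hi0 by (intro mult_right_mono mult_left_mono) auto
      moreover have "evl i * evl i * \<mu> \<le> hi * hi * \<mu>" using hi[of i] pos[of i] hi0 \<mu> by (intro mult_right_mono mult_mono) auto
      ultimately have "(evl i * evl i) * (hi + \<mu>) \<le> hi\<^sup>2 * (evl i + \<mu>)" by (simp add: power2_eq_square algebra_simps)
      then have "evl i * evl i \<le> (hi\<^sup>2 / (hi + \<mu>)) * (evl i + \<mu>)" using \<mu>p by (simp add: field_simps)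
      then have "(evl i * evl i) * (d \<bullet> V i)\<^sup>2 \<le> ((hi\<^sup>2 / (hi + \<mu>)) * (evl i + \<mu>)) * (d \<bullet> V i)\<^sup>2"
        by (rule mult_right_mono) simp
      then show "(evl i * (d \<bullet> V i)) * (evl i * (d \<bullet> V i)) \<le> (hi\<^sup>2 / (hi + \<mu>)) * ((d \<bullet> V i) * ((evl i + \<mu>) * (d \<bullet> V i)))"
        by (simp add: power2_eq_square mult_ac)
    qed
    also have "\<dots> = (hi\<^sup>2 / (hi + \<mu>)) * (d \<bullet> (?M \<mu> *v d))"
      by (subst orthonormal_family_inner[OF V(1)]) (simp add: sum_distrib_left sym_pos_defD(4)[OF M[OF \<mu>]] MV)
    finally have "sqrt ((A *v d) \<bullet> (A *v d)) \<le> sqrt ((hi\<^sup>2 / (hi + \<mu>)) * (d \<bullet> (?M \<mu> *v d)))"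
      by (rule real_sqrt_le_mono)
    then have 1: "norm (A *v d) \<le> (hi / sqrt (hi + \<mu>)) * weighted_norm (?M \<mu>) d"
      using hi0 by (simp add: norm_eq_sqrt_inner weighted_norm_def real_sqrt_mult real_sqrt_divide)
    have 2: "weighted_norm (?M \<mu>) d \<le> 2 * K * weighted_norm (?M \<mu>) (g \<mu>)"
      using err[OF \<mu>] by (simp add: d_def g_def)
    have "g \<mu> \<bullet> (?M \<mu> *v g \<mu>) = g \<mu> \<bullet> b" by (simp add: g_def sym_pos_def_inv_mult[OF M[OF \<mu>]])
    also have "\<dots> = (\<Sum>i\<in>UNIV. (b \<bullet> V i)\<^sup>2 / (evl i + \<mu>))"
      by (subst orthonormal_family_inner[OF V(1)]) (simp add: gV[OF \<mu>] power2_eq_square)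
    also have "\<dots> \<le> (\<Sum>i\<in>UNIV. (b \<bullet> V i)\<^sup>2 / (lo + \<mu>))"
      using lo \<mu>p by (intro sum_mono divide_left_mono mult_pos_pos) (auto intro: add_pos_nonneg[OF pos \<mu>])
    also have "\<dots> = (norm b)\<^sup>2 / (lo + \<mu>)"
      unfolding power2_norm_eq_inner
      by (subst orthonormal_family_inner[OF V(1)]) (simp add: power2_eq_square sum_divide_distrib)
    finally have "sqrt (g \<mu> \<bullet> (?M \<mu> *v g \<mu>)) \<le> sqrt ((norm b)\<^sup>2 / (lo + \<mu>))" by (rule real_sqrt_le_mono)
    then have 3: "weighted_norm (?M \<mu>) (g \<mu>) \<le> norm b / sqrt (lo + \<mu>)"
      by (simp add: weighted_norm_def real_sqrt_divide)
    have "norm (A *v d) \<le> (hi / sqrt (hi + \<mu>)) * (2 * K * (norm b / sqrt (lo + \<mu>)))"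
      using 1 2 3 K hi0 \<mu>p
      by (meson divide_nonneg_nonneg less_imp_le mult_left_mono mult_nonneg_nonneg order_trans real_sqrt_ge_zero zero_le_numeral)
    also have "\<dots> = C * e z"
      by (simp add: C_def e_def p(2) q(2) \<mu>_def[symmetric]) (simp add: p(2)[symmetric] power2_eq_square)
    finally show ?thesis by (simp add: d_def F[symmetric] matrix_vector_mult_diff_distrib \<mu>_def)
  qed
  define H where "H = (\<lambda>z. A *v c (z\<^sup>2))"
  have Hm: "H \<in> borel_measurable borel"
    unfolding H_def by (intro measurable_matrix_vector_mult borel_measurable_const meas)
  have Fm: "F \<in> borel_measurable borel" unfolding F_def by measurable
  have eint: "integrable lborel (\<lambda>z. indicator {0<..} z *\<^sub>R (C * e z))"
  proof -
    have "integrable lborel (\<lambda>z. C * (indicator {0<..} z *\<^sub>R e z))"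
      using elliptic_integral_bound(1)[OF q(1) qp] unfolding set_integrable_def e_def
      by (rule Bochner_Integration.integrable_mult_right)
    then show ?thesis by (simp add: mult_ac)
  qed
  have FHint: "integrable lborel (\<lambda>z. indicator {0<..} z *\<^sub>R (F z - H z))"
  proof (rule Bochner_Integration.integrable_bound[OF eint])
    show "(\<lambda>z. indicator {0<..} z *\<^sub>R (F z - H z)) \<in> borel_measurable lborel" using Fm Hm by simp
    show "AE z in lborel. norm (indicator {0<..} z *\<^sub>R (F z - H z)) \<le> norm (indicator {0<..} z *\<^sub>R (C * e z))"
      using FH by (intro AE_I2) (auto simp: indicator_def H_def intro: order_trans[OF _ abs_ge_self])
  qed
  have "(LINT z:{0<..}|lborel. F z) - (LINT z:{0<..}|lborel. H z) = (LINT z|lborel. indicator {0<..} z *\<^sub>R (F z - H z))"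
  proof -
    have "integrable lborel (\<lambda>z. indicator {0<..} z *\<^sub>R F z - indicator {0<..} z *\<^sub>R (F z - H z))"
      using Fint FHint unfolding set_integrable_def by (rule Bochner_Integration.integrable_diff)
    then have "integrable lborel (\<lambda>z. indicator {0<..} z *\<^sub>R H z)" by (simp add: algebra_simps)
    then show ?thesis using Fint unfolding set_integrable_def set_lebesgue_integral_def
      by (simp add: scaleR_diff_right)
  qed
  also have "norm \<dots> \<le> (LINT z|lborel. indicator {0<..} z *\<^sub>R (C * e z))"
  proof (rule Bochner_Integration.integral_norm_bound_integral[OF FHint eint])
    fix z show "norm (indicator {0<..} z *\<^sub>R (F z - H z)) \<le> indicator {0<..} z *\<^sub>R (C * e z)"
      using FH[of z] by (auto simp: indicator_def H_def)
  qed
  also have "\<dots> = C * (LINT z:{0<..}|lborel. e z)"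
    unfolding set_lebesgue_integral_def by (simp add: mult_ac)
  also have "\<dots> \<le> C * (2 * arsinh (sqrt (p / q)))"
    using elliptic_integral_bound(2)[OF q(1) qp] C unfolding e_def by (rule mult_left_mono)
  finally have main: "norm ((pi / 2) *\<^sub>R (matrix_sqrt A *v b) - (LINT z:{0<..}|lborel. H z)) \<le> C * (2 * arsinh (sqrt (p / q)))"
    unfolding FI .
  have "matrix_sqrt A *v b - (2 / pi) *\<^sub>R (LBINT z=0..\<infinity>. H z)
      = (2 / pi) *\<^sub>R ((pi / 2) *\<^sub>R (matrix_sqrt A *v b) - (LINT z:{0<..}|lborel. H z))"
    by (simp add: interval_lebesgue_integral_0_infty scaleR_diff_right)
  then have "norm (matrix_sqrt A *v b - (2 / pi) *\<^sub>R (LBINT z=0..\<infinity>. H z)) \<le> (2 / pi) * (C * (2 * arsinh (sqrt (p / q))))"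
    using main by (simp add: divide_right_mono)
  also have "\<dots> = ((4 / pi) * (2 * arsinh (sqrt (p / q)))) * (K * p * norm b)" by (simp add: C_def)
  also have "\<dots> \<le> ln (16 * (sqrt (p / q)) ^ 4) * (K * p * norm b)"
    using p q qp K by (intro mult_right_mono arsinh_le_ln) auto
  also have "(sqrt (p / q)) ^ 4 = hi / lo"
  proof -
    have "(sqrt (p / q)) ^ 4 = ((sqrt (p / q))\<^sup>2)\<^sup>2" by (simp flip: power_mult)
    then show ?thesis using p q by (simp add: power_divide)
  qed
  finally show ?thesis by (simp add: H_def p_def mult_ac)
qed

section \<open>Measurability of the iterates\<close>

text \<open>
  Joint measurability in the data and the shift, obtained by letting both depend on \<open>\<omega>\<close>; it is needed
  to integrate over the shift.
\<close>

lemma measurable_bcg: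
  fixes A :: "real^'d^'d"
  assumes A: "sym_pos_def A" and b: "\<And>k. k \<in> {1..m} \<Longrightarrow> b k \<in> borel_measurable N"
    and i: "i \<in> {1..m}" and Z: "Z \<in> borel_measurable N"
  shows "(\<lambda>\<omega>. bcg A m (\<lambda>k. b k \<omega>) t i ((Z \<omega>)\<^sup>2)) \<in> borel_measurable N"
proof (rule measurable_galerkin[where J = "{..<t} \<times> {1..m}" and w = "\<lambda>(j, k) \<omega>. ((*v) A ^^ j) (b k \<omega>)"
      and M = "\<lambda>\<omega>. shifted_matrix A ((Z \<omega>)\<^sup>2)" and b = "b i"])
  show "(case jk of (j, k) \<Rightarrow> \<lambda>\<omega>. ((*v) A ^^ j) (b k \<omega>)) \<in> borel_measurable N" if "jk \<in> {..<t} \<times> {1..m}" for jk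
    using that b by (cases jk) (auto intro: measurable_matrix_power)
  have "(\<lambda>\<omega>. mat ((Z \<omega>)\<^sup>2) :: real^'d^'d) \<in> borel_measurable N"
    unfolding mat_def
  proof (intro measurable_vec_lambda)
    fix i j :: 'd
    show "(\<lambda>\<omega>. if i = j then (Z \<omega>)\<^sup>2 else 0) \<in> borel_measurable N"
      using Z by (cases "i = j") simp_all
  qed
  then show "(\<lambda>\<omega>. shifted_matrix A ((Z \<omega>)\<^sup>2)) \<in> borel_measurable N"
    unfolding shifted_matrix_def by (intro borel_measurable_add) auto
  show "sym_pos_def (shifted_matrix A ((Z \<omega>)\<^sup>2))" for \<omega> by (rule sym_pos_def_shifted[OF A]) simp
  fix \<omega>
  have "((\<lambda>jk. (case jk of (j, k) \<Rightarrow> \<lambda>\<omega>. ((*v) A ^^ j) (b k \<omega>)) \<omega>) ` ({..<t} \<times> {1..m}))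
      = {((*v) A ^^ j) v | j v. j < t \<and> v \<in> (\<lambda>k. b k \<omega>) ` {1..m}}"
    (is "?L = ?R")
  proof
    show "?L \<subseteq> ?R" by auto
    show "?R \<subseteq> ?L"
    proof clarify
      fix j k assume "j < t" "k \<in> {1..m}"
      then show "((*v) A ^^ j) (b k \<omega>) \<in> ?L" by (intro image_eqI[of _ _ "(j, k)"]) auto
    qed
  qed
  then show "galerkin (shifted_matrix A ((Z \<omega>)\<^sup>2))
      (span ((\<lambda>jk. (case jk of (j, k) \<Rightarrow> \<lambda>\<omega>. ((*v) A ^^ j) (b k \<omega>)) \<omega>) ` ({..<t} \<times> {1..m}))) (b i \<omega>)
      (bcg A m (\<lambda>k. b k \<omega>) t i ((Z \<omega>)\<^sup>2))"
    using bcg_galerkin[OF A, of "(Z \<omega>)\<^sup>2" "\<lambda>k. b k \<omega>" m t i] by (simp add: krylov_space_def)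
qed (use b i in auto)

lemma measurable_bsq:
  fixes A :: "real^'d^'d"
  assumes A: "sym_pos_def A" and b: "\<And>k. k \<in> {1..m} \<Longrightarrow> b k \<in> borel_measurable N" and i: "i \<in> {1..m}"
  shows "(\<lambda>\<omega>. bsq A m (\<lambda>k. b k \<omega>) t i) \<in> borel_measurable N"
proof -
  have "(\<lambda>x. bcg A m (\<lambda>k. b k (fst x)) t i ((snd x)\<^sup>2)) \<in> borel_measurable (N \<Otimes>\<^sub>M lborel)"
    using b by (intro measurable_bcg[OF A _ i, of "\<lambda>k x. b k (fst x)"]) (auto intro: measurable_compose[OF measurable_fst])
  then have "(\<lambda>x. indicator {0<..} (snd x) *\<^sub>R (A *v bcg A m (\<lambda>k. b k (fst x)) t i ((snd x)\<^sup>2))) \<in> borel_measurable (N \<Otimes>\<^sub>M lborel)"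
    by (intro borel_measurable_scaleR measurable_matrix_vector_mult) auto
  then have "(\<lambda>\<omega>. LINT z|lborel. indicator {0<..} z *\<^sub>R (A *v bcg A m (\<lambda>k. b k \<omega>) t i (z\<^sup>2))) \<in> borel_measurable N"
    by (intro lborel.borel_measurable_lebesgue_integral) (simp add: case_prod_beta')
  then show ?thesis
    unfolding bsq_def interval_lebesgue_integral_0_infty set_lebesgue_integral_def
    by (rule borel_measurable_scaleR[OF borel_measurable_const])
qed

section \<open>Lebesgue measure under isometries\<close>

lemma nn_integral_lborel_shift:
  fixes c :: "'a::euclidean_space"
  assumes "f \<in> borel_measurable borel"
  shows "(\<integral>\<^sup>+y. f (c + y) \<partial>lborel) = (\<integral>\<^sup>+y. f y \<partial>lborel)"
proof -
  have "(\<integral>\<^sup>+y. f y \<partial>lborel) = (\<integral>\<^sup>+y. f y \<partial>distr lborel borel ((+) c))"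
    by (simp add: lborel_distr_plus)
  also have "\<dots> = (\<integral>\<^sup>+y. f (c + y) \<partial>lborel)"
    using assms by (subst nn_integral_distr) auto
  finally show ?thesis ..
qed

text \<open>
  Multiply the integral by the volume \<open>c0\<close> of the unit ball. Translations and Fubini turn
  \<open>\<integral>\<integral> 1\<^sub>B(x) f(T y) dy dx\<close> into \<open>\<integral> f(x) \<integral> 1\<^sub>B(x - T y) dy dx\<close>, and as \<open>T\<close> is an isometry the inner integral is
  the volume of a unit ball again.
\<close>

lemma nn_integral_lborel_isometry:
  fixes T S :: "'a::euclidean_space \<Rightarrow> 'a"
  assumes T: "linear T" and nT: "\<And>x. norm (T x) = norm x" and TS: "\<And>x. T (S x) = x"
    and f: "f \<in> borel_measurable borel"
  shows "(\<integral>\<^sup>+y. f (T y) \<partial>lborel) = (\<integral>\<^sup>+y. f y \<partial>lborel)"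
proof -
  interpret T: linear T by (rule T)
  have Tc: "continuous_on UNIV T" by (rule linear_continuous_on) (rule linear_conv_bounded_linear[THEN iffD1, OF T])
  have Tm: "T \<in> borel_measurable borel" by (rule borel_measurable_continuous_onI[OF Tc])
  let ?B = "indicator (ball 0 1) :: 'a \<Rightarrow> ennreal"
  have Bm: "?B \<in> borel_measurable borel" by (rule borel_measurable_indicator) simp
  define c0 where "c0 = emeasure lborel (ball (0::'a) 1)"
  have c0: "emeasure lborel (ball (x::'a) 1) = c0" for x
    by (simp add: c0_def emeasure_ball)
  have c0n: "c0 \<noteq> 0" "c0 \<noteq> \<infinity>"
  proof -
    have "unit_ball_vol (real DIM('a)) \<noteq> 0"
      by (rule less_imp_neq[symmetric], rule unit_ball_vol_pos) simp
    then show "c0 \<noteq> 0" "c0 \<noteq> \<infinity>" by (simp_all add: c0_def emeasure_ball)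
  qed
  have m1: "(\<lambda>y. f (x + T y)) \<in> borel_measurable borel" for x
    by (rule measurable_compose[OF _ f]) (use Tm in simp)
  have Tsnd: "(\<lambda>p. T (snd p)) \<in> borel_measurable (lborel \<Otimes>\<^sub>M lborel)"
    by (rule measurable_compose[OF measurable_snd]) (use Tm in simp)
  have fm2: "(\<lambda>p. f (fst p + T (snd p))) \<in> borel_measurable (lborel \<Otimes>\<^sub>M lborel)"
    by (rule measurable_compose[OF _ f]) (auto intro!: borel_measurable_add Tsnd)
  have Bm2: "(\<lambda>p. ?B (fst p - T (snd p))) \<in> borel_measurable (lborel \<Otimes>\<^sub>M lborel)"
    by (rule measurable_compose[OF _ Bm]) (auto intro!: borel_measurable_diff Tsnd)
  have "c0 * (\<integral>\<^sup>+y. f (T y) \<partial>lborel) = (\<integral>\<^sup>+x. ?B x * (\<integral>\<^sup>+y. f (T y) \<partial>lborel) \<partial>lborel)"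
    by (subst nn_integral_multc) (use Bm in \<open>auto simp: c0_def\<close>)
  also have "\<dots> = (\<integral>\<^sup>+x. (\<integral>\<^sup>+y. ?B x * f (x + T y) \<partial>lborel) \<partial>lborel)"
  proof (intro nn_integral_cong)
    fix x :: 'a
    have "(\<integral>\<^sup>+y. f (T y) \<partial>lborel) = (\<integral>\<^sup>+y. f (T (S x + y)) \<partial>lborel)"
      using nn_integral_lborel_shift[OF measurable_compose[OF Tm f], of "S x"] by simp
    also have "\<dots> = (\<integral>\<^sup>+y. f (x + T y) \<partial>lborel)" by (simp add: T.add TS)
    finally show "?B x * (\<integral>\<^sup>+y. f (T y) \<partial>lborel) = (\<integral>\<^sup>+y. ?B x * f (x + T y) \<partial>lborel)"
      using m1 by (simp add: nn_integral_cmult)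
  qed
  also have "\<dots> = (\<integral>\<^sup>+y. (\<integral>\<^sup>+x. ?B x * f (x + T y) \<partial>lborel) \<partial>lborel)"
  proof (rule lborel_pair.Fubini'[symmetric])
    show "(\<lambda>(x, y). ?B x * f (x + T y)) \<in> borel_measurable (lborel \<Otimes>\<^sub>M lborel)"
      unfolding case_prod_beta'
      by (rule borel_measurable_times_ennreal[OF measurable_compose[OF measurable_fst] fm2]) (use Bm in simp)
  qed
  also have "\<dots> = (\<integral>\<^sup>+y. (\<integral>\<^sup>+x. ?B (x - T y) * f x \<partial>lborel) \<partial>lborel)"
  proof (rule nn_integral_cong)
    fix y :: 'a
    have "(\<lambda>x. ?B x * f (x + T y)) \<in> borel_measurable borel"
      by (intro borel_measurable_times_ennreal Bm measurable_compose[OF _ f]) simp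
    from nn_integral_lborel_shift[OF this, of "- T y"]
    show "(\<integral>\<^sup>+x. ?B x * f (x + T y) \<partial>lborel) = (\<integral>\<^sup>+x. ?B (x - T y) * f x \<partial>lborel)" by simp
  qed
  also have "\<dots> = (\<integral>\<^sup>+x. (\<integral>\<^sup>+y. ?B (x - T y) * f x \<partial>lborel) \<partial>lborel)"
  proof (rule lborel_pair.Fubini')
    show "(\<lambda>(x, y). ?B (x - T y) * f x) \<in> borel_measurable (lborel \<Otimes>\<^sub>M lborel)"
      unfolding case_prod_beta'
      by (rule borel_measurable_times_ennreal[OF Bm2 measurable_compose[OF measurable_fst]]) (use f in simp)
  qed
  also have "\<dots> = (\<integral>\<^sup>+x. c0 * f x \<partial>lborel)"
  proof (intro nn_integral_cong)
    fix x :: 'a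
    have "?B (x - T y) = indicator (ball (S x) 1) y" for y
    proof -
      have "x - T y = T (S x - y)" by (simp add: T.diff TS)
      then have "norm (x - T y) = norm (S x - y)" by (simp add: nT)
      then show ?thesis by (simp add: indicator_def dist_norm norm_minus_commute)
    qed
    then show "(\<integral>\<^sup>+y. ?B (x - T y) * f x \<partial>lborel) = c0 * f x"
    proof -
      have "indicator (ball (S x) 1) \<in> (borel_measurable lborel :: ('a \<Rightarrow> ennreal) set)"
        by (rule borel_measurable_indicator) simp
      then have "(\<integral>\<^sup>+y. indicator (ball (S x) 1) y * f x \<partial>lborel) = (\<integral>\<^sup>+y. indicator (ball (S x) 1) y \<partial>lborel) * f x"
        by (rule nn_integral_multc)
      then show ?thesis using \<open>\<And>y. ?B (x - T y) = indicator (ball (S x) 1) y\<close> by (simp add: c0)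
    qed
  qed
  also have "\<dots> = c0 * (\<integral>\<^sup>+x. f x \<partial>lborel)" using f by (simp add: nn_integral_cmult)
  finally show ?thesis using c0n by (simp add: ennreal_mult_cancel_left)
qed

section \<open>The standard Gaussian measure\<close>

definition std_normal :: "real measure" where
  "std_normal = density lborel (\<lambda>t. ennreal (std_normal_density t))"

definition gauss :: "(real^'n) measure" where
  "gauss = density lborel (\<lambda>x. \<Prod>i\<in>UNIV. ennreal (std_normal_density (x $ i)))"

lemma prob_space_std_normal: "prob_space std_normal"
  unfolding std_normal_def by (rule prob_space_normal_density) simp

lemma sets_std_normal [simp, measurable_cong]: "sets std_normal = sets borel"
  and space_std_normal [simp]: "space std_normal = UNIV"
  and sets_gauss [simp, measurable_cong]: "sets gauss = sets borel"
  and space_gauss [simp]: "space gauss = UNIV"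
  by (simp_all add: std_normal_def gauss_def)

lemma gauss_density_measurable:
  "(\<lambda>x::real^'n. \<Prod>i\<in>UNIV. ennreal (std_normal_density (x $ i))) \<in> borel_measurable borel"
proof -
  have "(\<lambda>x::real^'n. x $ i) \<in> borel_measurable borel" for i
    by (rule measurable_vec_nth) simp
  then show ?thesis by (intro borel_measurable_prod_ennreal) auto
qed

lemma Basis_vec_real: "Basis = range (\<lambda>i::'n::finite. axis i (1::real))"
  by (auto simp: Basis_vec_def)

lemma nn_integral_gauss_prod:
  fixes f :: "'n::finite \<Rightarrow> real \<Rightarrow> ennreal"
  assumes f: "\<And>i. f i \<in> borel_measurable borel"
  shows "(\<integral>\<^sup>+x. (\<Prod>i\<in>UNIV. f i (x $ i)) \<partial>gauss) = (\<Prod>i\<in>UNIV. \<integral>\<^sup>+t. f i t \<partial>std_normal)"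
proof -
  have inj: "inj (\<lambda>i::'n. axis i (1::real))" by (auto simp: inj_on_def axis_eq_axis)
  define h where "h = (\<lambda>(b::real^'n) t. ennreal (std_normal_density t) * f (inv (\<lambda>i. axis i (1::real)) b) t)"
  have hm: "h b \<in> borel_measurable borel" for b
    unfolding h_def using f by (intro borel_measurable_times_ennreal) auto
  have h: "h (axis i 1) = (\<lambda>t. ennreal (std_normal_density t) * f i t)" for i
    by (simp add: h_def inv_f_f[OF inj])
  have cm: "(\<lambda>x::real^'n. x $ i) \<in> borel_measurable borel" for i
    by (rule measurable_vec_nth) simp
  have fm: "(\<lambda>x::real^'n. \<Prod>i\<in>UNIV. f i (x $ i)) \<in> borel_measurable lborel"
    using measurable_compose[OF cm f] by (intro borel_measurable_prod_ennreal) simp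
  have "(\<integral>\<^sup>+x. (\<Prod>i\<in>UNIV. f i (x $ i)) \<partial>gauss)
      = (\<integral>\<^sup>+(x::real^'n). (\<Prod>i\<in>UNIV. ennreal (std_normal_density (x $ i))) * (\<Prod>i\<in>UNIV. f i (x $ i)) \<partial>lborel)"
    unfolding gauss_def using gauss_density_measurable fm by (intro nn_integral_density) auto
  also have "\<dots> = (\<integral>\<^sup>+(x::real^'n). (\<Prod>b\<in>Basis. h b (x \<bullet> b)) \<partial>lborel)"
    unfolding Basis_vec_real
    by (subst prod.reindex[OF inj]) (simp add: h inner_axis prod.distrib)
  also have "\<dots> = (\<Prod>b\<in>Basis. \<integral>\<^sup>+t. h b t \<partial>lborel)"
    by (rule nn_integral_lborel_prod) (auto simp: hm)
  also have "\<dots> = (\<Prod>i\<in>UNIV. \<integral>\<^sup>+t. f i t \<partial>std_normal)"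
    unfolding Basis_vec_real std_normal_def using f
    by (subst prod.reindex[OF inj]) (simp add: h nn_integral_density)
  finally show ?thesis .
qed

lemma prob_space_gauss: "prob_space (gauss :: (real^'n) measure)"
proof
  interpret N: prob_space std_normal by (rule prob_space_std_normal)
  have "emeasure (gauss :: (real^'n) measure) UNIV = (\<integral>\<^sup>+x. (\<Prod>i\<in>(UNIV::'n set). 1) \<partial>(gauss :: (real^'n) measure))"
    by simp
  also have "\<dots> = 1"
    using nn_integral_gauss_prod[of "\<lambda>(i::'n) t. 1"] N.emeasure_space_1 by simp
  finally show "emeasure (gauss :: (real^'n) measure) (space gauss) = 1" by simp
qed

lemma emeasure_gauss_prod:
  fixes B :: "'n::finite \<Rightarrow> real set"
  assumes B: "\<And>i. B i \<in> sets borel"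
  shows "emeasure gauss {x. \<forall>i. x $ i \<in> B i} = (\<Prod>i\<in>UNIV. emeasure std_normal (B i))"
proof -
  have eq: "{x::real^'n. \<forall>i. x $ i \<in> B i} = (\<Inter>i. (\<lambda>x. x $ i) -` B i \<inter> space borel)" by auto
  have cm: "(\<lambda>x::real^'n. x $ i) \<in> borel_measurable borel" for i
    by (rule measurable_vec_nth) simp
  have "{x::real^'n. \<forall>i. x $ i \<in> B i} \<in> sets borel"
    unfolding eq using measurable_sets[OF cm B] by (intro sets.countable_INT') auto
  then have "emeasure gauss {x::real^'n. \<forall>i. x $ i \<in> B i} = (\<integral>\<^sup>+x. indicator {x. \<forall>i. x $ i \<in> B i} x \<partial>gauss)"
    by simp
  also have "\<dots> = (\<integral>\<^sup>+x. (\<Prod>i\<in>UNIV. indicator (B i) (x $ i)) \<partial>gauss)"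
  proof (intro nn_integral_cong)
    fix x :: "real^'n"
    show "(indicator {x. \<forall>i. x $ i \<in> B i} x :: ennreal) = (\<Prod>i\<in>UNIV. indicator (B i) (x $ i))"
    proof (cases "\<forall>i. x $ i \<in> B i")
      case False
      then obtain i where "x $ i \<notin> B i" by blast
      then have "(\<Prod>i\<in>UNIV. indicator (B i) (x $ i) :: ennreal) = 0" by (intro prod_zero bexI[of _ i]) auto
      with False show ?thesis by simp
    qed simp
  qed
  also have "\<dots> = (\<Prod>i\<in>UNIV. emeasure std_normal (B i))"
    using B by (subst nn_integral_gauss_prod) auto
  finally show ?thesis .
qed

lemma gauss_density_norm:
  fixes x :: "real^'n"
  shows "(\<Prod>i\<in>UNIV. ennreal (std_normal_density (x $ i))) = ennreal ((1 / sqrt (2 * pi)) ^ CARD('n) * exp (- (x \<bullet> x) / 2))"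
proof -
  have "(\<Prod>i\<in>UNIV. std_normal_density (x $ i)) = (1 / sqrt (2 * pi)) ^ CARD('n) * exp (\<Sum>i\<in>UNIV. - (x $ i)\<^sup>2 / 2)"
    by (simp only: std_normal_density_def prod.distrib prod_constant exp_sum[OF finite_class.finite_UNIV])
  also have "(\<Sum>i\<in>UNIV. - (x $ i)\<^sup>2 / 2) = - (x \<bullet> x) / 2"
    by (simp add: inner_vec_def power2_eq_square sum_divide_distrib sum_negf)
  finally show ?thesis by (simp add: prod_ennreal)
qed

lemma coordinate_isometry:
  fixes V :: "'n \<Rightarrow> real^'n"
  assumes V: "orthonormal_family V"
  defines "T \<equiv> (\<lambda>x. \<chi> i. V i \<bullet> x)" and "S \<equiv> (\<lambda>x. \<Sum>i\<in>UNIV. (x $ i) *\<^sub>R V i)"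
  shows "linear T" "norm (T x) = norm x" "T (S x) = x" "T \<in> borel_measurable borel"
proof -
  show lin: "linear T" unfolding T_def by (intro linearI) (auto simp: vec_eq_iff inner_add_right)
  have "T x \<bullet> T x = (\<Sum>i\<in>UNIV. T x $ i \<bullet> T x $ i)" by (rule inner_vec_def)
  also have "\<dots> = (\<Sum>i\<in>UNIV. (x \<bullet> V i) * (x \<bullet> V i))" by (simp add: T_def inner_commute)
  also have "\<dots> = x \<bullet> x" by (rule orthonormal_family_inner[OF V, symmetric])
  finally show "norm (T x) = norm x" by (simp add: norm_eq_sqrt_inner)
  have "V i \<bullet> V j = of_bool (i = j)" for i j using V by (auto simp: orthonormal_family_def)
  then show "T (S x) = x" by (simp add: T_def S_def vec_eq_iff inner_sum_right)
  have "continuous_on UNIV T" by (rule linear_continuous_on) (rule linear_conv_bounded_linear[THEN iffD1, OF lin])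
  then show "T \<in> borel_measurable borel" by (rule borel_measurable_continuous_onI)
qed

text \<open>
  The density depends on the norm only, and Lebesgue measure is invariant under isometries.
\<close>

lemma nn_integral_gauss_rotate:
  fixes V :: "'n \<Rightarrow> real^'n"
  assumes V: "orthonormal_family V" and f: "f \<in> borel_measurable borel"
  shows "(\<integral>\<^sup>+x. f (\<chi> i. V i \<bullet> x) \<partial>gauss) = (\<integral>\<^sup>+x. f x \<partial>gauss)"
proof -
  let ?T = "\<lambda>x. \<chi> i. V i \<bullet> x"
  let ?\<phi> = "\<lambda>x::real^'n. \<Prod>i\<in>UNIV. ennreal (std_normal_density (x $ i))"
  note T = coordinate_isometry[OF V]
  have \<phi>: "?\<phi> (?T x) = ?\<phi> x" for x
  proof -
    have "?T x \<bullet> ?T x = x \<bullet> x" using T(2)[of x] by (simp add: norm_eq_sqrt_inner)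
    then show ?thesis by (simp only: gauss_density_norm)
  qed
  have "(\<integral>\<^sup>+x. f (?T x) \<partial>gauss) = (\<integral>\<^sup>+x. ?\<phi> x * f (?T x) \<partial>lborel)"
    unfolding gauss_def using measurable_compose[OF T(4) f] gauss_density_measurable
    by (intro nn_integral_density) auto
  also have "\<dots> = (\<integral>\<^sup>+x. (\<lambda>x. ?\<phi> x * f x) (?T x) \<partial>lborel)" by (simp only: \<phi>)
  also have "\<dots> = (\<integral>\<^sup>+x. ?\<phi> x * f x \<partial>lborel)"
    by (rule nn_integral_lborel_isometry[OF T(1-3)]) (intro borel_measurable_times_ennreal f gauss_density_measurable)
  also have "\<dots> = (\<integral>\<^sup>+x. f x \<partial>gauss)"
    unfolding gauss_def using f gauss_density_measurable by (intro nn_integral_density[symmetric]) auto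
  finally show ?thesis .
qed

lemma distr_gauss_rotate:
  fixes V :: "'n \<Rightarrow> real^'n"
  assumes V: "orthonormal_family V"
  shows "distr gauss borel (\<lambda>x. \<chi> i. V i \<bullet> x) = gauss"
proof (rule measure_eqI)
  fix B assume "B \<in> sets (distr gauss borel (\<lambda>x. \<chi> i. V i \<bullet> x))"
  then have B: "B \<in> sets borel" by simp
  have T: "(\<lambda>x. \<chi> i. V i \<bullet> x) \<in> measurable gauss borel"
    using coordinate_isometry(4)[OF V] by simp
  have "emeasure (distr gauss borel (\<lambda>x. \<chi> i. V i \<bullet> x)) B = (\<integral>\<^sup>+x. indicator B x \<partial>distr gauss borel (\<lambda>x. \<chi> i. V i \<bullet> x))"
    using B by simp
  also have "\<dots> = (\<integral>\<^sup>+x. indicator B (\<chi> i. V i \<bullet> x) \<partial>gauss)"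
    using B by (intro nn_integral_distr T) simp
  also have "\<dots> = (\<integral>\<^sup>+x. indicator B x \<partial>gauss)"
    using B by (intro nn_integral_gauss_rotate[OF V]) simp
  finally show "emeasure (distr gauss borel (\<lambda>x. \<chi> i. V i \<bullet> x)) B = emeasure gauss B" using B by simp
qed simp

lemma orthonormal_extension:
  fixes B :: "(real^'n) set"
  assumes B: "pairwise orthogonal B" "\<And>x. x \<in> B \<Longrightarrow> norm x = 1"
  obtains V :: "'n \<Rightarrow> real^'n" where "orthonormal_family V" "B \<subseteq> range V"
proof -
  have "0 \<notin> B" using B(2)[of 0] by auto
  then have indB: "independent B" by (rule pairwise_orthogonal_independent[OF B(1)])
  then have finB: "finite B" by (rule independent_imp_finite)
  define W where "W = {y \<in> UNIV. \<forall>x\<in>span B. orthogonal x y}"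
  have dimW: "dim W + card B = CARD('n)"
    using dim_subspace_orthogonal_to_vectors[of "span B" UNIV] indB
    by (simp add: W_def dim_eq_card_independent)
  have subW: "subspace W"
    by (auto simp: subspace_def W_def orthogonal_def inner_add_right)
  obtain C where C: "C \<subseteq> W" "pairwise orthogonal C" "\<And>x. x \<in> C \<Longrightarrow> norm x = 1"
      "independent C" "card C = dim W" "span C = W"
    using orthonormal_basis_subspace[OF subW] by metis
  have BC: "orthogonal x y" if "x \<in> B" "y \<in> C" for x y
    using that C(1) span_base[of x B] by (auto simp: W_def)
  have disj: "B \<inter> C = {}"
  proof (rule ccontr)
    assume "B \<inter> C \<noteq> {}"
    then obtain x where "x \<in> B" "x \<in> C" by blast
    then have "x \<bullet> x = 0" "norm x = 1" using BC B(2) by (auto simp: orthogonal_def)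
    then show False by simp
  qed
  have finC: "finite C" using C(4) by (rule independent_imp_finite)
  have po: "pairwise orthogonal (B \<union> C)"
    using B(1) C(2) BC orthogonal_commute unfolding pairwise_def by blast
  have "card (B \<union> C) = CARD('n)" using disj finB finC C(5) dimW by (simp add: card_Un_disjoint)
  obtain V :: "'n \<Rightarrow> real^'n" where "orthonormal_family V" "range V = B \<union> C"
    by (rule orthonormal_family_of_set[OF po _ _ \<open>card (B \<union> C) = CARD('n)\<close>])
      (use B(2) C(3) finB finC that in auto)
  with that show ?thesis by blast
qed

section \<open>Gaussian moments and the inverse chi-square expectation\<close>

lemma std_normal_second_moment: "(\<integral>\<^sup>+t. ennreal (t\<^sup>2) \<partial>std_normal) = 1"
proof -
  have "has_bochner_integral lborel (\<lambda>x. std_normal_density x * x\<^sup>2) 1"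
    using std_normal_moment_even[of 1] by (simp add: fact_numeral)
  then have i: "integrable lborel (\<lambda>x. std_normal_density x * x\<^sup>2)" "(\<integral>x. std_normal_density x * x\<^sup>2 \<partial>lborel) = 1"
    by (auto simp: has_bochner_integral_iff)
  have "(\<integral>\<^sup>+t. ennreal (t\<^sup>2) \<partial>std_normal) = (\<integral>\<^sup>+t. ennreal (std_normal_density t * t\<^sup>2) \<partial>lborel)"
    unfolding std_normal_def by (subst nn_integral_density) (auto simp: ennreal_mult)
  also have "\<dots> = 1" using i by (subst nn_integral_eq_integral) auto
  finally show ?thesis .
qed

lemma nn_integral_gauss_coordinate:
  fixes i :: "'n::finite"
  assumes f: "f \<in> borel_measurable borel"
  shows "(\<integral>\<^sup>+x. f (x $ i) \<partial>gauss) = (\<integral>\<^sup>+t. f t \<partial>std_normal)"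
proof -
  interpret N: prob_space std_normal by (rule prob_space_std_normal)
  have "(\<integral>\<^sup>+x. f (x $ i) \<partial>gauss) = (\<integral>\<^sup>+x. (\<Prod>j\<in>UNIV. (if j = i then f else (\<lambda>_. 1)) (x $ j)) \<partial>gauss)"
    by (intro nn_integral_cong) (simp add: if_distribR prod.delta)
  also have "\<dots> = (\<Prod>j\<in>UNIV. \<integral>\<^sup>+t. (if j = i then f else (\<lambda>_. 1)) t \<partial>std_normal)"
    using f by (intro nn_integral_gauss_prod) auto
  also have "\<dots> = (\<Prod>j\<in>UNIV. if j = i then (\<integral>\<^sup>+t. f t \<partial>std_normal) else 1)"
    using N.emeasure_space_1 by (intro prod.cong) auto
  also have "\<dots> = (\<integral>\<^sup>+t. f t \<partial>std_normal)" by (simp add: prod.delta)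
  finally show ?thesis .
qed

text \<open>
  By rotation invariance \<open>w\<close> may be taken as a multiple of a coordinate vector.
\<close>

lemma nn_integral_gauss_inner_sq:
  fixes w :: "real^'n"
  shows "(\<integral>\<^sup>+x. ennreal ((x \<bullet> w)\<^sup>2) \<partial>gauss) = ennreal (w \<bullet> w)"
proof (cases "w = 0")
  case False
  define u where "u = w /\<^sub>R norm w"
  have u: "norm u = 1" "w = norm w *\<^sub>R u" using False by (simp_all add: u_def)
  obtain V :: "'n \<Rightarrow> real^'n" where V: "orthonormal_family V" "{u} \<subseteq> range V"
    by (rule orthonormal_extension[of "{u}"]) (use u in auto)
  then obtain i where i: "u = V i" by auto
  have m: "(\<lambda>x::real^'n. ennreal ((norm w * x $ i)\<^sup>2)) \<in> borel_measurable borel"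
    using measurable_vec_nth[of "\<lambda>x::real^'n. x" borel i] by simp
  have wV: "x \<bullet> w = norm w * (V i \<bullet> x)" for x
    by (subst u(2)) (simp add: i inner_commute)
  have "(\<integral>\<^sup>+x. ennreal ((x \<bullet> w)\<^sup>2) \<partial>gauss) = (\<integral>\<^sup>+x. (\<lambda>x. ennreal ((norm w * x $ i)\<^sup>2)) (\<chi> i. V i \<bullet> x) \<partial>gauss)"
    by (simp add: wV)
  also have "\<dots> = (\<integral>\<^sup>+x. ennreal ((norm w * x $ i)\<^sup>2) \<partial>gauss)"
    by (rule nn_integral_gauss_rotate[OF V(1) m])
  also have "\<dots> = (\<integral>\<^sup>+t. ennreal ((norm w * t)\<^sup>2) \<partial>std_normal)"
    by (rule nn_integral_gauss_coordinate) simp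
  also have "\<dots> = (\<integral>\<^sup>+t. ennreal ((norm w)\<^sup>2) * ennreal (t\<^sup>2) \<partial>std_normal)"
    by (simp add: power_mult_distrib ennreal_mult)
  also have "\<dots> = ennreal (w \<bullet> w)"
    by (subst nn_integral_cmult) (auto simp: std_normal_second_moment power2_norm_eq_inner)
  finally show ?thesis .
qed simp

lemma nn_integral_std_normal_exp:
  fixes s :: real
  assumes s: "0 \<le> s"
  shows "(\<integral>\<^sup>+t. ennreal (exp (- s * t\<^sup>2)) \<partial>std_normal) = ennreal (1 / sqrt (1 + 2 * s))"
proof -
  define \<sigma> where "\<sigma> = 1 / sqrt (1 + 2 * s)"
  have \<sigma>: "0 < \<sigma>" "\<sigma>\<^sup>2 = 1 / (1 + 2 * s)" using s by (simp_all add: \<sigma>_def power_divide)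
  have eq: "std_normal_density t * exp (- s * t\<^sup>2) = \<sigma> * normal_density 0 \<sigma> t" for t
  proof -
    have "\<sigma> * (1 / sqrt (2 * pi * \<sigma>\<^sup>2)) = 1 / sqrt (2 * pi)" using \<sigma>(1) by (simp add: real_sqrt_mult)
    moreover have "- (t - 0)\<^sup>2 / (2 * \<sigma>\<^sup>2) = - t\<^sup>2 / 2 + - s * t\<^sup>2" using s by (simp add: \<sigma>(2) field_simps)
    ultimately show ?thesis
      unfolding std_normal_density_def normal_density_def[of 0 \<sigma>] by (simp only: mult.assoc[symmetric] exp_add)
  qed
  have "(\<integral>\<^sup>+t. ennreal (exp (- s * t\<^sup>2)) \<partial>std_normal) = (\<integral>\<^sup>+t. ennreal (\<sigma> * normal_density 0 \<sigma> t) \<partial>lborel)"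
    unfolding std_normal_def by (subst nn_integral_density) (auto simp: ennreal_mult'[symmetric] eq[unfolded mult_minus_left])
  also have "\<dots> = ennreal (\<integral>t. \<sigma> * normal_density 0 \<sigma> t \<partial>lborel)"
    using \<sigma>(1) by (intro nn_integral_eq_integral) auto
  also have "\<dots> = ennreal \<sigma>" using \<sigma>(1) by simp
  finally show ?thesis by (simp add: \<sigma>_def)
qed

text \<open>
  Writing the inverse as a Laplace integral makes it a mixture of exponentials, whose Gaussian
  expectations factor over the coordinates. At \<open>r = 0\<close> both sides are infinite.
\<close>

lemma inverse_le_laplace_integral:
  fixes r :: real
  assumes r: "0 \<le> r"
  shows "inverse (ennreal r) \<le> (\<integral>\<^sup>+s. indicator {0<..} s * ennreal (exp (- s * r)) \<partial>lborel)"
proof (cases "r = 0")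
  case True
  have "(\<integral>\<^sup>+s. indicator {0<..} s * ennreal (exp (- s * r)) \<partial>lborel) = emeasure lborel {0::real<..}"
    using True by simp
  also have "\<dots> = \<infinity>"
  proof (rule ccontr)
    assume "emeasure lborel {0::real<..} \<noteq> \<infinity>"
    then obtain c where c: "emeasure lborel {0::real<..} = ennreal c" "0 \<le> c"
      by (metis ennreal_cases infinity_ennreal_def)
    have "emeasure lborel {0<..c + 1} \<le> emeasure lborel {0::real<..}" by (intro emeasure_mono) auto
    then show False using c by (simp add: ennreal_le_iff)
  qed
  finally show ?thesis by simp
next
  case False
  then have r: "0 < r" using r by simp
  have D: "((\<lambda>s. - exp (- s * r) / r) has_real_derivative exp (- s * r)) (at s)" for s
    using r by (auto intro!: derivative_eq_intros simp: field_simps)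
  have lim: "((\<lambda>s. - exp (- s * r) / r) \<longlongrightarrow> 0) at_top"
  proof -
    have "filterlim (\<lambda>s. s * r) at_top at_top"
      using r by (intro filterlim_at_top_mult_tendsto_pos[OF tendsto_const _ filterlim_ident, THEN filterlim_cong[THEN iffD1, rotated -1]]) (auto simp: mult.commute)
    then have "filterlim (\<lambda>s. - (s * r)) at_bot at_top" by (simp add: filterlim_uminus_at_top)
    then have "((\<lambda>s. exp (- (s * r))) \<longlongrightarrow> 0) at_top" by (rule filterlim_compose[OF exp_at_bot])
    then have "((\<lambda>s. - exp (- (s * r)) / r) \<longlongrightarrow> - 0 / r) at_top" by (intro tendsto_intros) (use r in auto)
    then show ?thesis by simp
  qed
  have "set_integrable lborel {0<..} (\<lambda>s. exp (- s * r))" "(LINT s:{0<..}|lborel. exp (- s * r)) = 1 / r"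
    using set_integral_FTC_ray[of 0 "\<lambda>s. - exp (- s * r) / r" "\<lambda>s. exp (- s * r)" 0, OF D _ _ DERIV_isCont[OF D] lim]
    by auto
  then have "(\<integral>\<^sup>+s. ennreal (indicator {0<..} s *\<^sub>R exp (- s * r)) \<partial>lborel) = ennreal (1 / r)"
    unfolding set_integrable_def set_lebesgue_integral_def by (subst nn_integral_eq_integral) auto
  moreover have "ennreal (indicator {0<..} s *\<^sub>R exp (- s * r)) = indicator {0<..} s * ennreal (exp (- s * r))" for s
    by (simp add: indicator_def)
  ultimately show ?thesis using r by (simp add: inverse_ennreal inverse_eq_divide)
qed

text \<open>
  After Fubini the expectation is \<open>\<integral> (1 + 2 s)\<^sup>-\<^sup>3\<^sup>/\<^sup>2 ds = 1\<close> over \<open>s > 0\<close>. Three is the least number of degrees of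
  freedom for which the integral converges, which is why groups have \<open>r + 2\<close> vectors.
\<close>

lemma nn_integral_gauss_inverse_chi3:
  fixes K :: "'n::finite set"
  assumes K: "card K = 3"
  shows "(\<integral>\<^sup>+x. inverse (ennreal (\<Sum>k\<in>K. (x $ k)\<^sup>2)) \<partial>gauss) \<le> 1"
proof -
  interpret G: prob_space "gauss :: (real^'n) measure" by (rule prob_space_gauss)
  interpret N: prob_space std_normal by (rule prob_space_std_normal)
  interpret P: pair_sigma_finite "lborel :: real measure" "gauss :: (real^'n) measure"
    by (intro pair_sigma_finite.intro lborel.sigma_finite_measure_axioms G.sigma_finite_measure_axioms)
  have cm: "(\<lambda>x::real^'n. x $ i) \<in> borel_measurable borel" for i
    by (rule measurable_vec_nth) simp
  have qm: "(\<lambda>x::real^'n. \<Sum>k\<in>K. (x $ k)\<^sup>2) \<in> borel_measurable borel"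
    using cm by (intro borel_measurable_sum borel_measurable_power)
  have "(\<integral>\<^sup>+(x::real^'n). inverse (ennreal (\<Sum>k\<in>K. (x $ k)\<^sup>2)) \<partial>gauss)
      \<le> (\<integral>\<^sup>+(x::real^'n). (\<integral>\<^sup>+s. indicator {0<..} s * ennreal (exp (- s * (\<Sum>k\<in>K. (x $ k)\<^sup>2))) \<partial>lborel) \<partial>gauss)"
    by (intro nn_integral_mono inverse_le_laplace_integral sum_nonneg) auto
  also have "\<dots> = (\<integral>\<^sup>+s. (\<integral>\<^sup>+(x::real^'n). indicator {0<..} s * ennreal (exp (- s * (\<Sum>k\<in>K. (x $ k)\<^sup>2))) \<partial>gauss) \<partial>lborel)"
  proof (rule P.Fubini')
    let ?P = "(lborel :: real measure) \<Otimes>\<^sub>M (gauss :: (real^'n) measure)"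
    have q: "(\<lambda>p. \<Sum>k\<in>K. (snd p $ k)\<^sup>2) \<in> borel_measurable ?P"
      by (rule measurable_compose[OF measurable_snd]) (use qm in simp)
    have t: "(\<lambda>p. - fst p) \<in> borel_measurable ?P"
      by (rule measurable_compose[OF measurable_fst]) simp
    have e: "(\<lambda>p. ennreal (exp (- fst p * (\<Sum>k\<in>K. (snd p $ k)\<^sup>2)))) \<in> borel_measurable ?P"
      by (rule measurable_compose[OF borel_measurable_times[OF t q]]) simp
    have i: "(\<lambda>p. indicator {0<..} (fst p) :: ennreal) \<in> borel_measurable ?P"
      by (rule measurable_compose[OF measurable_fst], rule borel_measurable_indicator) simp
    show "(\<lambda>(s, x). indicator {0<..} s * ennreal (exp (- s * (\<Sum>k\<in>K. (x $ k)\<^sup>2)))) \<in> borel_measurable ?P"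
      unfolding case_prod_beta' by (rule borel_measurable_times_ennreal[OF i e])
  qed
  also have "\<dots> = (\<integral>\<^sup>+s. ennreal (indicator {0<..} s *\<^sub>R (1 / (sqrt (1 + 2 * s)) ^ 3)) \<partial>lborel)"
  proof (intro nn_integral_cong)
    fix s :: real
    show "(\<integral>\<^sup>+(x::real^'n). indicator {0<..} s * ennreal (exp (- s * (\<Sum>k\<in>K. (x $ k)\<^sup>2))) \<partial>gauss)
        = ennreal (indicator {0<..} s *\<^sub>R (1 / (sqrt (1 + 2 * s)) ^ 3))"
    proof (cases "0 < s")
      case True
      define f where "f = (\<lambda>(k::'n) t. if k \<in> K then ennreal (exp (- s * t\<^sup>2)) else 1)"
      have fm: "f k \<in> borel_measurable borel" for k unfolding f_def by (cases "k \<in> K") auto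
      have "ennreal (exp (- s * (\<Sum>k\<in>K. (x $ k)\<^sup>2))) = (\<Prod>k\<in>UNIV. f k (x $ k))" for x
      proof -
        have "exp (- s * (\<Sum>k\<in>K. (x $ k)\<^sup>2)) = (\<Prod>k\<in>K. exp (- s * (x $ k)\<^sup>2))"
          unfolding sum_distrib_left by (rule exp_sum) simp
        then have "ennreal (exp (- s * (\<Sum>k\<in>K. (x $ k)\<^sup>2))) = (\<Prod>k\<in>K. ennreal (exp (- s * (x $ k)\<^sup>2)))"
          by (simp add: prod_ennreal)
        also have "\<dots> = (\<Prod>k\<in>UNIV. f k (x $ k))"
          unfolding f_def by (intro prod.mono_neutral_cong_left) auto
        finally show ?thesis .
      qed
      then have "(\<integral>\<^sup>+(x::real^'n). ennreal (exp (- s * (\<Sum>k\<in>K. (x $ k)\<^sup>2))) \<partial>gauss) = (\<Prod>k\<in>UNIV. \<integral>\<^sup>+t. f k t \<partial>std_normal)"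
        using nn_integral_gauss_prod[of f, OF fm] by simp
      also have "\<dots> = (\<Prod>k\<in>K. ennreal (1 / sqrt (1 + 2 * s)))"
      proof (rule prod.mono_neutral_cong_right)
        fix k assume "k \<in> K"
        then show "(\<integral>\<^sup>+t. f k t \<partial>std_normal) = ennreal (1 / sqrt (1 + 2 * s))"
          using nn_integral_std_normal_exp[of s] True by (simp add: f_def)
      qed (use N.emeasure_space_1 in \<open>auto simp: f_def\<close>)
      also have "\<dots> = ennreal (1 / (sqrt (1 + 2 * s)) ^ 3)"
        using True K by (simp add: prod_constant ennreal_power power_divide)
      finally show ?thesis using True by simp
    qed simp
  qed
  also have "\<dots> = 1"
  proof -
    have D: "((\<lambda>s. - 1 / sqrt (1 + 2 * s)) has_real_derivative 1 / (sqrt (1 + 2 * s)) ^ 3) (at s)" if "-1/2 < s" for s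
    proof -
      have p: "0 < 1 + 2 * s" using that by simp
      have "((\<lambda>s. - inverse (sqrt (1 + 2 * s))) has_real_derivative
          - (- (inverse (sqrt (1 + 2 * s)) * (inverse (sqrt (1 + 2 * s)) / 2 * 2) * inverse (sqrt (1 + 2 * s))))) (at s)"
        using p by (intro DERIV_minus DERIV_inverse' DERIV_chain2[OF DERIV_real_sqrt]) (auto intro!: derivative_eq_intros)
      moreover have "- (- (inverse w * (inverse w / 2 * 2) * inverse w)) = 1 / w ^ 3" for w :: real
        by (simp add: inverse_eq_divide power3_eq_cube)
      moreover have "(\<lambda>s::real. - 1 / sqrt (1 + 2 * s)) = (\<lambda>s. - inverse (sqrt (1 + 2 * s)))"
        by (simp add: inverse_eq_divide)
      ultimately show ?thesis by (simp only:)
    qed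
    have C: "isCont (\<lambda>s. 1 / (sqrt (1 + 2 * s)) ^ 3) s" if "0 < s" for s :: real
      using that by (intro continuous_intros) auto
    have lim: "((\<lambda>s. - 1 / sqrt (1 + 2 * s)) \<longlongrightarrow> 0) at_top"
    proof -
      have "filterlim (\<lambda>s::real. 1 + 2 * s) at_top at_top"
        by (intro filterlim_tendsto_add_at_top[OF tendsto_const] filterlim_tendsto_pos_mult_at_top[OF tendsto_const _ filterlim_ident]) simp
      then have "filterlim (\<lambda>s. sqrt (1 + 2 * s)) at_infinity at_top"
        by (intro filterlim_at_top_imp_at_infinity filterlim_compose[OF sqrt_at_top])
      then show ?thesis by (intro tendsto_divide_0[OF tendsto_const])
    qed
    have "set_integrable lborel {0<..} (\<lambda>s. 1 / (sqrt (1 + 2 * s)) ^ 3)"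
      "(LINT s:{0<..}|lborel. 1 / (sqrt (1 + 2 * s)) ^ 3) = 1"
      using set_integral_FTC_ray[of 0 "\<lambda>s. - 1 / sqrt (1 + 2 * s)" "\<lambda>s. 1 / (sqrt (1 + 2 * s)) ^ 3" 0,
          OF D C _ DERIV_isCont[OF D] lim] by auto
    then show ?thesis
      unfolding set_integrable_def set_lebesgue_integral_def
      by (subst nn_integral_eq_integral) (auto simp: indicator_def)
  qed
  finally show ?thesis .
qed

section \<open>Independent standard normal coordinates\<close>

definition (in prob_space) iid_std_normal :: "('i \<Rightarrow> 'a \<Rightarrow> real) \<Rightarrow> 'i set \<Rightarrow> bool" where
  "iid_std_normal h I \<longleftrightarrow> indep_vars (\<lambda>_. borel) h I \<and> (\<forall>i\<in>I. distr M borel (h i) = std_normal)"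

text \<open>
  Probabilities of product sets determine both the marginals and their independence: the marginal of
  one coordinate is the case in which all other factors are the whole line.
\<close>

lemma (in prob_space) iid_std_normalI:
  assumes I: "finite I" "I \<noteq> {}" and rv: "\<And>i. i \<in> I \<Longrightarrow> random_variable borel (h i)"
    and prod: "\<And>B. (\<And>i. i \<in> I \<Longrightarrow> B i \<in> sets borel) \<Longrightarrow>
      prob {\<omega> \<in> space M. \<forall>i\<in>I. h i \<omega> \<in> B i} = (\<Prod>i\<in>I. measure std_normal (B i))"
  shows "iid_std_normal h I"
proof -
  interpret N: prob_space std_normal by (rule prob_space_std_normal)
  have one: "prob {\<omega> \<in> space M. h i \<omega> \<in> B} = measure std_normal B" if i: "i \<in> I" and B: "B \<in> sets borel" for i B
  proof -
    have "{\<omega> \<in> space M. \<forall>j\<in>I. h j \<omega> \<in> (if j = i then B else UNIV)} = {\<omega> \<in> space M. h i \<omega> \<in> B}"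
      using i by auto
    moreover have "(\<Prod>j\<in>I. measure std_normal (if j = i then B else UNIV)) = measure std_normal B"
    proof -
      have "(\<Prod>j\<in>I. measure std_normal (if j = i then B else UNIV)) = (\<Prod>j\<in>I. if j = i then measure std_normal B else 1)"
        using N.prob_space by (intro prod.cong) auto
      then show ?thesis using I i by (simp add: prod.delta)
    qed
    ultimately show ?thesis using prod[of "\<lambda>j. if j = i then B else UNIV"] B by simp
  qed
  have d: "distr M borel (h i) = std_normal" if i: "i \<in> I" for i
  proof (rule measure_eqI)
    fix B assume "B \<in> sets (distr M borel (h i))"
    then have B: "B \<in> sets borel" by simp
    have "h i -` B \<inter> space M = {\<omega> \<in> space M. h i \<omega> \<in> B}" by auto
    then have "emeasure (distr M borel (h i)) B = ennreal (prob {\<omega> \<in> space M. h i \<omega> \<in> B})"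
      using B rv[OF i] by (simp add: emeasure_distr emeasure_eq_measure)
    then show "emeasure (distr M borel (h i)) B = emeasure std_normal B"
      by (simp add: one[OF i B] N.emeasure_eq_measure)
  qed simp
  have "indep_vars (\<lambda>_. borel) h I"
  proof (subst indep_vars_finite[where E = "\<lambda>_. sets borel"])
    show "\<forall>A\<in>I \<rightarrow> sets borel. prob (\<Inter>j\<in>I. h j -` A j \<inter> space M) = (\<Prod>j\<in>I. prob (h j -` A j \<inter> space M))"
    proof
      fix A assume A: "A \<in> I \<rightarrow> sets (borel :: real measure)"
      have "(\<Inter>j\<in>I. h j -` A j \<inter> space M) = {\<omega> \<in> space M. \<forall>i\<in>I. h i \<omega> \<in> A i}" using I by auto
      moreover have "h j -` A j \<inter> space M = {\<omega> \<in> space M. h j \<omega> \<in> A j}" for j by auto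
      ultimately have calc: "prob (\<Inter>j\<in>I. h j -` A j \<inter> space M) = prob {\<omega> \<in> space M. \<forall>i\<in>I. h i \<omega> \<in> A i}"
        "\<And>j. prob (h j -` A j \<inter> space M) = prob {\<omega> \<in> space M. h j \<omega> \<in> A j}" by simp_all
      show "prob (\<Inter>j\<in>I. h j -` A j \<inter> space M) = (\<Prod>j\<in>I. prob (h j -` A j \<inter> space M))"
      proof -
        have Ai: "A i \<in> sets borel" if "i \<in> I" for i using A that by auto
        have "(\<Prod>j\<in>I. prob {\<omega> \<in> space M. h j \<omega> \<in> A j}) = (\<Prod>j\<in>I. measure std_normal (A j))"
          by (intro prod.cong refl one Ai)
        with calc show ?thesis using prod[OF Ai] by simp
      qed
    qed
    show "Int_stable (sets borel)" by (auto simp: Int_stable_def)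
    show "sets borel = sigma_sets (space borel) (sets borel)" by (metis sets.sigma_sets_eq)
    show "sets borel \<subseteq> Pow (space borel)" by simp
  qed (use I rv in auto)
  with d show ?thesis by (simp add: iid_std_normal_def)
qed

lemma (in prob_space) iid_std_normal_distr:
  assumes h: "iid_std_normal h I" and I: "I \<noteq> {}"
  shows "distr M (PiM I (\<lambda>_. borel)) (\<lambda>\<omega>. \<lambda>i\<in>I. h i \<omega>) = PiM I (\<lambda>_. std_normal)"
proof -
  have ind: "indep_vars (\<lambda>_. borel) h I" and d: "\<And>i. i \<in> I \<Longrightarrow> distr M borel (h i) = std_normal"
    using h by (auto simp: iid_std_normal_def)
  have "distr M (PiM I (\<lambda>_. borel)) (\<lambda>\<omega>. \<lambda>i\<in>I. h i \<omega>) = PiM I (\<lambda>i. distr M borel (h i))"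
    using indep_vars_iff_distr_eq_PiM'[OF I, where X = h and M' = "\<lambda>_. borel"] ind
    by (auto simp: indep_vars_def)
  also have "\<dots> = PiM I (\<lambda>_. std_normal)" using d by (intro PiM_cong) auto
  finally show ?thesis .
qed

lemma gauss_coordinates_iid: "prob_space.iid_std_normal gauss (\<lambda>i (x::real^'n). x $ i) UNIV"
proof -
  interpret G: prob_space "gauss :: (real^'n) measure" by (rule prob_space_gauss)
  interpret N: prob_space std_normal by (rule prob_space_std_normal)
  show ?thesis
  proof (rule G.iid_std_normalI)
    show "(\<lambda>x::real^'n. x $ i) \<in> borel_measurable gauss" for i
      by (rule measurable_vec_nth) simp
    fix B :: "'n \<Rightarrow> real set" assume "\<And>i. i \<in> UNIV \<Longrightarrow> B i \<in> sets borel"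
    from emeasure_gauss_prod[of B, OF this]
    have "ennreal (measure gauss {x::real^'n. \<forall>i. x $ i \<in> B i}) = ennreal (\<Prod>i\<in>UNIV. measure std_normal (B i))"
      by (simp add: G.emeasure_eq_measure N.emeasure_eq_measure prod_ennreal)
    then show "measure gauss {\<omega> \<in> space gauss. \<forall>i\<in>UNIV. \<omega> $ i \<in> B i} = (\<Prod>i\<in>UNIV. measure std_normal (B i))"
      by (simp add: prod_nonneg)
  qed auto
qed

lemma (in prob_space) iid_std_normal_subset:
  assumes "iid_std_normal h I" "J \<subseteq> I"
  shows "iid_std_normal h J"
  using assms indep_vars_subset by (auto simp: iid_std_normal_def)

lemma (in prob_space) std_gaussian_vector_measurable:
  assumes "std_gaussian_vector X"
  shows "random_variable borel X"
proof -
  have "(\<lambda>\<omega>. X \<omega> $ j) \<in> borel_measurable M" for j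
    using assms by (auto simp: std_gaussian_vector_def indep_vars_def)
  from measurable_vec_lambda[where f = "\<lambda>\<omega> i. X \<omega> $ i", OF this] show ?thesis by simp
qed

text \<open>
  Both laws are the image of the same product measure under the map from coordinates to vectors.
\<close>

lemma (in prob_space) distr_std_gaussian_vector:
  fixes X :: "'a \<Rightarrow> real^'n"
  assumes X: "std_gaussian_vector X"
  shows "distr M borel X = gauss"
proof -
  interpret G: prob_space "gauss :: (real^'n) measure" by (rule prob_space_gauss)
  define vec :: "('n \<Rightarrow> real) \<Rightarrow> real^'n" where "vec = (\<lambda>f. \<chi> i. f i)"
  have vec: "vec \<in> borel_measurable (PiM UNIV (\<lambda>_. borel))"
    unfolding vec_def by (intro measurable_vec_lambda measurable_component_singleton) simp
  have "distr M borel (\<lambda>\<omega>. X \<omega> $ j) = std_normal" for j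
  proof -
    have "distr M borel (\<lambda>\<omega>. X \<omega> $ j) = distr M lborel (\<lambda>\<omega>. X \<omega> $ j)" by (rule distr_cong) simp_all
    also have "\<dots> = std_normal"
      using X unfolding std_normal_def by (intro distributed_distr_eq_density) (auto simp: std_gaussian_vector_def)
    finally show ?thesis .
  qed
  then have iid: "iid_std_normal (\<lambda>j \<omega>. X \<omega> $ j) UNIV"
    using X by (auto simp: std_gaussian_vector_def iid_std_normal_def)
  have Xm: "(\<lambda>\<omega>. \<lambda>i\<in>UNIV. X \<omega> $ i) \<in> measurable M (PiM UNIV (\<lambda>_. borel))"
    using iid by (intro measurable_restrict) (auto simp: iid_std_normal_def indep_vars_def)
  have Gm: "(\<lambda>x::real^'n. \<lambda>i\<in>UNIV. x $ i) \<in> measurable gauss (PiM UNIV (\<lambda>_. borel))"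
    by (intro measurable_restrict measurable_vec_nth) simp
  have "vec \<circ> (\<lambda>\<omega>. \<lambda>i\<in>UNIV. X \<omega> $ i) = X" by (simp add: fun_eq_iff vec_def vec_eq_iff)
  then have "distr M borel X = distr M borel (vec \<circ> (\<lambda>\<omega>. \<lambda>i\<in>UNIV. X \<omega> $ i))" by simp
  also have "\<dots> = distr (PiM UNIV (\<lambda>_. std_normal)) borel vec"
    by (simp only: distr_distr[OF vec Xm, symmetric] iid_std_normal_distr[OF iid UNIV_not_empty])
  also have "\<dots> = distr gauss borel (vec \<circ> (\<lambda>x::real^'n. \<lambda>i\<in>UNIV. x $ i))"
    by (simp only: distr_distr[OF vec Gm, symmetric] G.iid_std_normal_distr[OF gauss_coordinates_iid UNIV_not_empty])
  also have "vec \<circ> (\<lambda>x::real^'n. \<lambda>i\<in>UNIV. x $ i) = (\<lambda>x. x)" by (simp add: fun_eq_iff vec_def vec_eq_iff)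
  also have "distr gauss borel (\<lambda>x. x) = gauss" by (rule distr_id2) simp
  finally show ?thesis .
qed

text \<open>
  Independence over \<open>k\<close> comes from the hypothesis, independence over \<open>i\<close> from rotation invariance.
\<close>

lemma (in prob_space) iid_rotated_coordinates:
  fixes V :: "'n \<Rightarrow> real^'n" and b :: "'k \<Rightarrow> 'a \<Rightarrow> real^'n"
  assumes V: "orthonormal_family V" and I: "finite I" "I \<noteq> {}"
    and ind: "indep_vars (\<lambda>_. borel) b I" and g: "\<And>k. k \<in> I \<Longrightarrow> std_gaussian_vector (b k)"
  shows "iid_std_normal (\<lambda>(i, k) \<omega>. V i \<bullet> b k \<omega>) (UNIV \<times> I)"
proof (rule iid_std_normalI)
  interpret G: prob_space "gauss :: (real^'n) measure" by (rule prob_space_gauss)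
  interpret N: prob_space std_normal by (rule prob_space_std_normal)
  have rvb: "random_variable borel (b k)" if "k \<in> I" for k
    using g[OF that] by (rule std_gaussian_vector_measurable)
  show "random_variable borel (case ik of (i, k) \<Rightarrow> \<lambda>\<omega>. V i \<bullet> b k \<omega>)" if "ik \<in> UNIV \<times> I" for ik
    using that rvb by (cases ik) auto
  fix B :: "'n \<times> 'k \<Rightarrow> real set" assume B: "\<And>ik. ik \<in> UNIV \<times> I \<Longrightarrow> B ik \<in> sets borel"
  define C where "C = (\<lambda>k. {x::real^'n. \<forall>i. x $ i \<in> B (i, k)})"
  define T where "T = (\<lambda>x::real^'n. \<chi> i. V i \<bullet> x)"
  have T: "T \<in> borel_measurable borel" unfolding T_def by (rule coordinate_isometry(4)[OF V])
  have C: "C k \<in> sets borel" if "k \<in> I" for k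
  proof -
    have eq: "C k = (\<Inter>i. (\<lambda>x. x $ i) -` B (i, k) \<inter> space borel)" by (auto simp: C_def)
    have cm: "(\<lambda>x::real^'n. x $ i) \<in> borel_measurable borel" for i
      by (rule measurable_vec_nth) simp
    have "(\<lambda>x::real^'n. x $ i) -` B (i, k) \<inter> space borel \<in> sets borel" for i
      using B[of "(i, k)"] that by (intro measurable_sets[OF cm]) auto
    then show ?thesis unfolding eq by (intro sets.countable_INT') auto
  qed
  have TC: "T -` C k \<in> sets borel" if "k \<in> I" for k
    using measurable_sets[OF T C[OF that]] by simp
  have "{\<omega> \<in> space M. \<forall>ik\<in>UNIV \<times> I. (case ik of (i, k) \<Rightarrow> \<lambda>\<omega>. V i \<bullet> b k \<omega>) \<omega> \<in> B ik}
      = (\<Inter>k\<in>I. b k -` (T -` C k) \<inter> space M)"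
    using I by (auto simp: C_def T_def)
  then have "prob {\<omega> \<in> space M. \<forall>ik\<in>UNIV \<times> I. (case ik of (i, k) \<Rightarrow> \<lambda>\<omega>. V i \<bullet> b k \<omega>) \<omega> \<in> B ik}
      = (\<Prod>k\<in>I. prob (b k -` (T -` C k) \<inter> space M))"
    using indep_varsD_finite[OF ind I(2,1), of "\<lambda>k. T -` C k"] TC by simp
  also have "\<dots> = (\<Prod>k\<in>I. \<Prod>i\<in>UNIV. measure std_normal (B (i, k)))"
  proof (rule prod.cong[OF refl])
    fix k assume k: "k \<in> I"
    have "prob (b k -` (T -` C k) \<inter> space M) = measure (distr M borel (b k)) (T -` C k)"
      using rvb[OF k] TC[OF k] by (simp add: measure_distr)
    also have "\<dots> = measure gauss (T -` C k)" by (simp add: distr_std_gaussian_vector[OF g[OF k]])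
    also have "\<dots> = measure (distr gauss borel T) (C k)"
      using T C[OF k] by (subst measure_distr) auto
    also have "\<dots> = measure gauss (C k)" unfolding T_def by (simp add: distr_gauss_rotate[OF V])
    also have "\<dots> = (\<Prod>i\<in>UNIV. measure std_normal (B (i, k)))"
    proof -
      have "emeasure gauss (C k) = (\<Prod>i\<in>UNIV. emeasure std_normal (B (i, k)))"
        unfolding C_def using B k by (intro emeasure_gauss_prod) auto
      then have "ennreal (measure gauss (C k)) = ennreal (\<Prod>i\<in>UNIV. measure std_normal (B (i, k)))"
        by (simp add: G.emeasure_eq_measure N.emeasure_eq_measure prod_ennreal)
      then show ?thesis by (simp add: prod_nonneg)
    qed
    finally show "prob (b k -` (T -` C k) \<inter> space M) = (\<Prod>i\<in>UNIV. measure std_normal (B (i, k)))" .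
  qed
  also have "\<dots> = (\<Prod>ik\<in>UNIV \<times> I. measure std_normal (B ik))"
    by (subst prod.swap) (simp add: prod.cartesian_product)
  finally show "prob {\<omega> \<in> space M. \<forall>ik\<in>UNIV \<times> I. (case ik of (i, k) \<Rightarrow> \<lambda>\<omega>. V i \<bullet> b k \<omega>) \<omega> \<in> B ik}
      = (\<Prod>ik\<in>UNIV \<times> I. measure std_normal (B ik))" .
qed (use I in auto)

section \<open>Gaussian rows with vanishing coordinates\<close>

definition restrict_coords :: "'n set \<Rightarrow> real^'n \<Rightarrow> real^'n" where
  "restrict_coords S x = (\<chi> s. if s \<in> S then x $ s else 0)"

text \<open>
  A group of Gaussian vectors gives rows with one entry per vector, and the number of vectors is not
  the cardinality of a type. The rows are therefore embedded into a larger Euclidean space, with the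
  entries outside \<open>S\<close> set to 0.
\<close>

definition pad :: "'n set \<Rightarrow> ('n \<Rightarrow> real) \<Rightarrow> real^'n" where
  "pad S f = (\<chi> s. if s \<in> S then f s else 0)"

definition padded_gauss :: "'n set \<Rightarrow> (real^'n) measure" where
  "padded_gauss S = distr (PiM S (\<lambda>_. std_normal)) borel (pad S)"

lemma measurable_pad: "pad S \<in> borel_measurable (PiM S (\<lambda>_. borel))"
  unfolding pad_def
proof (intro measurable_vec_lambda)
  fix s show "(\<lambda>f. if s \<in> S then f s else 0) \<in> borel_measurable (PiM S (\<lambda>_. borel))"
    by (cases "s \<in> S") (auto intro: measurable_component_singleton)
qed

lemma measurable_restrict_coords:
  fixes S :: "'n::finite set"
  shows "restrict_coords S \<in> borel_measurable borel"
  unfolding restrict_coords_def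
proof (intro measurable_vec_lambda)
  fix s
  have "(\<lambda>x::real^'n. x $ s) \<in> borel_measurable borel" by (rule measurable_vec_nth) simp
  then show "(\<lambda>x::real^'n. if s \<in> S then x $ s else 0) \<in> borel_measurable borel"
    by (cases "s \<in> S") auto
qed

lemma restrict_coords_gauss: "restrict_coords S \<in> borel_measurable gauss"
  unfolding measurable_cong_sets[OF sets_gauss refl] by (rule measurable_restrict_coords)

lemma sets_padded_gauss [simp, measurable_cong]: "sets (padded_gauss S) = sets borel"
  and space_padded_gauss [simp]: "space (padded_gauss S) = UNIV"
  by (simp_all add: padded_gauss_def)

lemma (in prob_space) distr_pad:
  assumes h: "iid_std_normal h S" and S: "S \<noteq> {}"
  shows "distr M borel (\<lambda>\<omega>. pad S (\<lambda>s. h s \<omega>)) = padded_gauss S"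
proof -
  have m: "(\<lambda>\<omega>. \<lambda>s\<in>S. h s \<omega>) \<in> measurable M (PiM S (\<lambda>_. borel))"
    using h by (intro measurable_restrict) (auto simp: iid_std_normal_def indep_vars_def)
  have "(\<lambda>\<omega>. pad S (\<lambda>s. h s \<omega>)) = pad S \<circ> (\<lambda>\<omega>. \<lambda>s\<in>S. h s \<omega>)"
    by (auto simp: pad_def fun_eq_iff vec_eq_iff)
  then have "distr M borel (\<lambda>\<omega>. pad S (\<lambda>s. h s \<omega>)) = distr (distr M (PiM S (\<lambda>_. borel)) (\<lambda>\<omega>. \<lambda>s\<in>S. h s \<omega>)) borel (pad S)"
    by (simp only: distr_distr[OF measurable_pad m])
  then show ?thesis by (simp add: iid_std_normal_distr[OF h S] padded_gauss_def)
qed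

lemma padded_gauss_eq:
  fixes S :: "'n::finite set"
  assumes S: "S \<noteq> {}"
  shows "padded_gauss S = distr gauss borel (restrict_coords S)"
proof -
  interpret G: prob_space "gauss :: (real^'n) measure" by (rule prob_space_gauss)
  have "distr gauss borel (\<lambda>x. pad S (\<lambda>s. x $ s)) = padded_gauss S"
    by (rule G.distr_pad[OF G.iid_std_normal_subset[OF gauss_coordinates_iid] S]) simp
  moreover have "(\<lambda>x. pad S (\<lambda>s. x $ s)) = restrict_coords S"
    by (simp add: fun_eq_iff pad_def restrict_coords_def)
  ultimately show ?thesis by simp
qed

lemma nn_integral_padded_gauss:
  fixes S :: "'n::finite set"
  assumes S: "S \<noteq> {}" and f: "f \<in> borel_measurable borel"
  shows "(\<integral>\<^sup>+x. f x \<partial>padded_gauss S) = (\<integral>\<^sup>+x. f (restrict_coords S x) \<partial>gauss)"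
  unfolding padded_gauss_eq[OF S]
  by (subst nn_integral_distr[OF restrict_coords_gauss]) (use f in auto)

lemma prob_space_padded_gauss:
  fixes S :: "'n::finite set"
  assumes S: "S \<noteq> {}"
  shows "prob_space (padded_gauss S)"
  unfolding padded_gauss_eq[OF S]
  by (intro prob_space.prob_space_distr prob_space_gauss restrict_coords_gauss)

lemma restrict_coords_inner: "restrict_coords S x \<bullet> y = x \<bullet> restrict_coords S y"
  unfolding inner_vec_def restrict_coords_def by (intro sum.cong) auto

lemma nn_integral_padded_gauss_inner_sq:
  fixes S :: "'n::finite set"
  assumes S: "S \<noteq> {}"
  shows "(\<integral>\<^sup>+x. ennreal ((x \<bullet> w)\<^sup>2) \<partial>padded_gauss S) \<le> ennreal (w \<bullet> w)"
proof -
  have "(\<integral>\<^sup>+x. ennreal ((x \<bullet> w)\<^sup>2) \<partial>padded_gauss S) = (\<integral>\<^sup>+x. ennreal ((x \<bullet> restrict_coords S w)\<^sup>2) \<partial>gauss)"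
    by (subst nn_integral_padded_gauss[OF S]) (auto simp: restrict_coords_inner)
  also have "\<dots> = ennreal (restrict_coords S w \<bullet> restrict_coords S w)" by (rule nn_integral_gauss_inner_sq)
  also have "\<dots> \<le> ennreal (w \<bullet> w)"
    unfolding inner_vec_def restrict_coords_def by (intro ennreal_leI sum_mono) auto
  finally show ?thesis .
qed

section \<open>Distance of a Gaussian row to a subspace\<close>

definition oproj :: "(real^'n) set \<Rightarrow> real^'n \<Rightarrow> real^'n" where
  "oproj U x = (THE p. galerkin (mat 1) U x p)"

lemma sym_pos_def_mat_1: "sym_pos_def (mat 1 :: real^'n^'n)"
  by (auto simp: sym_pos_def_def transpose_mat)

lemma oproj_galerkin:
  assumes "subspace U"
  shows "galerkin (mat 1) U x (oproj U x)"
proof -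
  obtain p where p: "galerkin (mat 1) U x p" using galerkin_exists[OF sym_pos_def_mat_1 assms] by blast
  have "\<exists>!p. galerkin (mat 1) U x p"
    by (rule ex1I[of _ p], rule p, rule galerkin_unique[OF sym_pos_def_mat_1 assms _ p])
  then show ?thesis unfolding oproj_def by (rule theI')
qed

lemma oproj_decomposition:
  assumes "subspace U"
  shows "oproj U x \<in> U" "y \<in> U \<Longrightarrow> (x - oproj U x) \<bullet> y = 0"
  using oproj_galerkin[OF assms, of x] by (auto simp: galerkin_def)

lemma inverse_ennreal_antimono:
  fixes r s :: real
  assumes "0 \<le> r" "r \<le> s"
  shows "inverse (ennreal s) \<le> inverse (ennreal r)"
proof (cases "r = 0")
  case False
  with assms have "0 < r" "0 < s" by auto
  then show ?thesis using assms by (simp add: inverse_ennreal ennreal_leI le_imp_inverse_le)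
qed simp

text \<open>
  Choose three orthonormal vectors in the complement of \<open>U\<close> within the coordinates \<open>S\<close>. By Bessel's
  inequality the squared distance of \<open>x\<close> to \<open>U\<close> is at least the sum of the three squared components, and
  by rotation invariance these are three independent standard normals.
\<close>

lemma inverse_distance_expectation:
  fixes S :: "'n::finite set" and U :: "(real^'n) set"
  assumes U: "subspace U" "\<And>x s. x \<in> U \<Longrightarrow> s \<notin> S \<Longrightarrow> x $ s = 0" and dim: "dim U + 3 \<le> card S"
    and m: "(\<lambda>x. oproj U x) \<in> borel_measurable borel"
  shows "(\<integral>\<^sup>+x. inverse (ennreal ((x - oproj U x) \<bullet> (x - oproj U x))) \<partial>padded_gauss S) \<le> 1"
proof -
  have S: "S \<noteq> {}" using dim by auto
  define E where "E = {x::real^'n. \<forall>s. s \<notin> S \<longrightarrow> x $ s = 0}"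
  have subE: "subspace E" by (auto simp: E_def subspace_def)
  have dimE: "dim E = card S"
  proof -
    have inj: "inj (\<lambda>i::'n. axis i (1::real))" by (auto simp: inj_on_def axis_eq_axis)
    let ?d = "(\<lambda>s. axis s (1::real)) ` S"
    have "dim {x::real^'n. \<forall>i\<in>Basis. i \<notin> ?d \<longrightarrow> x \<bullet> i = 0} = card ?d"
      by (rule dim_substandard) (auto simp: Basis_vec_real)
    moreover have "{x::real^'n. \<forall>i\<in>Basis. i \<notin> ?d \<longrightarrow> x \<bullet> i = 0} = E"
      by (auto simp: E_def Basis_vec_real inner_axis inj_image_mem_iff[OF inj])
    moreover have "card ?d = card S" by (rule card_image) (rule inj_on_subset[OF inj], simp)
    ultimately show ?thesis by simp
  qed
  define W where "W = {y \<in> E. \<forall>x\<in>U. orthogonal x y}"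
  have "dim W + dim U = dim E"
    unfolding W_def by (rule dim_subspace_orthogonal_to_vectors[OF U(1) subE]) (use U(2) in \<open>auto simp: E_def\<close>)
  then have dimW: "3 \<le> dim W" using dim dimE by simp
  have subW: "subspace W" using subE by (auto simp: W_def subspace_def orthogonal_def inner_add_right)
  obtain C where C: "C \<subseteq> W" "pairwise orthogonal C" "\<And>x. x \<in> C \<Longrightarrow> norm x = 1" "independent C" "card C = dim W"
    using orthonormal_basis_subspace[OF subW] by metis
  obtain B where B: "B \<subseteq> C" "card B = 3"
    using dimW C(5) by (metis obtain_subset_with_card_n)
  obtain V :: "'n \<Rightarrow> real^'n" where V: "orthonormal_family V" "B \<subseteq> range V"
  proof (rule orthonormal_extension[of B])
    show "pairwise orthogonal B" using C(2) B(1) by (rule pairwise_subset)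
    show "norm x = 1" if "x \<in> B" for x using that B C by auto
  qed (rule that)
  note injV = orthonormal_family_inj[OF V(1)]
  define K where "K = V -` B"
  have VK: "V ` K = B" using V(2) by (auto simp: K_def)
  then have cK: "card K = 3" using B(2) card_image[OF inj_on_subset[OF injV], of K] by simp
  have fm: "(\<lambda>x. inverse (ennreal ((x - oproj U x) \<bullet> (x - oproj U x)))) \<in> borel_measurable borel"
    using m by (intro borel_measurable_inverse_ennreal measurable_compose[OF _ measurable_ennreal] borel_measurable_inner borel_measurable_diff) auto
  have bound: "(\<Sum>k\<in>K. ((\<chi> i. V i \<bullet> x) $ k)\<^sup>2) \<le> (restrict_coords S x - oproj U (restrict_coords S x)) \<bullet> (restrict_coords S x - oproj U (restrict_coords S x))" for x
  proof -
    let ?y = "restrict_coords S x - oproj U (restrict_coords S x)"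
    have "?y \<bullet> V k = V k \<bullet> x" if k: "k \<in> K" for k
    proof -
      have "V k \<in> W" using k VK B(1) C(1) by auto
      then have "oproj U (restrict_coords S x) \<bullet> V k = 0" "restrict_coords S (V k) = V k"
        using oproj_decomposition(1)[OF U(1)] by (auto simp: W_def orthogonal_def E_def restrict_coords_def vec_eq_iff)
      moreover have "restrict_coords S x \<bullet> V k = x \<bullet> restrict_coords S (V k)" by (rule restrict_coords_inner)
      ultimately show ?thesis by (simp add: inner_diff_left inner_commute[of x])
    qed
    then have "(\<Sum>k\<in>K. ((\<chi> i. V i \<bullet> x) $ k)\<^sup>2) = (\<Sum>k\<in>K. (?y \<bullet> V k) * (?y \<bullet> V k))"
      by (simp add: power2_eq_square)
    also have "\<dots> \<le> (\<Sum>k\<in>UNIV. (?y \<bullet> V k) * (?y \<bullet> V k))" by (intro sum_mono2) auto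
    also have "\<dots> = ?y \<bullet> ?y" by (rule orthonormal_family_inner[OF V(1), symmetric])
    finally show ?thesis .
  qed
  have gm: "(\<lambda>x::real^'n. inverse (ennreal (\<Sum>k\<in>K. (x $ k)\<^sup>2))) \<in> borel_measurable borel"
  proof -
    have "(\<lambda>x::real^'n. x $ i) \<in> borel_measurable borel" for i by (rule measurable_vec_nth) simp
    then show ?thesis
      by (intro borel_measurable_inverse_ennreal measurable_compose[OF _ measurable_ennreal] borel_measurable_sum borel_measurable_power)
  qed
  have "(\<integral>\<^sup>+x. inverse (ennreal ((x - oproj U x) \<bullet> (x - oproj U x))) \<partial>padded_gauss S)
      \<le> (\<integral>\<^sup>+x. (\<lambda>x. inverse (ennreal (\<Sum>k\<in>K. (x $ k)\<^sup>2))) (\<chi> i. V i \<bullet> x) \<partial>gauss)"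
    unfolding nn_integral_padded_gauss[OF S fm]
    by (intro nn_integral_mono inverse_ennreal_antimono bound sum_nonneg) auto
  also have "\<dots> = (\<integral>\<^sup>+x. inverse (ennreal (\<Sum>k\<in>K. (x $ k)\<^sup>2)) \<partial>gauss)"
    by (rule nn_integral_gauss_rotate[OF V(1) gm])
  also have "\<dots> \<le> 1" by (rule nn_integral_gauss_inverse_chi3[OF cK])
  finally show ?thesis .
qed

section \<open>Leakage of the dual rows\<close>

text \<open>
  Replacing one coordinate by an independent copy does not change an expectation. This form of Fubini
  allows one to average over a single row while all rows stay arguments of the same function.
\<close>

lemma nn_integral_PiM_resample:
  fixes i :: "'i::finite"
  assumes N: "prob_space N" and f: "f \<in> borel_measurable (PiM UNIV (\<lambda>_::'i. N))"
  shows "(\<integral>\<^sup>+h. f h \<partial>PiM UNIV (\<lambda>_::'i. N)) = (\<integral>\<^sup>+h. (\<integral>\<^sup>+x. f (h(i := x)) \<partial>N) \<partial>PiM UNIV (\<lambda>_::'i. N))"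
proof -
  interpret N: prob_space N by (rule N)
  interpret P: product_sigma_finite "\<lambda>_::'i. N" by standard
  let ?J = "UNIV - {i}"
  have U: "insert i ?J = UNIV" by auto
  define g where "g = (\<lambda>h. \<integral>\<^sup>+x. f (h(i := x)) \<partial>N)"
  have "(\<lambda>(h, x). h(i := x)) \<in> measurable (PiM UNIV (\<lambda>_::'i. N) \<Otimes>\<^sub>M N) (PiM UNIV (\<lambda>_::'i. N))"
    using measurable_add_dim[of i UNIV "\<lambda>_::'i. N"] by simp
  from measurable_compose[OF this f]
  have "(\<lambda>(h, x). f (h(i := x))) \<in> borel_measurable (PiM UNIV (\<lambda>_::'i. N) \<Otimes>\<^sub>M N)"
    by (simp add: case_prod_beta')
  then have gm: "g \<in> borel_measurable (PiM UNIV (\<lambda>_::'i. N))"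
    unfolding g_def by (rule N.borel_measurable_nn_integral)
  have split: "(\<integral>\<^sup>+h. u h \<partial>PiM UNIV (\<lambda>_::'i. N)) = (\<integral>\<^sup>+h. (\<integral>\<^sup>+x. u (h(i := x)) \<partial>N) \<partial>PiM ?J (\<lambda>_::'i. N))"
    if "u \<in> borel_measurable (PiM UNIV (\<lambda>_::'i. N))" for u
    using P.product_nn_integral_insert[of ?J i u] that by (simp add: U)
  show ?thesis
    unfolding g_def[symmetric] split[OF f] split[OF gm]
    by (simp add: g_def N.emeasure_space_1)
qed

definition residual :: "'n set \<Rightarrow> 'd set \<Rightarrow> ('d \<Rightarrow> real^'n) \<Rightarrow> 'd \<Rightarrow> real^'n" where
  "residual S T h j = restrict_coords S (h j)
     - oproj (span ((\<lambda>l. restrict_coords S (h l)) ` (T - {j}))) (restrict_coords S (h j))"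

text \<open>
  The dual vector of row \<open>j\<close> relative to the other rows in \<open>T\<close>, as in a row of a pseudoinverse. Its
  length is the inverse distance of row \<open>j\<close> to the span of the others. If the residual is 0, then so is
  the quotient; \<open>bad_rows\<close> contains this case.
\<close>

definition dual_row :: "'n set \<Rightarrow> 'd set \<Rightarrow> ('d \<Rightarrow> real^'n) \<Rightarrow> 'd \<Rightarrow> real^'n" where
  "dual_row S T h j = (1 / (residual S T h j \<bullet> residual S T h j)) *\<^sub>R residual S T h j"

text \<open>
  The squared Frobenius norm of the product of the lower part of the sketch with the pseudoinverse of
  its upper part.
\<close>

definition leakage :: "'n set \<Rightarrow> 'd set \<Rightarrow> ('d \<Rightarrow> real^'n) \<Rightarrow> real" where
  "leakage S T h = (\<Sum>i\<in>-T. \<Sum>j\<in>T. (restrict_coords S (h i) \<bullet> dual_row S T h j)\<^sup>2)"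

definition bad_rows :: "'n set \<Rightarrow> 'd set \<Rightarrow> ('d::finite \<Rightarrow> real^'n) set" where
  "bad_rows S T = {h. (\<exists>j\<in>T. residual S T h j = 0) \<or> 100 * (real (card T) * real (card (-T))) < leakage S T h}"

lemma measurable_row: "(\<lambda>h. restrict_coords S (h l)) \<in> borel_measurable (PiM UNIV (\<lambda>_::'d. borel :: (real^'n) measure))"
  by (rule measurable_compose[OF _ measurable_restrict_coords], rule measurable_component_singleton) simp

lemma measurable_oproj:
  assumes "finite J" "\<And>j. j \<in> J \<Longrightarrow> w j \<in> borel_measurable N" "b \<in> borel_measurable N"
  shows "(\<lambda>\<omega>. oproj (span ((\<lambda>j. w j \<omega>) ` J)) (b \<omega>)) \<in> borel_measurable N"
  by (rule measurable_galerkin[where M = "\<lambda>_. mat 1" and J = J and w = w and b = b])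
    (simp_all add: assms sym_pos_def_mat_1 oproj_galerkin)

lemma measurable_residual:
  fixes S :: "'n::finite set" and T :: "'d::finite set"
  shows "(\<lambda>h. residual S T h j) \<in> borel_measurable (PiM UNIV (\<lambda>_. borel))"
proof -
  have "(\<lambda>h. oproj (span ((\<lambda>l. restrict_coords S (h l)) ` (T - {j}))) (restrict_coords S (h j)))
      \<in> borel_measurable (PiM UNIV (\<lambda>_. borel))"
    by (rule measurable_oproj[where w = "\<lambda>l h. restrict_coords S (h l)" and b = "\<lambda>h. restrict_coords S (h j)"])
      (simp, rule measurable_row, rule measurable_row)
  then show ?thesis unfolding residual_def by (rule borel_measurable_diff[OF measurable_row])
qed

lemma measurable_dual_row:
  fixes S :: "'n::finite set" and T :: "'d::finite set"
  shows "(\<lambda>h. dual_row S T h j) \<in> borel_measurable (PiM UNIV (\<lambda>_. borel))"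
  unfolding dual_row_def
  by (rule borel_measurable_scaleR[OF borel_measurable_divide[OF borel_measurable_const
        borel_measurable_inner[OF measurable_residual measurable_residual]] measurable_residual])

lemma measurable_leakage:
  fixes S :: "'n::finite set" and T :: "'d::finite set"
  shows "leakage S T \<in> borel_measurable (PiM UNIV (\<lambda>_. borel))"
  unfolding leakage_def[abs_def]
  by (rule borel_measurable_sum, rule borel_measurable_sum,
      rule borel_measurable_power[OF borel_measurable_inner[OF measurable_row measurable_dual_row]])

lemma sets_bad_rows:
  fixes S :: "'n::finite set" and T :: "'d::finite set"
  shows "bad_rows S T \<in> sets (PiM UNIV (\<lambda>_. borel))"
proof -
  let ?P = "PiM UNIV (\<lambda>_. borel) :: ('d \<Rightarrow> real^'n) measure"
  have sp: "space ?P = UNIV" by (simp add: space_PiM)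
  have 1: "{h. residual S T h j = 0} \<in> sets ?P" for j
  proof -
    have "{h. residual S T h j = 0} = (\<lambda>h. residual S T h j) -` {0} \<inter> space ?P"
      unfolding sp by blast
    then show ?thesis using measurable_sets[OF measurable_residual borel_closed[OF closed_singleton]] by metis
  qed
  have 2: "{h. c < leakage S T h} \<in> sets ?P" for c
  proof -
    have "{h. c < leakage S T h} = leakage S T -` {c<..} \<inter> space ?P"
      unfolding sp by blast
    then show ?thesis using measurable_sets[OF measurable_leakage borel_open[OF open_greaterThan]] by metis
  qed
  have "bad_rows S T = (\<Union>j\<in>T. {h. residual S T h j = 0}) \<union> {h. 100 * (real (card T) * real (card (-T))) < leakage S T h}"
    unfolding bad_rows_def by blast
  also have "\<dots> \<in> sets ?P"
    by (rule sets.Un[OF sets.finite_UN 2]) (rule finite, rule 1)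
  finally show ?thesis .
qed

lemma sets_PiM_padded: "sets (PiM UNIV (\<lambda>_. padded_gauss S)) = sets (PiM UNIV (\<lambda>_. borel))"
  by (intro sets_PiM_cong) auto

lemma measurable_PiM_padded:
  "f \<in> measurable (PiM UNIV (\<lambda>_. borel)) N \<Longrightarrow> f \<in> measurable (PiM UNIV (\<lambda>_. padded_gauss S)) N"
  using measurable_cong_sets[OF sets_PiM_padded refl] by blast

lemma restrict_coords_idem: "restrict_coords S (restrict_coords S x) = restrict_coords S x"
  by (simp add: restrict_coords_def vec_eq_iff)

text \<open>
  The other rows in \<open>T\<close> span at most \<open>card T - 1\<close> dimensions, which leaves at least
  three in the coordinates \<open>S\<close>.
\<close>

lemma expected_inverse_residual:
  fixes S :: "'n::finite set" and T :: "'d::finite set"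
  assumes card: "card T + 2 \<le> card S" and j: "j \<in> T"
  shows "(\<integral>\<^sup>+h. inverse (ennreal (residual S T h j \<bullet> residual S T h j)) \<partial>PiM UNIV (\<lambda>_. padded_gauss S)) \<le> 1"
proof -
  have S: "S \<noteq> {}" using card by auto
  have N: "prob_space (padded_gauss S)" by (rule prob_space_padded_gauss[OF S])
  interpret Q: prob_space "PiM UNIV (\<lambda>_::'d. padded_gauss S)" by (rule prob_space_PiM) (rule N)
  have m: "(\<lambda>h. inverse (ennreal (residual S T h j \<bullet> residual S T h j))) \<in> borel_measurable (PiM UNIV (\<lambda>_. padded_gauss S))"
    by (intro measurable_PiM_padded borel_measurable_inverse_ennreal measurable_compose[OF _ measurable_ennreal]
        borel_measurable_inner measurable_residual)
  have inner: "(\<integral>\<^sup>+x. inverse (ennreal (residual S T (h(j := x)) j \<bullet> residual S T (h(j := x)) j)) \<partial>padded_gauss S) \<le> 1" for h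
  proof -
    define U where "U = span ((\<lambda>l. restrict_coords S (h l)) ` (T - {j}))"
    define f where "f = (\<lambda>x. inverse (ennreal ((x - oproj U x) \<bullet> (x - oproj U x))))"
    have "(\<lambda>l. restrict_coords S ((h(j := x)) l)) ` (T - {j}) = (\<lambda>l. restrict_coords S (h l)) ` (T - {j})" for x
      by (intro image_cong) auto
    then have res: "residual S T (h(j := x)) j = restrict_coords S x - oproj U (restrict_coords S x)" for x
      by (simp add: residual_def U_def)
    have om: "(\<lambda>x. oproj U x) \<in> borel_measurable borel"
      unfolding U_def by (rule measurable_oproj[where w = "\<lambda>l _. restrict_coords S (h l)"]) auto
    then have fm: "f \<in> borel_measurable borel"
      unfolding f_def
      by (intro borel_measurable_inverse_ennreal measurable_compose[OF _ measurable_ennreal] borel_measurable_inner borel_measurable_diff) auto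
    have "(\<integral>\<^sup>+x. f (restrict_coords S x) \<partial>padded_gauss S) = (\<integral>\<^sup>+x. f x \<partial>padded_gauss S)"
      unfolding nn_integral_padded_gauss[OF S fm]
        nn_integral_padded_gauss[OF S measurable_compose[OF measurable_restrict_coords fm]]
      by (simp only: restrict_coords_idem)
    also have "\<dots> \<le> 1"
      unfolding f_def
    proof (rule inverse_distance_expectation[OF _ _ _ om])
      show "subspace U" by (simp add: U_def)
      have "subspace {x::real^'n. \<forall>s. s \<notin> S \<longrightarrow> x $ s = 0}" by (auto simp: subspace_def)
      then have "U \<subseteq> {x. \<forall>s. s \<notin> S \<longrightarrow> x $ s = 0}"
        unfolding U_def by (intro span_minimal) (auto simp: restrict_coords_def)
      then show "x $ s = 0" if "x \<in> U" "s \<notin> S" for x s using that by auto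
      have "dim U \<le> card ((\<lambda>l. restrict_coords S (h l)) ` (T - {j}))"
        unfolding U_def dim_span by (rule dim_le_card') simp
      also have "\<dots> \<le> card (T - {j})" by (rule card_image_le) simp
      also have "\<dots> = card T - 1" using j by simp
      finally show "dim U + 3 \<le> card S" using card j card_gt_0_iff[of T] by fastforce
    qed
    finally show ?thesis by (simp add: res f_def)
  qed
  have "(\<integral>\<^sup>+h. inverse (ennreal (residual S T h j \<bullet> residual S T h j)) \<partial>PiM UNIV (\<lambda>_. padded_gauss S))
      \<le> (\<integral>\<^sup>+h. 1 \<partial>PiM UNIV (\<lambda>_::'d. padded_gauss S))"
    unfolding nn_integral_PiM_resample[OF N m, of j] by (intro nn_integral_mono inner)
  also have "\<dots> = 1" using Q.emeasure_space_1 by simp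
  finally show ?thesis .
qed

text \<open>
  Row \<open>i\<close> is independent of the dual row, which depends only on the rows in \<open>T\<close>. Averaging over row \<open>i\<close>
  leaves the squared length of the dual row, an inverse squared distance.
\<close>

lemma expected_leakage_entry:
  fixes S :: "'n::finite set" and T :: "'d::finite set"
  assumes card: "card T + 2 \<le> card S" and j: "j \<in> T" and i: "i \<notin> T"
  shows "(\<integral>\<^sup>+h. ennreal ((restrict_coords S (h i) \<bullet> dual_row S T h j)\<^sup>2) \<partial>PiM UNIV (\<lambda>_. padded_gauss S)) \<le> 1"
proof -
  have S: "S \<noteq> {}" using card by auto
  have N: "prob_space (padded_gauss S)" by (rule prob_space_padded_gauss[OF S])
  have m: "(\<lambda>h. ennreal ((restrict_coords S (h i) \<bullet> dual_row S T h j)\<^sup>2)) \<in> borel_measurable (PiM UNIV (\<lambda>_. padded_gauss S))"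
    by (intro measurable_PiM_padded measurable_compose[OF _ measurable_ennreal] borel_measurable_power
        borel_measurable_inner measurable_row measurable_dual_row)
  have inner: "(\<integral>\<^sup>+x. ennreal ((restrict_coords S ((h(i := x)) i) \<bullet> dual_row S T (h(i := x)) j)\<^sup>2) \<partial>padded_gauss S)
      \<le> inverse (ennreal (residual S T h j \<bullet> residual S T h j))" for h
  proof -
    let ?w = "dual_row S T h j" and ?r = "residual S T h j"
    have ne: "l \<noteq> i" if "l \<in> T" for l using that i by auto
    have "(\<lambda>l. restrict_coords S ((h(i := x)) l)) ` (T - {j}) = (\<lambda>l. restrict_coords S (h l)) ` (T - {j})" for x
      using ne by (intro image_cong) auto
    then have dual: "dual_row S T (h(i := x)) j = ?w" for x
      using ne[OF j] by (simp add: dual_row_def residual_def)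
    have "(\<integral>\<^sup>+x. ennreal ((restrict_coords S ((h(i := x)) i) \<bullet> dual_row S T (h(i := x)) j)\<^sup>2) \<partial>padded_gauss S)
        = (\<integral>\<^sup>+x. ennreal ((x \<bullet> restrict_coords S ?w)\<^sup>2) \<partial>padded_gauss S)"
      by (simp only: dual fun_upd_same restrict_coords_inner)
    also have "\<dots> \<le> ennreal (restrict_coords S ?w \<bullet> restrict_coords S ?w)"
      by (rule nn_integral_padded_gauss_inner_sq[OF S])
    also have "\<dots> \<le> ennreal (?w \<bullet> ?w)"
      unfolding inner_vec_def restrict_coords_def by (intro ennreal_leI sum_mono) auto
    also have "\<dots> \<le> inverse (ennreal (?r \<bullet> ?r))"
    proof (cases "?r = 0")
      case False
      then have "0 < ?r \<bullet> ?r" by simp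
      then show ?thesis by (simp add: dual_row_def inverse_ennreal inverse_eq_divide)
    qed simp
    finally show ?thesis .
  qed
  have "(\<integral>\<^sup>+h. ennreal ((restrict_coords S (h i) \<bullet> dual_row S T h j)\<^sup>2) \<partial>PiM UNIV (\<lambda>_. padded_gauss S))
      \<le> (\<integral>\<^sup>+h. inverse (ennreal (residual S T h j \<bullet> residual S T h j)) \<partial>PiM UNIV (\<lambda>_. padded_gauss S))"
    unfolding nn_integral_PiM_resample[OF N m, of i] by (intro nn_integral_mono inner)
  also have "\<dots> \<le> 1" by (rule expected_inverse_residual[OF card j])
  finally show ?thesis .
qed

text \<open>
  The residuals vanish with probability 0 because their inverse squares have finite expectation; the
  leakage has expectation at most \<open>r (d - r)\<close>, and Markov's inequality loses the factor 100.
\<close>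

lemma measure_bad_rows:
  fixes S :: "'n::finite set" and T :: "'d::finite set"
  assumes card: "card T + 2 \<le> card S"
  shows "measure (PiM UNIV (\<lambda>_. padded_gauss S)) (bad_rows S T) \<le> 1 / 100"
proof -
  let ?Q = "PiM UNIV (\<lambda>_::'d. padded_gauss S)"
  have S: "S \<noteq> {}" using card by auto
  have N: "prob_space (padded_gauss S)" by (rule prob_space_padded_gauss[OF S])
  interpret Q: prob_space ?Q by (rule prob_space_PiM) (rule N)
  have spQ: "space ?Q = UNIV" by (simp add: space_PiM)
  define a where "a = real (card T) * real (card (-T))"
  have a: "0 \<le> a" by (simp add: a_def)
  have bm: "bad_rows S T \<in> sets ?Q" using sets_bad_rows by (simp add: sets_PiM_padded)
  have ae: "AE h in ?Q. \<forall>j\<in>T. residual S T h j \<noteq> 0"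
  proof -
    have "AE h in ?Q. residual S T h j \<noteq> 0" if j: "j \<in> T" for j
    proof -
      have "AE h in ?Q. inverse (ennreal (residual S T h j \<bullet> residual S T h j)) \<noteq> \<infinity>"
      proof (rule nn_integral_PInf_AE)
        show "(\<lambda>h. inverse (ennreal (residual S T h j \<bullet> residual S T h j))) \<in> borel_measurable ?Q"
          by (intro measurable_PiM_padded borel_measurable_inverse_ennreal measurable_compose[OF _ measurable_ennreal]
              borel_measurable_inner measurable_residual)
        show "(\<integral>\<^sup>+h. inverse (ennreal (residual S T h j \<bullet> residual S T h j)) \<partial>?Q) \<noteq> \<infinity>"
          using expected_inverse_residual[OF card j] by (auto simp: top_unique)
      qed
      then show ?thesis by eventually_elim auto
    qed
    then show ?thesis by (simp add: AE_finite_all)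
  qed
  have El: "(\<integral>\<^sup>+h. ennreal (leakage S T h) \<partial>?Q) \<le> ennreal a"
  proof -
    have em: "(\<lambda>h. ennreal ((restrict_coords S (h i) \<bullet> dual_row S T h j)\<^sup>2)) \<in> borel_measurable ?Q" for i j
      by (intro measurable_PiM_padded measurable_compose[OF _ measurable_ennreal] borel_measurable_power
          borel_measurable_inner measurable_row measurable_dual_row)
    have "(\<integral>\<^sup>+h. ennreal (leakage S T h) \<partial>?Q)
        = (\<integral>\<^sup>+h. (\<Sum>i\<in>-T. \<Sum>j\<in>T. ennreal ((restrict_coords S (h i) \<bullet> dual_row S T h j)\<^sup>2)) \<partial>?Q)"
      unfolding leakage_def by (simp add: sum_nonneg)
    also have "\<dots> = (\<Sum>i\<in>-T. \<Sum>j\<in>T. \<integral>\<^sup>+h. ennreal ((restrict_coords S (h i) \<bullet> dual_row S T h j)\<^sup>2) \<partial>?Q)"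
      by (subst nn_integral_sum) (intro borel_measurable_sum em sum.cong refl nn_integral_sum)+
    also have "\<dots> \<le> (\<Sum>i\<in>-T. \<Sum>j\<in>T. 1)"
      by (intro sum_mono expected_leakage_entry[OF card]) auto
    also have "\<dots> = ennreal a"
      by (simp add: a_def ennreal_mult ennreal_of_nat_eq_real_of_nat mult.commute)
    finally show ?thesis .
  qed
  have "emeasure ?Q (bad_rows S T) \<le> ennreal (1 / 100)"
  proof (cases "a = 0")
    case True
    then have "T = {} \<or> - T = {}" by (simp add: a_def)
    then have l0: "leakage S T h = 0" for h by (auto simp: leakage_def)
    have "{h \<in> space ?Q. \<not> (\<forall>j\<in>T. residual S T h j \<noteq> 0)} = bad_rows S T"
      unfolding bad_rows_def a_def[symmetric] l0 True spQ by simp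
    from AE_iff_measurable[OF bm this] ae have "emeasure ?Q (bad_rows S T) = 0" by simp
    then show ?thesis by simp
  next
    case False
    with a have a0: "0 < a" by simp
    have "emeasure ?Q (bad_rows S T) \<le> emeasure ?Q {h \<in> space ?Q. 1 \<le> ennreal (1 / (100 * a)) * ennreal (leakage S T h)}"
    proof (rule emeasure_mono_AE)
      show "AE h in ?Q. h \<in> bad_rows S T \<longrightarrow> h \<in> {h \<in> space ?Q. 1 \<le> ennreal (1 / (100 * a)) * ennreal (leakage S T h)}"
        using ae
      proof eventually_elim
        case (elim h)
        show ?case
        proof
          assume "h \<in> bad_rows S T"
          then have "100 * a < leakage S T h" using elim by (auto simp: bad_rows_def a_def)
          then have "1 \<le> 1 / (100 * a) * leakage S T h" using a0 by (simp add: field_simps)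
          then have "ennreal 1 \<le> ennreal (1 / (100 * a) * leakage S T h)" by (rule ennreal_leI)
          also have "\<dots> = ennreal (1 / (100 * a)) * ennreal (leakage S T h)"
            using a0 by (intro ennreal_mult') simp
          finally show "h \<in> {h \<in> space ?Q. 1 \<le> ennreal (1 / (100 * a)) * ennreal (leakage S T h)}"
            by (simp add: spQ)
        qed
      qed
      have lm: "(\<lambda>h. ennreal (1 / (100 * a)) * ennreal (leakage S T h)) \<in> borel_measurable ?Q"
        by (intro borel_measurable_times_ennreal borel_measurable_const measurable_PiM_padded
            measurable_compose[OF measurable_leakage measurable_ennreal])
      have "(\<lambda>h. ennreal (1 / (100 * a)) * ennreal (leakage S T h)) -` {1..} \<inter> space ?Q \<in> sets ?Q"
        by (rule measurable_sets[OF lm]) simp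
      then show "{h \<in> space ?Q. 1 \<le> ennreal (1 / (100 * a)) * ennreal (leakage S T h)} \<in> sets ?Q"
        by (simp add: spQ vimage_def)
    qed
    also have "\<dots> \<le> ennreal (1 / (100 * a)) * (\<integral>\<^sup>+h. ennreal (leakage S T h) * indicator (space ?Q) h \<partial>?Q)"
    proof (rule nn_integral_Markov_inequality)
      show "(\<lambda>h. ennreal (leakage S T h) * indicator (space ?Q) h) \<in> borel_measurable ?Q"
        by (simp add: spQ measurable_PiM_padded measurable_compose[OF measurable_leakage measurable_ennreal])
    qed simp
    also have "\<dots> \<le> ennreal (1 / (100 * a)) * ennreal a"
      using El by (intro mult_left_mono) (simp_all add: spQ)
    also have "\<dots> = ennreal (1 / 100)" using a0 by (simp add: ennreal_mult'[symmetric])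
    finally show ?thesis .
  qed
  then show ?thesis by (simp add: Q.emeasure_eq_measure)
qed

text \<open>
  The entries of a dual row are the coefficients of a combination of the sketch vectors, and inner
  products of rows with dual rows are eigencoordinates of these combinations.
\<close>

lemma dual_combinations_of_good_rows:
  fixes S :: "'n::finite set" and T :: "'d::finite set" and V :: "'d \<Rightarrow> real^'d" and c :: "'n \<Rightarrow> real^'d"
  assumes good: "(\<lambda>i. pad S (\<lambda>s. V i \<bullet> c s)) \<notin> bad_rows S T"
  obtains y where "\<And>j. j \<in> T \<Longrightarrow> y j \<in> span (c ` S)"
    "\<And>i j. i \<in> T \<Longrightarrow> j \<in> T \<Longrightarrow> V i \<bullet> y j = of_bool (i = j)"
    "(\<Sum>i\<in>-T. \<Sum>j\<in>T. (V i \<bullet> y j)\<^sup>2) \<le> 100 * (real (card T) * real (card (-T)))"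
proof -
  define h where "h = (\<lambda>i. pad S (\<lambda>s. V i \<bullet> c s))"
  have h: "h \<notin> bad_rows S T" using good by (simp add: h_def)
  have rh: "restrict_coords S (h i) = h i" for i
    by (simp add: h_def restrict_coords_def pad_def vec_eq_iff)
  define w where "w = (\<lambda>j. dual_row S T h j)"
  define y where "y = (\<lambda>j. \<Sum>s\<in>S. (w j $ s) *\<^sub>R c s)"
  have Vy: "V i \<bullet> y j = h i \<bullet> w j" for i j
  proof -
    have "h i \<bullet> w j = (\<Sum>s\<in>UNIV. if s \<in> S then (V i \<bullet> c s) * w j $ s else 0)"
      unfolding inner_vec_def h_def pad_def by (intro sum.cong) auto
    also have "\<dots> = (\<Sum>s\<in>S. (V i \<bullet> c s) * w j $ s)" by (simp add: sum.If_cases)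
    finally show ?thesis by (simp add: y_def inner_sum_right mult.commute)
  qed
  show ?thesis
  proof (rule that)
    show "y j \<in> span (c ` S)" for j
      unfolding y_def by (intro span_sum span_scale span_base) auto
    show "V i \<bullet> y j = of_bool (i = j)" if i: "i \<in> T" and j: "j \<in> T" for i j
    proof -
      let ?U = "span ((\<lambda>l. restrict_coords S (h l)) ` (T - {j}))"
      let ?r = "residual S T h j"
      have r: "?r = h j - oproj ?U (h j)" by (simp add: residual_def rh)
      have r0: "?r \<bullet> ?r \<noteq> 0" using h j by (auto simp: bad_rows_def)
      have U: "?r \<bullet> u = 0" if "u \<in> ?U" for u
        unfolding r by (rule oproj_decomposition(2)[OF subspace_span that])
      have "h i \<bullet> ?r = of_bool (i = j) * (?r \<bullet> ?r)"
      proof (cases "i = j")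
        case True
        have "?r \<bullet> oproj ?U (h j) = 0" by (intro U oproj_decomposition(1) subspace_span)
        moreover have "h j = ?r + oproj ?U (h j)" by (simp add: r)
        ultimately have "?r \<bullet> h j = ?r \<bullet> ?r" by (metis add.right_neutral inner_add_right)
        then show ?thesis using True by (simp add: inner_commute)
      next
        case False
        then have "h i \<in> ?U" using i rh[of i] by (metis Diff_iff image_eqI singletonD span_base)
        from U[OF this] show ?thesis using False by (simp add: inner_commute)
      qed
      then show ?thesis using r0 by (simp add: Vy w_def dual_row_def)
    qed
    have "leakage S T h = (\<Sum>i\<in>-T. \<Sum>j\<in>T. (V i \<bullet> y j)\<^sup>2)"
      by (simp add: leakage_def rh Vy w_def)
    then show "(\<Sum>i\<in>-T. \<Sum>j\<in>T. (V i \<bullet> y j)\<^sup>2) \<le> 100 * (real (card T) * real (card (-T)))"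
      using h by (auto simp: bad_rows_def not_less)
  qed
qed

section \<open>Independent groups of Gaussian vectors\<close>

lemma (in prob_space) indep_vars_reindex:
  assumes e: "inj_on e S" "e ` S \<subseteq> I" and ind: "indep_vars (\<lambda>_. N) X I"
  shows "indep_vars (\<lambda>_. N) (\<lambda>s. X (e s)) S"
proof -
  let ?F = "\<lambda>i. sigma_sets (space M) {X i -` A \<inter> space M |A. A \<in> sets N}"
  have rv: "\<And>i. i \<in> I \<Longrightarrow> random_variable N (X i)" and sets: "\<And>i. i \<in> I \<Longrightarrow> ?F i \<subseteq> events"
    and pr: "\<And>J A. J \<subseteq> I \<Longrightarrow> J \<noteq> {} \<Longrightarrow> finite J \<Longrightarrow> A \<in> Pi J ?F \<Longrightarrow> prob (\<Inter>j\<in>J. A j) = (\<Prod>j\<in>J. prob (A j))"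
    using ind unfolding indep_vars_def indep_sets_def by auto
  show ?thesis
    unfolding indep_vars_def indep_sets_def
  proof (intro conjI ballI allI impI)
    fix J A assume J: "J \<subseteq> S" "J \<noteq> {}" "finite J" and A: "A \<in> Pi J (\<lambda>s. ?F (e s))"
    have inj: "inj_on e J" using e(1) J(1) inj_on_subset by blast
    define B where "B = (\<lambda>k. A (inv_into J e k))"
    have B: "B (e s) = A s" if "s \<in> J" for s using inj that by (simp add: B_def)
    have "prob (\<Inter>k\<in>e ` J. B k) = (\<Prod>k\<in>e ` J. prob (B k))"
      using J A e(2) B by (intro pr) auto
    then show "prob (\<Inter>s\<in>J. A s) = (\<Prod>s\<in>J. prob (A s))"
      using B by (simp add: prod.reindex[OF inj] cong: INF_cong prod.cong)
  qed (use rv sets e(2) in auto)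
qed

lemma measurable_sketch_rows:
  fixes V :: "'d \<Rightarrow> real^'d" and S :: "'n::finite set"
  assumes "\<And>s. s \<in> S \<Longrightarrow> e s \<in> K"
  shows "(\<lambda>f i. pad S (\<lambda>s. V i \<bullet> f (e s))) \<in> measurable (PiM K (\<lambda>_. borel)) (PiM UNIV (\<lambda>_::'d. borel))"
proof -
  have "(\<lambda>f. pad S (\<lambda>s. V i \<bullet> f (e s))) \<in> borel_measurable (PiM K (\<lambda>_. borel))" for i
    unfolding pad_def
  proof (intro measurable_vec_lambda)
    fix s
    show "(\<lambda>f. if s \<in> S then V i \<bullet> f (e s) else 0) \<in> borel_measurable (PiM K (\<lambda>_. borel))"
      using assms[of s] by (cases "s \<in> S") (auto intro!: borel_measurable_inner measurable_component_singleton)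
  qed
  then have "(\<lambda>f. \<lambda>i\<in>UNIV. pad S (\<lambda>s. V i \<bullet> f (e s))) \<in> measurable (PiM K (\<lambda>_. borel)) (PiM UNIV (\<lambda>_::'d. borel))"
    by (intro measurable_restrict)
  then show ?thesis by (simp add: restrict_def)
qed

text \<open>
  The vectors are the columns of a matrix with independent standard normal entries; here the entries
  are regrouped by rows.
\<close>

lemma (in prob_space) distr_sketch_rows:
  fixes V :: "'d::finite \<Rightarrow> real^'d" and S :: "'n::finite set"
  assumes V: "orthonormal_family V" and S: "S \<noteq> {}"
    and ind: "indep_vars (\<lambda>_. borel) c S" and g: "\<And>s. s \<in> S \<Longrightarrow> std_gaussian_vector (c s)"
  shows "distr M (PiM UNIV (\<lambda>_. borel)) (\<lambda>\<omega> i. pad S (\<lambda>s. V i \<bullet> c s \<omega>)) = PiM UNIV (\<lambda>_. padded_gauss S)"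
proof -
  define h where "h = (\<lambda>(i, s) \<omega>. V i \<bullet> c s \<omega>)"
  have iid: "iid_std_normal h (UNIV \<times> S)"
    unfolding h_def by (rule iid_rotated_coordinates[OF V _ S ind g]) auto
  have hind: "indep_vars (\<lambda>_. borel) h (UNIV \<times> S)" using iid by (simp add: iid_std_normal_def)
  define R where "R = (\<lambda>i \<omega>. pad S (\<lambda>s. h (i, s) \<omega>))"
  have row: "distr M borel (R i) = padded_gauss S" for i
  proof -
    have "iid_std_normal (\<lambda>s. h (i, s)) S"
      using iid indep_vars_reindex[of "Pair i" S "UNIV \<times> S" borel h]
      by (auto simp: iid_std_normal_def inj_on_def)
    then show ?thesis unfolding R_def by (rule distr_pad[OF _ S])
  qed
  have "indep_vars (\<lambda>i. PiM ({i} \<times> S) (\<lambda>_. borel)) (\<lambda>i \<omega>. restrict (\<lambda>p. h p \<omega>) ({i} \<times> S)) UNIV"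
    by (rule indep_vars_restrict[OF hind]) (auto simp: disjoint_family_on_def)
  then have "indep_vars (\<lambda>_. borel) (\<lambda>i \<omega>. (\<lambda>f. pad S (\<lambda>s. f (i, s))) (restrict (\<lambda>p. h p \<omega>) ({i} \<times> S))) UNIV"
  proof (rule indep_vars_compose2)
    fix i :: 'd
    show "(\<lambda>f. pad S (\<lambda>s. f (i, s))) \<in> borel_measurable (PiM ({i} \<times> S) (\<lambda>_. borel))"
      unfolding pad_def
    proof (intro measurable_vec_lambda)
      fix s show "(\<lambda>f. if s \<in> S then f (i, s) else 0) \<in> borel_measurable (PiM ({i} \<times> S) (\<lambda>_. borel))"
        by (cases "s \<in> S") (auto intro!: measurable_component_singleton)
    qed
  qed
  moreover have "(\<lambda>i \<omega>. (\<lambda>f. pad S (\<lambda>s. f (i, s))) (restrict (\<lambda>p. h p \<omega>) ({i} \<times> S))) = R"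
    by (auto simp: R_def pad_def fun_eq_iff vec_eq_iff)
  ultimately have Rind: "indep_vars (\<lambda>_. borel) R UNIV" by simp
  have "distr M (PiM UNIV (\<lambda>_. borel)) (\<lambda>\<omega>. \<lambda>i\<in>UNIV. R i \<omega>) = PiM UNIV (\<lambda>i. distr M borel (R i))"
    using Rind indep_vars_iff_distr_eq_PiM'[OF UNIV_not_empty, where X = R and M' = "\<lambda>_. borel"]
    by (auto simp: indep_vars_def)
  then show ?thesis unfolding row by (simp add: R_def h_def restrict_def)
qed

theorem (in prob_space) prob_all_groups_bad:
  fixes V :: "'d::finite \<Rightarrow> real^'d" and S :: "'n::finite set" and e :: "nat \<Rightarrow> 'n \<Rightarrow> 'k"
  assumes V: "orthonormal_family V" and card: "card T + 2 \<le> card S"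
    and ind: "indep_vars (\<lambda>_. borel) b I" and g: "\<And>k. k \<in> I \<Longrightarrow> std_gaussian_vector (b k)"
    and q: "0 < q" and e: "inj_on (\<lambda>(l, s). e l s) ({..<q} \<times> S)" "\<And>l s. l < q \<Longrightarrow> s \<in> S \<Longrightarrow> e l s \<in> I"
  shows "prob {\<omega> \<in> space M. \<forall>l<q. (\<lambda>i. pad S (\<lambda>s. V i \<bullet> b (e l s) \<omega>)) \<in> bad_rows S T} \<le> (1 / 100) ^ q"
    "{\<omega> \<in> space M. \<forall>l<q. (\<lambda>i. pad S (\<lambda>s. V i \<bullet> b (e l s) \<omega>)) \<in> bad_rows S T} \<in> events"
proof -
  have S: "S \<noteq> {}" using card by auto
  let ?P = "PiM UNIV (\<lambda>_. borel) :: ('d \<Rightarrow> real^'n) measure"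
  define X where "X = (\<lambda>l \<omega> i. pad S (\<lambda>s. V i \<bullet> b (e l s) \<omega>))"
  have inje: "inj_on (e l) S" if "l < q" for l
    using e(1) that by (auto simp: inj_on_def)
  have disj: "disjoint_family_on (\<lambda>l. e l ` S) {..<q}"
    using e(1) by (fastforce simp: disjoint_family_on_def inj_on_def)
  have "indep_vars (\<lambda>l. PiM (e l ` S) (\<lambda>_. borel)) (\<lambda>l \<omega>. restrict (\<lambda>k. b k \<omega>) (e l ` S)) {..<q}"
    by (rule indep_vars_restrict[OF ind]) (use e(2) disj in auto)
  then have "indep_vars (\<lambda>_. ?P) (\<lambda>l \<omega>. (\<lambda>f i. pad S (\<lambda>s. V i \<bullet> f (e l s))) (restrict (\<lambda>k. b k \<omega>) (e l ` S))) {..<q}"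
    by (rule indep_vars_compose2) (rule measurable_sketch_rows, auto)
  moreover have "(\<lambda>l \<omega>. (\<lambda>f i. pad S (\<lambda>s. V i \<bullet> f (e l s))) (restrict (\<lambda>k. b k \<omega>) (e l ` S))) = X"
    by (auto simp: X_def pad_def fun_eq_iff vec_eq_iff)
  ultimately have Xind: "indep_vars (\<lambda>_. ?P) X {..<q}" by simp
  then have Xm: "X l \<in> measurable M ?P" if "l < q" for l using that by (auto simp: indep_vars_def)
  have one: "prob (X l -` bad_rows S T \<inter> space M) \<le> 1 / 100" if l: "l < q" for l
  proof -
    have "indep_vars (\<lambda>_. borel) (\<lambda>s. b (e l s)) S"
      by (rule indep_vars_reindex[OF inje[OF l] _ ind]) (use e(2) l in auto)
    then have d: "distr M ?P (X l) = PiM UNIV (\<lambda>_. padded_gauss S)"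
      unfolding X_def by (rule distr_sketch_rows[OF V S]) (use g e(2) l in auto)
    have "prob (X l -` bad_rows S T \<inter> space M) = measure (distr M ?P (X l)) (bad_rows S T)"
      by (rule measure_distr[OF Xm[OF l] sets_bad_rows, symmetric])
    also have "\<dots> \<le> 1 / 100" unfolding d by (rule measure_bad_rows[OF card])
    finally show ?thesis .
  qed
  have eq: "{\<omega> \<in> space M. \<forall>l<q. X l \<omega> \<in> bad_rows S T} = (\<Inter>l\<in>{..<q}. X l -` bad_rows S T \<inter> space M)"
    using q by auto
  have "prob (\<Inter>l\<in>{..<q}. X l -` bad_rows S T \<inter> space M) = (\<Prod>l\<in>{..<q}. prob (X l -` bad_rows S T \<inter> space M))"
    by (rule indep_varsD_finite[OF Xind]) (use q sets_bad_rows in auto)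
  also have "\<dots> \<le> (\<Prod>l\<in>{..<q}. 1 / 100)" by (intro prod_mono) (use one in auto)
  finally show "prob {\<omega> \<in> space M. \<forall>l<q. (\<lambda>i. pad S (\<lambda>s. V i \<bullet> b (e l s) \<omega>)) \<in> bad_rows S T} \<le> (1 / 100) ^ q"
    using eq by (simp add: X_def)
  have "(\<Inter>l\<in>{..<q}. X l -` bad_rows S T \<inter> space M) \<in> events"
    using q measurable_sets[OF Xm sets_bad_rows] by (intro sets.finite_INT) auto
  then show "{\<omega> \<in> space M. \<forall>l<q. (\<lambda>i. pad S (\<lambda>s. V i \<bullet> b (e l s) \<omega>)) \<in> bad_rows S T} \<in> events"
    by (simp only: eq[symmetric]) (simp only: X_def)
qed

section \<open>The error of the block-Lanczos square root\<close>

lemma bcg_optimal: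
  assumes A: "sym_pos_def A" and \<mu>: "0 \<le> \<mu>" and x: "x \<in> krylov_space A (b ` {1..m}) t"
  defines "M \<equiv> shifted_matrix A \<mu>"
  shows "weighted_norm M (matrix_inv M *v b i - bcg A m b t i \<mu>) \<le> weighted_norm M (matrix_inv M *v b i - x)"
proof -
  have M: "sym_pos_def M" unfolding M_def by (rule sym_pos_def_shifted[OF A \<mu>])
  have "galerkin M (krylov_space A (b ` {1..m}) t) (b i) (bcg A m b t i \<mu>)"
    unfolding M_def by (rule bcg_galerkin[OF A \<mu>])
  from galerkin_energy[OF M subspace_krylov_space this x] sym_pos_defD(3)[OF M]
  show ?thesis by (simp add: weighted_norm_def)
qed

text \<open>
  If \<open>t\<close> leaves no room for the power steps, the claimed bound on the energy error exceeds the error of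
  the zero vector. Otherwise the approximation from the Krylov space applies, since block CG is
  optimal there, and its rate is worst at \<open>\<mu> = 0\<close>.
\<close>

theorem bsq_error_bound:
  fixes A :: "real^'d^'d" and V :: "'d \<Rightarrow> real^'d" and b :: "nat \<Rightarrow> real^'d"
  assumes A: "sym_pos_def A" and V: "orthonormal_family V" "\<And>i. A *v V i = evl i *\<^sub>R V i"
    and lo: "0 < lo" "\<And>i. lo \<le> evl i" and l: "\<And>i. i \<notin> T \<Longrightarrow> evl i \<le> l" "lo \<le> l" and hi: "\<And>i. evl i \<le> hi"
    and dual: "\<And>i j. i \<in> T \<Longrightarrow> j \<in> T \<Longrightarrow> V i \<bullet> y j = of_bool (i = j)"
    and small: "(\<Sum>i\<in>-T. \<Sum>j\<in>T. (V i \<bullet> y j)\<^sup>2) \<le> 25 * (real CARD('d))\<^sup>2"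
    and yF: "\<And>j. j \<in> T \<Longrightarrow> y j \<in> span (b ` {1..m})" and i: "i \<in> {1..m}"
  shows "norm (matrix_sqrt A *v b i - bsq A m b t i)
    \<le> ln (16 * (hi / lo)) * exp (- ((real t - (2 + ln (real CARD('d)) / 2)) / (3 * sqrt (l / lo)))) * (sqrt hi * norm (b i))"
proof -
  define d where "d = real CARD('d)"
  have d: "1 \<le> d" by (simp add: d_def Suc_le_eq)
  \<comment> \<open>the largest number of power steps with \<open>p + 1 \<le> 2 + (log d) / 2\<close>\<close>
  define p where "p = nat \<lfloor>ln d / 2\<rfloor> + 1"
  have ln0: "0 \<le> ln d" using d by simp
  have "real p = of_int \<lfloor>ln d / 2\<rfloor> + 1" unfolding p_def using ln0 by simp
  then have pl: "ln d / 2 \<le> real p" and pu: "real p \<le> 1 + ln d / 2" by linarith+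
  have "d\<^sup>2 = exp (2 * ln d)" using d by (simp add: exp_double)
  also have "\<dots> \<le> exp (4 * real p)" using pl by simp
  finally have p: "d\<^sup>2 \<le> exp (4 * real p)" .
  have pos: "0 < evl i" for i using lo(1) lo(2)[of i] by simp
  have l0: "0 < l" using lo(1) l(2) by simp
  define E where "E = exp (- ((real t - (2 + ln d / 2)) / (3 * sqrt (l / lo))))"
  have sq: "0 < sqrt (l / lo)" using lo(1) l0 by simp
  let ?K = "krylov_space A (b ` {1..m}) t"
  have err: "weighted_norm (shifted_matrix A \<mu>) (matrix_inv (shifted_matrix A \<mu>) *v b i - bcg A m b t i \<mu>)
      \<le> 2 * E * weighted_norm (shifted_matrix A \<mu>) (matrix_inv (shifted_matrix A \<mu>) *v b i)" if \<mu>: "0 \<le> \<mu>" for \<mu>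
  proof -
    define M where "M = shifted_matrix A \<mu>"
    have M: "sym_pos_def M" unfolding M_def by (rule sym_pos_def_shifted[OF A \<mu>])
    define g where "g = weighted_norm M (matrix_inv M *v b i)"
    have g: "0 \<le> g" by (simp add: g_def weighted_norm_def sym_pos_defD(3)[OF M])
    have opt: "weighted_norm M (matrix_inv M *v b i - bcg A m b t i \<mu>) \<le> weighted_norm M (matrix_inv M *v b i - x)"
      if "x \<in> ?K" for x unfolding M_def by (rule bcg_optimal[OF A \<mu> that])
    have "weighted_norm M (matrix_inv M *v b i - bcg A m b t i \<mu>) \<le> 2 * E * g"
    proof (cases "Suc p \<le> t")
      case False
      have "weighted_norm M (matrix_inv M *v b i - bcg A m b t i \<mu>) \<le> g"
        using opt[OF subspace_0[OF subspace_krylov_space]] by (simp add: g_def)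
      also have "g \<le> 2 * E * g"
      proof -
        have "real t - (2 + ln d / 2) \<le> 0" using False pu by linarith
        then have "(real t - (2 + ln d / 2)) / (3 * sqrt (l / lo)) \<le> 0" using sq by (intro divide_nonpos_pos) auto
        then have "1 \<le> E" by (simp add: E_def)
        then have "1 * g \<le> (2 * E) * g" using g by (intro mult_right_mono) auto
        then show ?thesis by simp
      qed
      finally show ?thesis .
    next
      case True
      define k where "k = t - Suc p"
      have t: "t = Suc p + k" using True by (simp add: k_def)
      have kb: "real t - (2 + ln d / 2) \<le> real k" using t pu by simp
      obtain x where x: "x \<in> ?K" "weighted_norm M (matrix_inv M *v b i - x)
          \<le> 2 * exp (- (real k / (3 * sqrt ((l + \<mu>) / (lo + \<mu>))))) * g"
        using block_krylov_approximation[where F = "b ` {1..m}" and b = "b i" and k = k and \<mu> = \<mu> and D = d and p = p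
            and y = y and T = T and l = l and lo = lo, OF A V pos \<mu> l(1) lo l(2) dual small[folded d_def] p yF] i
        unfolding t M_def g_def by blast
      have "weighted_norm M (matrix_inv M *v b i - bcg A m b t i \<mu>) \<le> 2 * exp (- (real k / (3 * sqrt ((l + \<mu>) / (lo + \<mu>))))) * g"
        using opt[OF x(1)] x(2) by simp
      also have "\<dots> \<le> 2 * E * g"
      proof -
        have "(l + \<mu>) / (lo + \<mu>) \<le> l / lo"
        proof -
          have "lo * \<mu> \<le> l * \<mu>" using l(2) \<mu> by (rule mult_right_mono)
          then have "(l + \<mu>) * lo \<le> l * (lo + \<mu>)" by (simp add: algebra_simps)
          then show ?thesis using lo(1) \<mu> by (simp add: divide_simps mult.commute)
        qed
        then have "sqrt ((l + \<mu>) / (lo + \<mu>)) \<le> sqrt (l / lo)" by (rule real_sqrt_le_mono)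
        moreover have "0 < sqrt ((l + \<mu>) / (lo + \<mu>))" using l0 lo(1) \<mu> by simp
        ultimately have "real k / (3 * sqrt (l / lo)) \<le> real k / (3 * sqrt ((l + \<mu>) / (lo + \<mu>)))"
          using sq by (intro divide_left_mono) auto
        moreover have "(real t - (2 + ln d / 2)) / (3 * sqrt (l / lo)) \<le> real k / (3 * sqrt (l / lo))"
          using kb sq by (intro divide_right_mono) auto
        ultimately have "exp (- (real k / (3 * sqrt ((l + \<mu>) / (lo + \<mu>))))) \<le> E"
          by (simp add: E_def)
        then show ?thesis using g by (intro mult_right_mono) auto
      qed
      finally show ?thesis .
    qed
    then show ?thesis by (simp add: M_def g_def)
  qed
  have meas: "(\<lambda>z. bcg A m b t i (z\<^sup>2)) \<in> borel_measurable borel"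
    using measurable_bcg[OF A, of m "\<lambda>k _. b k" borel i "\<lambda>z. z" t] i by simp
  have "norm (matrix_sqrt A *v b i - (2 / pi) *\<^sub>R (LBINT z=0..\<infinity>. A *v bcg A m b t i (z\<^sup>2)))
      \<le> ln (16 * (hi / lo)) * E * (sqrt hi * norm (b i))"
    by (rule sqrt_error_from_shifted_errors[OF A V lo hi _ err meas]) (simp add: E_def)
  then show ?thesis by (simp add: bsq_def E_def d_def)
qed

theorem theorem5p3:
  fixes A :: "real^'d^'d"
    and lam :: "nat \<Rightarrow> real"
    and M :: "'w measure"
    and b :: "nat \<Rightarrow> 'w \<Rightarrow> real^'d"
    and r m t :: nat
    and \<delta> :: real
  assumes "sym_pos_def A"
    and "ordered_eigenvalues A lam"
    and "prob_space M"
    and "prob_space.indep_vars M (\<lambda>_. borel) b {1..m}"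
    and "\<forall>i\<in>{1..m}. prob_space.std_gaussian_vector M (b i)"
    and "0 < \<delta>" and "\<delta> < 1"
    and "r < CARD('d)"
    and "real r \<le> (real m - 1) * inverse (of_int \<lceil>ln (real m / \<delta>) / ln 100\<rceil>) - 2"
  shows "\<P>(\<omega> in M. \<forall>i\<in>{1..m}.
            norm (matrix_sqrt A *v b i \<omega> - bsq A m (\<lambda>k. b k \<omega>) t i)
              / (spectral_norm (matrix_sqrt A) * norm (b i \<omega>))
            \<le> ln (16 * shifted_cond CARD('d) lam 1 0)
               * exp (- ((real t - (2 + ln (real CARD('d)) / 2))
                         / (3 * sqrt (shifted_cond CARD('d) lam (r + 1) 0)))))
          \<ge> 1 - \<delta>"
proof -
  interpret prob_space M by (rule assms(3))
  note A = assms(1)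
  define d where "d = CARD('d)"
  have d: "1 \<le> d" by (simp add: d_def Suc_le_eq)
  obtain V :: "'d \<Rightarrow> real^'d" and evl where V: "orthonormal_family V" "\<And>i. A *v V i = evl i *\<^sub>R V i"
    and pos: "\<And>i. evl i > 0"
    by (rule sym_pos_def_eigenbasis[OF A]) (rule that)
  obtain \<sigma> where \<sigma>': "bij_betw \<sigma> {1..CARD('d)} (UNIV :: 'd set)"
      "\<And>k. k \<in> {1..CARD('d)} \<Longrightarrow> evl (\<sigma> k) = lam k"
    by (rule ordered_eigenvalues_enumerate[OF V assms(2)]) (rule that)
  note \<sigma> = \<sigma>'[folded d_def]
  have mono: "lam k \<le> lam j" if "j \<in> {1..d}" "k \<in> {1..d}" "j \<le> k" for j k
    using assms(2) that unfolding ordered_eigenvalues_def d_def by blast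
  define T where "T = \<sigma> ` {1..r}"
  have rd: "r < d" using assms(8) by (simp add: d_def)
  have cT: "card T = r"
  proof -
    have "inj_on \<sigma> {1..r}"
      using \<sigma>(1) rd by (intro inj_on_subset[OF bij_betw_imp_inj_on]) auto
    then show ?thesis unfolding T_def by (simp add: card_image)
  qed
  have cTc: "real (card (- T)) = real d - real r"
    using rd by (simp add: Compl_eq_Diff_UNIV card_Diff_subset cT d_def of_nat_diff)
  define lo where "lo = lam d"
  define l where "l = lam (r + 1)"
  define hi where "hi = lam 1"
  have ex: "\<exists>k\<in>{1..d}. i = \<sigma> k" for i using \<sigma>(1) by (auto simp: bij_betw_def)
  have lo_le: "lo \<le> evl i" for i
  proof -
    obtain k where "k \<in> {1..d}" "i = \<sigma> k" using ex by blast
    then show ?thesis using \<sigma>(2) mono[of k d] d by (auto simp: lo_def)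
  qed
  have hi_ge: "evl i \<le> hi" for i
  proof -
    obtain k where "k \<in> {1..d}" "i = \<sigma> k" using ex by blast
    then show ?thesis using \<sigma>(2) mono[of 1 k] d by (auto simp: hi_def)
  qed
  have l_ge: "evl i \<le> l" if "i \<notin> T" for i
  proof -
    obtain k where k: "k \<in> {1..d}" "i = \<sigma> k" using ex by blast
    with that have "r + 1 \<le> k" by (force simp: T_def)
    then show ?thesis using \<sigma>(2) mono[of "r + 1" k] k by (auto simp: l_def)
  qed
  have lo0: "0 < lo" using \<sigma>(2)[of d] pos[of "\<sigma> d"] d by (simp add: lo_def)
  have lol: "lo \<le> l" using mono[of "r + 1" d] rd by (simp add: lo_def l_def)
  have hi0: "0 < hi" using lo0 lo_le[of "\<sigma> 1"] hi_ge[of "\<sigma> 1"] by linarith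
  have bm: "b k \<in> borel_measurable M" if "k \<in> {1..m}" for k
    using assms(5) that std_gaussian_vector_measurable by blast

  define q where "q = nat \<lceil>ln (real m / \<delta>) / ln 100\<rceil>"
  have m1: "1 \<le> m"
  proof (rule ccontr)
    assume "\<not> 1 \<le> m"
    then have "m = 0" by simp
    with assms(9) show False by simp
  qed
  have "1 < real m / \<delta>" using m1 assms(6,7) by (simp add: field_simps)
  then have "0 < ln (real m / \<delta>) / ln 100" by simp
  then have qc: "0 < q" "real q = of_int \<lceil>ln (real m / \<delta>) / ln 100\<rceil>"
    by (simp_all add: q_def)
  have "real q * (real r + 2) \<le> real q * ((real m - 1) * inverse (real q))"
  proof (rule mult_left_mono)
    show "real r + 2 \<le> (real m - 1) * inverse (real q)" using assms(9) unfolding qc(2) by linarith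
  qed simp
  also have "\<dots> = real m - 1" using qc(1) by simp
  finally have "real (q * (r + 2)) \<le> real m" by (simp add: algebra_simps)
  then have qm: "q * (r + 2) \<le> m" by linarith
  have qd: "(1 / 100) ^ q \<le> \<delta>"
  proof -
    have "ln (real m / \<delta>) / ln 100 \<le> real q" unfolding qc(2) by (rule le_of_int_ceiling)
    then have "ln (real m / \<delta>) \<le> real q * ln 100" by (simp add: field_simps)
    then have "exp (ln (real m / \<delta>)) \<le> exp (real q * ln 100)" by simp
    moreover have "exp (ln (real m / \<delta>)) = real m / \<delta>" using m1 assms(6) by simp
    moreover have "exp (real q * ln 100) = (100::real) ^ q" by (simp add: exp_of_nat_mult)
    ultimately have "real m / \<delta> \<le> 100 ^ q" by simp
    moreover have "1 / \<delta> \<le> real m / \<delta>" using m1 assms(6) by (intro divide_right_mono) auto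
    ultimately have "1 / \<delta> \<le> 100 ^ q" by linarith
    then show ?thesis using assms(6) by (simp add: power_divide field_simps)
  qed

  \<comment> \<open>The type \<open>'d option\<close> has \<open>d + 1 \<ge> r + 2\<close> elements, enough to index the vectors of a group.\<close>
  have "r + 2 \<le> card (UNIV :: 'd option set)" using assms(8) by (simp add: card_UNIV_option)
  then obtain S :: "'d option set" where cS: "card S = r + 2"
    by (metis obtain_subset_with_card_n)
  have "card ({..<q} \<times> S) \<le> card {1..m}" using qm by (simp add: card_cartesian_product cS)
  then obtain e' where e': "inj_on e' ({..<q} \<times> S)" "e' ` ({..<q} \<times> S) \<subseteq> {1..m}"
    using card_le_inj[of "{..<q} \<times> S" "{1..m}"] by auto
  define e where "e = (\<lambda>l s. e' (l, s))"
  have e: "inj_on (\<lambda>(l, s). e l s) ({..<q} \<times> S)" "\<And>l s. l < q \<Longrightarrow> s \<in> S \<Longrightarrow> e l s \<in> {1..m}"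
    using e' by (auto simp: e_def case_prod_eta image_subset_iff)
  define Bad where "Bad = {\<omega> \<in> space M. \<forall>l<q. (\<lambda>i. pad S (\<lambda>s. V i \<bullet> b (e l s) \<omega>)) \<in> bad_rows S T}"
  have card: "card T + 2 \<le> card S" by (simp add: cT cS)
  have gs: "std_gaussian_vector (b k)" if "k \<in> {1..m}" for k using assms(5) that by blast
  note Bad = prob_all_groups_bad[OF V(1) card assms(4) gs qc(1) e, folded Bad_def]

  define rhs where "rhs = ln (16 * (hi / lo)) * exp (- ((real t - (2 + ln (real d) / 2)) / (3 * sqrt (l / lo))))"
  define Good where "Good = {\<omega> \<in> space M. \<forall>i\<in>{1..m}.
      norm (matrix_sqrt A *v b i \<omega> - bsq A m (\<lambda>k. b k \<omega>) t i)
        / (spectral_norm (matrix_sqrt A) * norm (b i \<omega>)) \<le> rhs}"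
  have Good: "Good \<in> events"
  proof -
    have "{\<omega> \<in> space M. norm (matrix_sqrt A *v b i \<omega> - bsq A m (\<lambda>k. b k \<omega>) t i)
        / (spectral_norm (matrix_sqrt A) * norm (b i \<omega>)) \<le> rhs} \<in> events" if i: "i \<in> {1..m}" for i
    proof -
      have "(\<lambda>\<omega>. matrix_sqrt A *v b i \<omega>) \<in> borel_measurable M"
        by (rule measurable_matrix_vector_mult[OF borel_measurable_const bm[OF i]])
      moreover have "(\<lambda>\<omega>. bsq A m (\<lambda>k. b k \<omega>) t i) \<in> borel_measurable M"
        by (rule measurable_bsq[where b = b, OF A bm i])
      ultimately have n: "(\<lambda>\<omega>. norm (matrix_sqrt A *v b i \<omega> - bsq A m (\<lambda>k. b k \<omega>) t i)) \<in> borel_measurable M"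
        by (rule measurable_compose[OF borel_measurable_diff borel_measurable_norm])
      have "(\<lambda>\<omega>. norm (matrix_sqrt A *v b i \<omega> - bsq A m (\<lambda>k. b k \<omega>) t i)
          / (spectral_norm (matrix_sqrt A) * norm (b i \<omega>))) \<in> borel_measurable M"
        by (rule borel_measurable_divide[OF n borel_measurable_times[OF borel_measurable_const
              measurable_compose[OF bm[OF i] borel_measurable_norm]]])
      from borel_measurable_le[OF this borel_measurable_const] show ?thesis .
    qed
    then show ?thesis unfolding Good_def by (intro sets.sets_Collect_finite_All) auto
  qed
  have pointwise: "\<omega> \<in> Good" if \<omega>: "\<omega> \<in> space M" "\<omega> \<notin> Bad" for \<omega>
  proof -
    obtain k where k: "k < q" "(\<lambda>i. pad S (\<lambda>s. V i \<bullet> b (e k s) \<omega>)) \<notin> bad_rows S T"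
      using \<omega> by (auto simp: Bad_def)
    obtain y where y: "\<And>j. j \<in> T \<Longrightarrow> y j \<in> span ((\<lambda>s. b (e k s) \<omega>) ` S)"
      "\<And>i j. i \<in> T \<Longrightarrow> j \<in> T \<Longrightarrow> V i \<bullet> y j = of_bool (i = j)"
      "(\<Sum>i\<in>-T. \<Sum>j\<in>T. (V i \<bullet> y j)\<^sup>2) \<le> 100 * (real (card T) * real (card (-T)))"
      by (rule dual_combinations_of_good_rows[OF k(2)]) (rule that)
    have small: "(\<Sum>i\<in>-T. \<Sum>j\<in>T. (V i \<bullet> y j)\<^sup>2) \<le> 25 * (real CARD('d))\<^sup>2"
    proof -
      have "0 \<le> (real d - 2 * real r)\<^sup>2" by simp
      then have "100 * (real r * (real d - real r)) \<le> 25 * (real d)\<^sup>2"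
        by (simp add: power2_eq_square algebra_simps)
      then show ?thesis using y(3) by (simp add: cT cTc d_def)
    qed
    have "(\<lambda>s. b (e k s) \<omega>) ` S \<subseteq> (\<lambda>k. b k \<omega>) ` {1..m}" using e(2)[OF k(1)] by blast
    then have yF: "y j \<in> span ((\<lambda>k. b k \<omega>) ` {1..m})" if "j \<in> T" for j
      using y(1)[OF that] span_mono by blast
    have "norm (matrix_sqrt A *v b i \<omega> - bsq A m (\<lambda>k. b k \<omega>) t i)
        / (spectral_norm (matrix_sqrt A) * norm (b i \<omega>)) \<le> rhs" if i: "i \<in> {1..m}" for i
    proof -
      let ?e = "norm (matrix_sqrt A *v b i \<omega> - bsq A m (\<lambda>k. b k \<omega>) t i)"
      have bound: "?e \<le> rhs * (sqrt hi * norm (b i \<omega>))"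
        unfolding rhs_def d_def
        by (rule bsq_error_bound[where T = T and y = y and V = V and evl = evl and b = "\<lambda>k. b k \<omega>",
              OF A V lo0 lo_le l_ge lol hi_ge y(2) small yF i])
      have sn: "sqrt hi \<le> spectral_norm (matrix_sqrt A)"
      proof (rule spectral_norm_ge_eigenvalue)
        show "matrix_sqrt A *v V (\<sigma> 1) = sqrt hi *\<^sub>R V (\<sigma> 1)"
          using matrix_sqrt_eigen(1)[OF V pos, of "\<sigma> 1"] \<sigma>(2)[of 1] d by (simp add: hi_def)
        have "V (\<sigma> 1) \<bullet> V (\<sigma> 1) = 1" using V(1) by (simp add: orthonormal_family_def)
        then show "V (\<sigma> 1) \<noteq> 0" by auto
      qed
      have rhs0: "0 \<le> rhs"
      proof -
        have "1 \<le> hi / lo" using lo0 lo_le[of "\<sigma> 1"] hi_ge[of "\<sigma> 1"] by simp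
        then show ?thesis unfolding rhs_def by (intro mult_nonneg_nonneg) auto
      qed
      show ?thesis
      proof (cases "b i \<omega> = 0")
        case True
        then show ?thesis using rhs0 by simp
      next
        case False
        have p: "0 < sqrt hi * norm (b i \<omega>)" using False hi0 by simp
        have le: "sqrt hi * norm (b i \<omega>) \<le> spectral_norm (matrix_sqrt A) * norm (b i \<omega>)"
          by (rule mult_right_mono[OF sn norm_ge_zero])
        have "?e / (spectral_norm (matrix_sqrt A) * norm (b i \<omega>)) \<le> ?e / (sqrt hi * norm (b i \<omega>))"
          by (rule divide_left_mono[OF le norm_ge_zero mult_pos_pos[OF less_le_trans[OF p le] p]])
        also have "\<dots> \<le> rhs" using bound p by (simp add: pos_divide_le_eq)
        finally show ?thesis .
      qed
    qed
    then show ?thesis using \<omega>(1) by (simp add: Good_def)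
  qed
  have "1 - \<delta> \<le> 1 - prob Bad" using Bad(1) qd by simp
  also have "\<dots> = prob (space M - Bad)" using Bad(2) by (simp add: prob_compl)
  also have "\<dots> \<le> prob Good" by (rule finite_measure_mono[OF _ Good]) (use pointwise in auto)
  finally show ?thesis
    unfolding Good_def rhs_def by (simp add: shifted_cond_def hi_def lo_def l_def d_def)
qed

end
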